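(* Let $n,d\in\mathbb{N}$ and $\varepsilon,\alpha>0$. Let $D_0=\mathcal{N}(0,1)^{\otimes nd}$ (i.e., $X_1,\dots,X_n$ i.i.d. $\mathcal{N}(0,I_d)$), and let $D_1$ be the distribution obtained by first sampling a uniformly random unit vector $v\in\mathbb{R}^d$ and then drawing $n$ i.i.d. vectors $X_1,\dots,X_n$ from $(1-\varepsilon)\mathcal{N}(\alpha v,I)+\varepsilon\,\mathcal{N}(-\alpha(1-\varepsilon)\varepsilon^{-1}v,I)$. For $D\in\mathbb{N}$, $D>1$, let $L^{\le D}$ be the degree-$D$ truncated likelihood ratio of $D_1$ with respect to $D_0$. Then \[ \|L^{\le D}-1\|\le D^{O(D)}\cdot\frac{\sqrt n\,\alpha^2}{\sqrt d\,\varepsilon}\cdot\exp\!\left(\frac{\sqrt n\,\alpha^2}{\sqrt d\,\varepsilon}+\frac{\alpha^2}{\sqrt d\,\varepsilon^2}\right). \] Consequently, if $n\le o\!\left(D^{-O(D)}\cdot\frac{d\varepsilon^2}{\alpha^4}\right)$ and $n\ge\sqrt d/\alpha^2$, then $\|L^{\le D}-1\|\le o(1)$.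
   Context: The degree-$D$ truncated likelihood ratio $L^{\le D}$ is the orthogonal projection, in $L^2(D_0)$, of the likelihood ratio $dD_1/dD_0$ onto the space of polynomials of degree at most $D$ in the $nd$ coordinates of $(X_1,\dots,X_n)$; the norm $\|\cdot\|$ is the $L^2(D_0)$ norm. The constants in $O(D)$ are absolute. *)

theory Defs
  imports "HOL-Probability.Probability" "HOL-Library.Landau_Symbols"
begin

text \<open>
  Since \<open>n\<close> and \<open>d\<close> are quantified inside the statement (the constants must not depend on them),
  \<open>\<real>\<^sup>d\<close> is represented by functions on \<open>{..<d}\<close> and a sample \<open>(X\<^sub>1, \<dots>, X\<^sub>n)\<close> by
  \<open>X :: nat \<Rightarrow> nat \<Rightarrow> real\<close> with \<open>X i j\<close> the \<open>j\<close>-th coordinate of the \<open>i\<close>-th vector.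
\<close>

definition gaussian :: "nat \<Rightarrow> (nat \<Rightarrow> real) \<Rightarrow> (nat \<Rightarrow> real) measure" where
  "gaussian d \<mu> = (\<Pi>\<^sub>M j\<in>{..<d}. density lborel (\<lambda>x. ennreal (normal_density (\<mu> j) 1 x)))"

text \<open>
  The uniform distribution on the unit sphere as normalized surface measure, where the surface
  measure of \<open>E\<close> is, up to the factor \<open>d\<close>, the volume of the cone \<open>{r x | 0 < r \<le> 1, x \<in> E}\<close>:
  the radial projection of the uniform distribution on the unit ball. (The origin, where the radial
  projection is not defined, is a null set for \<open>d \<ge> 1\<close>.)
\<close>

definition uniform_sphere :: "nat \<Rightarrow> (nat \<Rightarrow> real) measure" where
  "uniform_sphere d =
     distr (uniform_measure (\<Pi>\<^sub>M j\<in>{..<d}. lborel)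
              {x \<in> space (\<Pi>\<^sub>M j\<in>{..<d}. lborel). L2_set x {..<d} \<le> 1})
           (\<Pi>\<^sub>M j\<in>{..<d}. borel)
           (\<lambda>x. \<lambda>j\<in>{..<d}. x j / L2_set x {..<d})"

text \<open>
  The mixture \<open>(1 - \<epsilon>) N(\<alpha> v, I) + \<epsilon> N(- \<alpha> (1 - \<epsilon>) \<epsilon>\<^sup>-\<^sup>1 v, I)\<close>, for \<open>0 < \<epsilon> \<le> 1\<close>.
\<close>

definition mixture :: "nat \<Rightarrow> real \<Rightarrow> real \<Rightarrow> (nat \<Rightarrow> real) \<Rightarrow> (nat \<Rightarrow> real) measure" where
  "mixture d \<epsilon> \<alpha> v =
     measure_pmf (bernoulli_pmf \<epsilon>) \<bind>
       (\<lambda>b. if b then gaussian d (\<lambda>j. - \<alpha> * (1 - \<epsilon>) / \<epsilon> * v j) else gaussian d (\<lambda>j. \<alpha> * v j))"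

definition null_dist :: "nat \<Rightarrow> nat \<Rightarrow> (nat \<Rightarrow> nat \<Rightarrow> real) measure" where
  "null_dist n d = (\<Pi>\<^sub>M i\<in>{..<n}. gaussian d (\<lambda>_. 0))"

definition alt_dist :: "nat \<Rightarrow> nat \<Rightarrow> real \<Rightarrow> real \<Rightarrow> (nat \<Rightarrow> nat \<Rightarrow> real) measure" where
  "alt_dist n d \<epsilon> \<alpha> = uniform_sphere d \<bind> (\<lambda>v. \<Pi>\<^sub>M i\<in>{..<n}. mixture d \<epsilon> \<alpha> v)"

definition likelihood_ratio :: "'a measure \<Rightarrow> 'a measure \<Rightarrow> 'a \<Rightarrow> real" where
  "likelihood_ratio M N x = enn2real (RN_deriv M N x)"

definition polynomials_upto :: "nat \<Rightarrow> nat \<Rightarrow> nat \<Rightarrow> ((nat \<Rightarrow> nat \<Rightarrow> real) \<Rightarrow> real) set" where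
  "polynomials_upto n d D =
     {p. \<exists>S c. finite S \<and> (\<forall>m\<in>S. (\<Sum>i<n. \<Sum>j<d. m i j) \<le> D) \<and>
           p = (\<lambda>X. \<Sum>m\<in>S. c m * (\<Prod>i<n. \<Prod>j<d. X i j ^ (m i j :: nat)))}"

definition square_integrable :: "'a measure \<Rightarrow> ('a \<Rightarrow> real) \<Rightarrow> bool" where
  "square_integrable M f \<longleftrightarrow> f \<in> borel_measurable M \<and> integrable M (\<lambda>x. (f x)\<^sup>2)"

definition L2_norm :: "'a measure \<Rightarrow> ('a \<Rightarrow> real) \<Rightarrow> real" where
  "L2_norm M f = sqrt (\<integral>x. (f x)\<^sup>2 \<partial>M)"

definition is_L2_projection ::
    "'a measure \<Rightarrow> ('a \<Rightarrow> real) set \<Rightarrow> ('a \<Rightarrow> real) \<Rightarrow> ('a \<Rightarrow> real) \<Rightarrow> bool" where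
  "is_L2_projection M V f p \<longleftrightarrow>
     square_integrable M f \<and> (\<forall>q\<in>V. square_integrable M q) \<and>
     p \<in> V \<and> (\<forall>q\<in>V. (\<integral>x. (f x - p x) * q x \<partial>M) = 0)"

text \<open>The projection is determined up to a null set, so the choice made here is immaterial.\<close>

definition L2_projection ::
    "'a measure \<Rightarrow> ('a \<Rightarrow> real) set \<Rightarrow> ('a \<Rightarrow> real) \<Rightarrow> 'a \<Rightarrow> real" where
  "L2_projection M V f = (SOME p. is_L2_projection M V f p)"

definition truncated_LR ::
    "nat \<Rightarrow> nat \<Rightarrow> real \<Rightarrow> real \<Rightarrow> nat \<Rightarrow> (nat \<Rightarrow> nat \<Rightarrow> real) \<Rightarrow> real" where
  "truncated_LR n d \<epsilon> \<alpha> D =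
     L2_projection (null_dist n d) (polynomials_upto n d D)
       (likelihood_ratio (null_dist n d) (alt_dist n d \<epsilon> \<alpha>))"

end

theory Submission
  imports Defs "HOL-Computational_Algebra.Polynomial"
begin

text \<open>
  Products of normalized Hermite polynomials form an orthonormal basis of the polynomials of degree
  at most \<open>D\<close>, so \<open>\<parallel>L\<^bsup>\<le>D\<^esup> - 1\<parallel>\<^sup>2\<close> is the sum over multi-indices \<open>0 < |m| \<le> D\<close> of the squared
  Hermite coefficients of \<open>L\<close>. The coefficient at \<open>m\<close> is the average over the direction \<open>v\<close> of
  \<open>\<Prod>\<^sub>i \<kappa>(|m\<^sub>i|) v\<^bsup>m\<^sub>i\<^esup> / \<surd>(m\<^sub>i!)\<close>, where \<open>\<kappa>(s) = (1 - \<epsilon>) \<alpha>\<^sup>s + \<epsilon> (- \<alpha> (1 - \<epsilon>) / \<epsilon>)\<^sup>s\<close> satisfies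
  \<open>\<kappa>(0) = 1\<close>, \<open>\<kappa>(1) = 0\<close> and \<open>\<kappa>(s)\<^sup>2 \<le> \<epsilon>\<^sup>2 (\<alpha>\<^sup>2 / \<epsilon>\<^sup>2)\<^sup>s\<close> for \<open>s \<ge> 2\<close>. Squaring by means of an
  independent copy \<open>w\<close> of \<open>v\<close> and using the multinomial theorem, the terms with \<open>|m| = k\<close> sum to
  \<open>W\<^sub>k E \<langle>v, w\<rangle>\<^sup>k\<close>, where \<open>W\<^sub>k\<close> is the coefficient of \<open>z\<^sup>k\<close> in \<open>(\<Sum>\<^sub>s \<kappa>(s)\<^sup>2 z\<^sup>s / s!)\<^sup>n\<close>.

  Comparison with a Gaussian vector gives \<open>E |\<langle>v, w\<rangle>|\<^sup>k \<le> 4 k! d\<^bsup>-k/2\<^esup>\<close>. Since all the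
  coefficients are nonnegative, \<open>W\<^sub>k z\<^sup>k\<close> is at most the value of the generating function at \<open>z\<close>
  minus 1; with \<open>A = \<surd>n \<alpha>\<^sup>2 / (\<surd>d \<epsilon>)\<close> and \<open>B = \<alpha>\<^sup>2 / (\<surd>d \<epsilon>\<^sup>2)\<close>, the choice
  \<open>z = 1 / (\<surd>d (A + B))\<close> yields \<open>W\<^sub>k d\<^bsup>-k/2\<^esup> \<le> D e\<^sup>D A\<^sup>2 (A + B)\<^bsup>k-2\<^esup>\<close>. Under the hypotheses of the
  second claim, \<open>B \<le> A\<^sup>2\<close>.
\<close>

section \<open>Hermite polynomials and the standard normal distribution\<close>

definition std_normal :: "real measure" where
  "std_normal = density lborel (\<lambda>x. ennreal (normal_density 0 1 x))"

lemma prob_space_std_normal: "prob_space std_normal"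
  unfolding std_normal_def by (rule prob_space_normal_density) simp

lemma sets_std_normal [simp, measurable_cong]: "sets std_normal = sets borel"
  and space_std_normal [simp]: "space std_normal = UNIV"
  by (simp_all add: std_normal_def)

lemma integrable_std_normal_iff:
  fixes f :: "real \<Rightarrow> real"
  shows "f \<in> borel_measurable borel \<Longrightarrow>
    integrable std_normal f \<longleftrightarrow> integrable lborel (\<lambda>x. std_normal_density x * f x)"
  unfolding std_normal_def by (subst integrable_density) auto

lemma integral_std_normal:
  fixes f :: "real \<Rightarrow> real"
  shows "f \<in> borel_measurable borel \<Longrightarrow>
    integral\<^sup>L std_normal f = (\<integral>x. std_normal_density x * f x \<partial>lborel)"
  unfolding std_normal_def by (subst integral_density) auto

lemma borel_measurable_poly [measurable]: "poly (q :: real poly) \<in> borel_measurable borel"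
  by (intro borel_measurable_continuous_onI continuous_intros)

lemma integrable_std_normal_power: "integrable std_normal (\<lambda>x. x ^ k)"
  using integrable_std_normal_moment[of k] by (subst integrable_std_normal_iff) auto

lemma integrable_std_normal_poly: "integrable std_normal (poly q)"
  unfolding poly_altdef
  by (intro Bochner_Integration.integrable_sum integrable_mult_right integrable_std_normal_power)

text \<open>Gaussian integration by parts, \<open>E[X q(X)] = E[q'(X)]\<close>, where
  \<open>pCons 0 q\<close> is the polynomial \<open>x q(x)\<close>. By linearity only monomials
  matter, and there it is a recursion between the explicit moments.\<close>

lemma std_normal_stein:
  "(\<integral>x. poly (pCons 0 q) x \<partial>std_normal) = (\<integral>x. poly (pderiv q) x \<partial>std_normal)"
proof -
  note power = integrable_std_normal_power
  \<comment> \<open>At \<open>k = 0\<close> the truncated difference \<open>k - 1\<close> is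
    harmless because the factor \<open>real k\<close> vanishes.\<close>
  have mom: "(\<integral>x. x ^ Suc k \<partial>std_normal) = real k * (\<integral>x. x ^ (k - 1) \<partial>std_normal)" for k
  proof (cases "even k")
    case True
    then obtain j where j: "k = 2 * j" by (auto elim: evenE)
    have "(\<integral>x. x ^ Suc k \<partial>std_normal) = 0"
      using integral_std_normal_moment_odd[of j] by (simp add: integral_std_normal j)
    moreover have "real k * (\<integral>x. x ^ (k - 1) \<partial>std_normal) = 0"
    proof (cases j)
      case (Suc i)
      then show ?thesis
        using integral_std_normal_moment_odd[of i] by (simp add: integral_std_normal j)
    qed (simp add: j)
    ultimately show ?thesis by simp
  next
    case False
    then obtain j where j: "k = 2 * j + 1" by (auto elim: oddE)
    have "(\<integral>x. x ^ Suc k \<partial>std_normal) = fact (2 * Suc j) / (2 ^ Suc j * fact (Suc j))"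
      using integral_std_normal_moment_even[of "Suc j"] by (simp add: integral_std_normal j)
    also have "\<dots> = (2 * real (Suc j)) * (real k * fact (2 * j)) / ((2 * 2 ^ j) * (real (Suc j) * fact j))"
      by (simp add: j algebra_simps)
    also have "\<dots> = real k * (fact (2 * j) / (2 ^ j * fact j))"
      by (simp del: of_nat_Suc)
    also have "fact (2 * j) / (2 ^ j * fact j) = (\<integral>x. x ^ (k - 1) \<partial>std_normal)"
      using integral_std_normal_moment_even[of j] by (simp add: integral_std_normal j)
    finally show ?thesis .
  qed
  have "(\<integral>x. poly (pCons 0 q) x \<partial>std_normal)
      = (\<integral>x. (\<Sum>i\<le>degree q. coeff q i * x ^ Suc i) \<partial>std_normal)"
    by (subst poly_pCons) (simp add: poly_altdef sum_distrib_left mult_ac)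
  also have "\<dots> = (\<Sum>i\<le>degree q. coeff q i * (\<integral>x. x ^ Suc i \<partial>std_normal))"
    using power by (simp add: Bochner_Integration.integral_sum del: power_Suc)
  also have "\<dots> = (\<Sum>i\<le>degree q. coeff q i * (real i * (\<integral>x. x ^ (i - 1) \<partial>std_normal)))"
    by (simp only: mom)
  also have "\<dots> = (\<integral>x. (\<Sum>i\<le>degree q. coeff q i * (real i * x ^ (i - 1))) \<partial>std_normal)"
    using power by (simp add: Bochner_Integration.integral_sum)
  \<comment> \<open>Both sides are derivatives of the same function; uniqueness of the derivative
    replaces an index shift in the coefficients.\<close>
  also have "(\<lambda>x. \<Sum>i\<le>degree q. coeff q i * (real i * x ^ (i - 1))) = poly (pderiv q)"
  proof
    fix x
    have "((\<lambda>x. \<Sum>i\<le>degree q. coeff q i * x ^ i) has_real_derivative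
           (\<Sum>i\<le>degree q. coeff q i * (real i * x ^ (i - 1)))) (at x)"
      by (auto intro!: derivative_eq_intros sum.cong)
    moreover have "((\<lambda>x. \<Sum>i\<le>degree q. coeff q i * x ^ i) has_real_derivative
           poly (pderiv q) x) (at x)"
      unfolding poly_altdef[symmetric] by (rule poly_DERIV)
    ultimately show "(\<Sum>i\<le>degree q. coeff q i * (real i * x ^ (i - 1))) = poly (pderiv q) x"
      by (rule DERIV_unique)
  qed
  finally show ?thesis .
qed

text \<open>The monic (probabilists') Hermite polynomials. The recursion
  \<open>x He_a - He_a'\<close> is the form to which Stein's identity applies directly.\<close>

primrec hermite :: "nat \<Rightarrow> real poly" where
  "hermite 0 = 1"
| "hermite (Suc a) = pCons 0 (hermite a) - pderiv (hermite a)"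

text \<open>Differentiating the recursion leaves \<open>He_(a+1)\<close> plus
  \<open>x p - p'\<close> with \<open>p\<close> the derivative of \<open>He_(a+1)\<close>; by
  induction \<open>p\<close> is a multiple of \<open>He_a\<close>, so the recursion closes up
  again.\<close>

lemma pderiv_hermite: "pderiv (hermite (Suc a)) = smult (real (Suc a)) (hermite a)"
proof (induction a)
  case 0
  then show ?case by (simp add: pderiv_diff pderiv_pCons)
next
  case (Suc a)
  have "pderiv (hermite (Suc (Suc a)))
      = hermite (Suc a) + pCons 0 (pderiv (hermite (Suc a))) - pderiv (pderiv (hermite (Suc a)))"
    by (subst hermite.simps) (simp only: pderiv_diff pderiv_pCons)
  also have "\<dots> = hermite (Suc a) + smult (real (Suc a)) (hermite (Suc a))"
    unfolding Suc.IH by (simp add: pderiv_smult smult_diff_right)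
  also have "\<dots> = smult (1 + real (Suc a)) (hermite (Suc a))"
    by (simp only: smult_add_left smult_1_left)
  finally show ?case by (simp only: of_nat_Suc)
qed

lemma hermite_degree: "degree (hermite a) = a \<and> lead_coeff (hermite a) = 1"
proof (induction a)
  case (Suc a)
  then have nz: "hermite a \<noteq> 0" by auto
  have "degree (pderiv (hermite a)) < degree (pCons 0 (hermite a))"
    using nz by (simp add: degree_pderiv)
  then have "degree (hermite (Suc a)) = degree (pCons 0 (hermite a))"
    by (simp add: degree_add_eq_left[of "- _", simplified])
  moreover have "coeff (pderiv (hermite a)) (Suc a) = 0"
    using Suc by (intro coeff_eq_0) (simp add: degree_pderiv)
  moreover have "coeff (hermite a) a = 1"
    using Suc by metis
  ultimately show ?case using Suc nz by simp
qed simp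

text \<open>Composition with \<open>[:\<mu>, 1:]\<close> is translation by \<open>\<mu>\<close>, so
  this is the mean of \<open>He_a\<close> under \<open>N(\<mu>, 1)\<close>. Translating the
  recursion adds the term \<open>\<mu> He_a(x + \<mu>)\<close>; the rest has mean zero by Stein's
  identity.\<close>

lemma hermite_integral_shift:
  "(\<integral>x. poly (hermite a \<circ>\<^sub>p [:\<mu>, 1:]) x \<partial>std_normal) = \<mu> ^ a"
proof (induction a)
  case 0
  interpret prob_space std_normal by (rule prob_space_std_normal)
  show ?case using prob_space by (simp add: pcompose_1)
next
  case (Suc a)
  let ?h = "hermite a \<circ>\<^sub>p [:\<mu>, 1:]"
  have "hermite (Suc a) \<circ>\<^sub>p [:\<mu>, 1:] = smult \<mu> ?h + (pCons 0 ?h - pderiv ?h)"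
    by (simp add: pcompose_diff pcompose_pCons pderiv_pcompose pderiv_pCons)
  then have "(\<integral>x. poly (hermite (Suc a) \<circ>\<^sub>p [:\<mu>, 1:]) x \<partial>std_normal)
     = (\<integral>x. \<mu> * poly ?h x + (poly (pCons 0 ?h) x - poly (pderiv ?h) x) \<partial>std_normal)"
    by (simp only: poly_add poly_smult poly_diff)
  also have "\<dots> = \<mu> * (\<integral>x. poly ?h x \<partial>std_normal)
      + ((\<integral>x. poly (pCons 0 ?h) x \<partial>std_normal) - (\<integral>x. poly (pderiv ?h) x \<partial>std_normal))"
    by (simp del: poly_pCons add: integrable_std_normal_poly)
  also have "\<dots> = \<mu> ^ Suc a" by (simp add: std_normal_stein Suc del: poly_pCons)
  finally show ?case .
qed

text \<open>Stein's identity applied to \<open>He_a He_b\<close> moves the recursion step from one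
  factor to a derivative on the other, and \<open>He_b' = b He_(b-1)\<close> lowers both indices.
  The base case is the shift formula at \<open>\<mu> = 0\<close>.\<close>

lemma hermite_orthogonal:
  "(\<integral>x. poly (hermite a) x * poly (hermite b) x \<partial>std_normal) = (if a = b then fact a else 0)"
proof (induction a arbitrary: b)
  case 0
  have "(\<integral>x. poly (hermite b) x \<partial>std_normal) = 0 ^ b"
    using hermite_integral_shift[of b 0] by simp
  then show ?case by (cases b) auto
next
  case (Suc a)
  have "(\<integral>x. poly (hermite (Suc a)) x * poly (hermite b) x \<partial>std_normal)
      = (\<integral>x. poly (pCons 0 (hermite a * hermite b)) x
              - poly (pderiv (hermite a) * hermite b) x \<partial>std_normal)"
    by (simp add: algebra_simps)
  also have "\<dots> = (\<integral>x. poly (pCons 0 (hermite a * hermite b)) x \<partial>std_normal)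
      - (\<integral>x. poly (pderiv (hermite a) * hermite b) x \<partial>std_normal)"
    by (intro Bochner_Integration.integral_diff integrable_std_normal_poly)
  also have "\<dots> = (\<integral>x. poly (pderiv (hermite a * hermite b)) x
      - poly (pderiv (hermite a) * hermite b) x \<partial>std_normal)"
    unfolding std_normal_stein
    by (intro Bochner_Integration.integral_diff[symmetric] integrable_std_normal_poly)
  also have "\<dots> = (\<integral>x. poly (hermite a) x * poly (pderiv (hermite b)) x \<partial>std_normal)"
    by (simp add: pderiv_mult algebra_simps)
  also have "\<dots> = (if Suc a = b then fact (Suc a) else 0)"
  proof (cases b)
    case (Suc c)
    have "(\<integral>x. poly (hermite a) x * poly (pderiv (hermite b)) x \<partial>std_normal)
        = (\<integral>x. real (Suc c) * (poly (hermite a) x * poly (hermite c) x) \<partial>std_normal)"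
      unfolding Suc pderiv_hermite by (simp add: mult_ac)
    then show ?thesis using Suc.IH[of c] Suc by auto
  qed simp
  finally show ?case .
qed

section \<open>Normalized Hermite functions and exponential tilts\<close>

definition hermite_fun :: "nat \<Rightarrow> real \<Rightarrow> real" where
  "hermite_fun a x = poly (hermite a) x / sqrt (fact a)"

lemma hermite_fun_eq_poly: "hermite_fun a = poly (smult (1 / sqrt (fact a)) (hermite a))"
  by (simp add: hermite_fun_def fun_eq_iff)

lemma hermite_fun_0 [simp]: "hermite_fun 0 x = 1"
  by (simp add: hermite_fun_def)

lemma borel_measurable_hermite_fun [measurable]: "hermite_fun a \<in> borel_measurable borel"
  unfolding hermite_fun_eq_poly by (rule borel_measurable_poly)

lemma integrable_hermite_fun_mult:
  "integrable std_normal (\<lambda>x. hermite_fun a x * hermite_fun b x)"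
  unfolding hermite_fun_eq_poly poly_mult[symmetric] by (rule integrable_std_normal_poly)

lemma hermite_fun_orthonormal:
  "(\<integral>x. hermite_fun a x * hermite_fun b x \<partial>std_normal) = of_bool (a = b)"
proof -
  have "(\<integral>x. hermite_fun a x * hermite_fun b x \<partial>std_normal)
    = (\<integral>x. poly (hermite a) x * poly (hermite b) x / (sqrt (fact a) * sqrt (fact b)) \<partial>std_normal)"
    by (simp add: hermite_fun_def)
  also have "\<dots> = (\<integral>x. poly (hermite a) x * poly (hermite b) x \<partial>std_normal)
      / (sqrt (fact a) * sqrt (fact b))" by simp
  finally show ?thesis by (simp add: hermite_orthogonal)
qed

text \<open>The likelihood ratio of \<open>N(\<mu>, 1)\<close> with respect to
  \<open>N(0, 1)\<close>.\<close>

definition tilt :: "real \<Rightarrow> real \<Rightarrow> real" where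
  "tilt \<mu> x = exp (\<mu> * x - \<mu>\<^sup>2 / 2)"

lemma tilt_pos: "tilt \<mu> x > 0"
  by (simp add: tilt_def)

lemma borel_measurable_tilt [measurable]: "tilt \<mu> \<in> borel_measurable borel"
  unfolding tilt_def by measurable

lemma normal_density_eq_tilt: "normal_density \<mu> 1 x = std_normal_density x * tilt \<mu> x"
  by (simp add: normal_density_def tilt_def exp_add[symmetric] power2_eq_square field_simps)

text \<open>Tilting turns \<open>N(0, 1)\<close> into \<open>N(\<mu>, 1)\<close>, and the
  substitution \<open>x = \<mu> + y\<close> moves the shift onto the polynomial.\<close>

lemma tilt_poly_integral:
  "has_bochner_integral std_normal (\<lambda>x. tilt \<mu> x * poly q x)
     (\<integral>x. poly (q \<circ>\<^sub>p [:\<mu>, 1:]) x \<partial>std_normal)"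
proof -
  let ?f = "\<lambda>x. std_normal_density x * (tilt \<mu> x * poly q x)"
  have eq: "(\<lambda>x. ?f (\<mu> + 1 * x)) = (\<lambda>x. std_normal_density x * poly (q \<circ>\<^sub>p [:\<mu>, 1:]) x)"
  proof
    fix x
    have "?f (\<mu> + 1 * x) = normal_density \<mu> 1 (\<mu> + x) * poly q (\<mu> + x)"
      by (simp add: normal_density_eq_tilt[of \<mu>] mult_ac)
    also have "\<dots> = std_normal_density x * poly (q \<circ>\<^sub>p [:\<mu>, 1:]) x"
      by (simp add: normal_density_def poly_pcompose algebra_simps)
    finally show "?f (\<mu> + 1 * x) = std_normal_density x * poly (q \<circ>\<^sub>p [:\<mu>, 1:]) x" .
  qed
  have "integrable lborel (\<lambda>x. ?f (\<mu> + 1 * x))"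
    unfolding eq using integrable_std_normal_poly[of "q \<circ>\<^sub>p [:\<mu>, 1:]"]
    by (subst (asm) integrable_std_normal_iff) auto
  then have "integrable lborel ?f"
    by (subst (asm) lborel_integrable_real_affine_iff) auto
  moreover have "integral\<^sup>L lborel ?f = (\<integral>x. poly (q \<circ>\<^sub>p [:\<mu>, 1:]) x \<partial>std_normal)"
    by (subst lborel_integral_real_affine[where c = 1 and t = \<mu>])
       (simp_all add: eq[simplified] integral_std_normal)
  ultimately show ?thesis
    by (auto simp: has_bochner_integral_iff integrable_std_normal_iff integral_std_normal)
qed

text \<open>The Hermite coefficients of a Gaussian likelihood ratio are monomials in the mean; all
  later coefficient formulas rest on this.\<close>

lemma tilt_hermite_integral:
  "has_bochner_integral std_normal (\<lambda>x. tilt \<mu> x * hermite_fun a x) (\<mu> ^ a / sqrt (fact a))"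
proof -
  have "has_bochner_integral std_normal (\<lambda>x. tilt \<mu> x * poly (hermite a) x / sqrt (fact a))
      (\<mu> ^ a / sqrt (fact a))"
    using tilt_poly_integral[of \<mu> "hermite a"]
    by (intro has_bochner_integral_divide_zero) (simp add: hermite_integral_shift)
  then show ?thesis by (simp add: hermite_fun_def)
qed

lemma tilt_integral: "has_bochner_integral std_normal (tilt \<mu>) 1"
  using tilt_hermite_integral[of \<mu> 0] by simp

text \<open>Since \<open>He_a\<close> is monic of degree \<open>a\<close>, subtracting the right
  multiple of it lowers the degree.\<close>

lemma poly_hermite_expansion:
  "degree q \<le> a \<Longrightarrow> \<exists>c. \<forall>x. poly q x = (\<Sum>b\<le>a. c b * hermite_fun b x)"
proof (induction a arbitrary: q)
  case 0
  then show ?case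
    by (auto elim!: degree_eq_zeroE intro!: exI[of _ "\<lambda>_. coeff q 0"])
next
  case (Suc a)
  let ?q = "q - smult (coeff q (Suc a)) (hermite (Suc a))"
  have "coeff (hermite (Suc a)) (Suc a) = 1"
    using hermite_degree[of "Suc a"] by metis
  then have "coeff ?q (Suc a) = 0" by (simp del: hermite.simps)
  moreover have "degree ?q \<le> Suc a"
    using Suc.prems hermite_degree[of "Suc a"] degree_smult_le[of _ "hermite (Suc a)"]
    by (intro degree_diff_le) auto
  ultimately have "degree ?q \<le> a"
    by (intro degree_le) (metis Suc_lessI coeff_eq_0 le_less_trans)
  then obtain c where c: "poly ?q x = (\<Sum>b\<le>a. c b * hermite_fun b x)" for x
    using Suc.IH by blast
  \<comment> \<open>The square root undoes the normalization in \<open>hermite_fun\<close>.\<close>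
  let ?c = "c(Suc a := coeff q (Suc a) * sqrt (fact (Suc a)))"
  have "poly q x = (\<Sum>b\<le>Suc a. ?c b * hermite_fun b x)" for x
    using c[of x] by (simp add: hermite_fun_def del: hermite.simps fact_Suc)
  then show ?case by blast
qed

section \<open>Generating function of the mixture moments\<close>

lemma prod_monom: "(\<Prod>j\<in>J. monom (c j) (e j)) = monom (\<Prod>j\<in>J. c j) (\<Sum>j\<in>J. e j)"
  by (induction J rule: infinite_finite_induct) (auto simp: mult_monom)

lemma coeff_sum_monom: "s \<le> D \<Longrightarrow> coeff (\<Sum>a\<le>D. monom (c a) a) s = c s"
  by (simp add: coeff_sum)

text \<open>The coefficients of \<open>exp(y_1 z) exp(y_2 z) ... = exp((y_1 + y_2 + ...) z)\<close>.
  Truncating each series at degree \<open>D\<close> leaves the coefficients up to \<open>D\<close>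
  intact; the induction step is the binomial theorem.\<close>

lemma coeff_prod_exp_series:
  fixes y :: "'a \<Rightarrow> real"
  assumes "finite J" "s \<le> D"
  shows "coeff (\<Prod>j\<in>J. \<Sum>a\<le>D. monom (y j ^ a / fact a) a) s = (\<Sum>j\<in>J. y j) ^ s / fact s"
  using assms
proof (induction J arbitrary: s rule: finite_induct)
  case empty
  then show ?case by (cases s) auto
next
  case (insert i J)
  have "coeff (\<Prod>j\<in>insert i J. \<Sum>a\<le>D. monom (y j ^ a / fact a) a) s
      = (\<Sum>b\<le>s. (y i ^ b / fact b) * ((\<Sum>j\<in>J. y j) ^ (s - b) / fact (s - b)))"
    using insert by (simp add: coeff_mult coeff_sum_monom)
  also have "\<dots> = (\<Sum>b\<le>s. real (s choose b) * y i ^ b * (\<Sum>j\<in>J. y j) ^ (s - b)) / fact s"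
    unfolding sum_divide_distrib
    by (intro sum.cong) (auto simp: binomial_fact field_simps)
  also have "\<dots> = (\<Sum>j\<in>insert i J. y j) ^ s / fact s"
    using insert by (simp add: binomial_ring)
  finally show ?case .
qed

text \<open>The contribution of one sample. The exponent of \<open>monom\<close> records the total
  degree, so extracting degree \<open>s\<close> turns the factor \<open>g\<close> into the constant
  \<open>g s\<close> and leaves the multinomial theorem.\<close>

lemma coeff_row_sum:
  fixes y :: "nat \<Rightarrow> real"
  assumes "s \<le> D"
  shows "coeff (\<Sum>r\<in>PiE {..<d} (\<lambda>_. {..D}).
            monom (g (\<Sum>j<d. r j) * (\<Prod>j<d. y j ^ r j / fact (r j))) (\<Sum>j<d. r j)) s
       = g s / fact s * (\<Sum>j<d. y j) ^ s"
proof -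
  have "coeff (\<Sum>r\<in>PiE {..<d} (\<lambda>_. {..D}).
            monom (g (\<Sum>j<d. r j) * (\<Prod>j<d. y j ^ r j / fact (r j))) (\<Sum>j<d. r j)) s
      = g s * coeff (\<Sum>r\<in>PiE {..<d} (\<lambda>_. {..D}).
            monom (\<Prod>j<d. y j ^ r j / fact (r j)) (\<Sum>j<d. r j)) s"
    unfolding coeff_sum coeff_monom sum_distrib_left by (intro sum.cong refl) (simp split: if_split)
  also have "(\<Sum>r\<in>PiE {..<d} (\<lambda>_. {..D}). monom (\<Prod>j<d. y j ^ r j / fact (r j)) (\<Sum>j<d. r j))
      = (\<Prod>j<d. \<Sum>a\<le>D. monom (y j ^ a / fact a) a)"
    by (subst prod_sum_PiE) (auto simp: prod_monom)
  finally show ?thesis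
    using assms by (simp add: coeff_prod_exp_series)
qed

text \<open>Up to degree \<open>D\<close>, \<open>q(z)\<close> agrees with \<open>p(t z)\<close>,
  hence so do the \<open>n\<close>-th powers. The restriction to low degrees matters because the row
  polynomial of \<open>sum_multiindex_eq_coeff\<close> can have terms of degree above
  \<open>D\<close>.\<close>

lemma coeff_power_scale:
  fixes p q :: "real poly"
  assumes "\<And>s. s \<le> D \<Longrightarrow> coeff q s = coeff p s * t ^ s" and "k \<le> D"
  shows "coeff (q ^ n) k = coeff (p ^ n) k * t ^ k"
  using assms(2)
proof (induction n arbitrary: k)
  case (Suc n)
  have "coeff (q ^ Suc n) k = (\<Sum>i\<le>k. (coeff p i * t ^ i) * (coeff (p ^ n) (k - i) * t ^ (k - i)))"
    using Suc assms(1) by (auto simp: coeff_mult intro!: sum.cong)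
  also have "\<dots> = (\<Sum>i\<le>k. coeff p i * coeff (p ^ n) (k - i) * t ^ k)"
  proof (intro sum.cong refl)
    fix i assume "i \<in> {..k}"
    then have "t ^ k = t ^ i * t ^ (k - i)" by (simp flip: power_add)
    then show "(coeff p i * t ^ i) * (coeff (p ^ n) (k - i) * t ^ (k - i))
        = coeff p i * coeff (p ^ n) (k - i) * t ^ k" by simp
  qed
  finally show ?case by (simp add: coeff_mult sum_distrib_right)
qed (auto intro: gr0I)

definition weight_poly :: "(nat \<Rightarrow> real) \<Rightarrow> nat \<Rightarrow> real poly" where
  "weight_poly \<kappa> D = (\<Sum>s\<le>D. monom ((\<kappa> s)\<^sup>2 / fact s) s)"

text \<open>Marking each multi-index by \<open>z^|m|\<close> removes the constraint on the total
  degree: the sum over the whole box factors into \<open>n\<close> equal row polynomials, each of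
  which agrees up to degree \<open>D\<close> with \<open>weight_poly\<close> at \<open>z\<close>
  times the sum of the \<open>y j\<close>.\<close>

lemma sum_multiindex_eq_coeff:
  fixes y :: "nat \<Rightarrow> real"
  assumes "k \<le> D"
  shows "(\<Sum>m\<in>{m \<in> PiE {..<n} (\<lambda>_. PiE {..<d} (\<lambda>_. {..D})). (\<Sum>i<n. \<Sum>j<d. m i j) = k}.
            \<Prod>i<n. (\<kappa> (\<Sum>j<d. m i j))\<^sup>2 * (\<Prod>j<d. y j ^ m i j / fact (m i j)))
       = coeff (weight_poly \<kappa> D ^ n) k * (\<Sum>j<d. y j) ^ k"
proof -
  let ?g = "\<lambda>r. (\<kappa> (\<Sum>j<d. r j))\<^sup>2 * (\<Prod>j<d. y j ^ r j / fact (r j))"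
  let ?R = "\<Sum>r\<in>PiE {..<d} (\<lambda>_. {..D}). monom (?g r) (\<Sum>j<d. r j)"
  have fin: "finite (PiE {..<n} (\<lambda>_. PiE {..<d} (\<lambda>_. {..D})))"
    by (intro finite_PiE) auto
  have "(\<Sum>m\<in>{m \<in> PiE {..<n} (\<lambda>_. PiE {..<d} (\<lambda>_. {..D})). (\<Sum>i<n. \<Sum>j<d. m i j) = k}. \<Prod>i<n. ?g (m i))
      = coeff (\<Sum>m\<in>PiE {..<n} (\<lambda>_. PiE {..<d} (\<lambda>_. {..D})).
            monom (\<Prod>i<n. ?g (m i)) (\<Sum>i<n. \<Sum>j<d. m i j)) k"
    using fin by (simp add: coeff_sum sum.If_cases) (auto intro!: sum.cong)
  also have "(\<Sum>m\<in>PiE {..<n} (\<lambda>_. PiE {..<d} (\<lambda>_. {..D})).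
            monom (\<Prod>i<n. ?g (m i)) (\<Sum>i<n. \<Sum>j<d. m i j)) = (\<Prod>i<n. ?R)"
    by (subst prod_sum_PiE) (auto simp: prod_monom intro!: finite_PiE)
  also have "coeff (\<Prod>i<n. ?R) k = coeff (weight_poly \<kappa> D ^ n) k * (\<Sum>j<d. y j) ^ k"
    unfolding prod_constant card_lessThan
    by (rule coeff_power_scale[OF _ assms])
       (simp add: coeff_row_sum[where g = "\<lambda>s. (\<kappa> s)\<^sup>2"] weight_poly_def coeff_sum_monom)
  finally show ?thesis .
qed

lemma coeff_weight_poly: "s \<le> D \<Longrightarrow> coeff (weight_poly \<kappa> D) s = (\<kappa> s)\<^sup>2 / fact s"
  by (simp add: weight_poly_def coeff_sum_monom)

lemma coeff_weight_poly_nonneg: "coeff (weight_poly \<kappa> D) s \<ge> 0"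
  by (auto simp: weight_poly_def coeff_sum intro!: sum_nonneg)

lemma coeff_power_nonneg:
  fixes p :: "real poly"
  assumes "\<And>s. coeff p s \<ge> 0"
  shows "coeff (p ^ n) k \<ge> 0"
  by (induction n arbitrary: k) (auto simp: coeff_mult assms intro!: sum_nonneg mult_nonneg_nonneg)

text \<open>With nonnegative coefficients, the value at \<open>x\<close> dominates any selection of
  terms; here those of degree \<open>0\<close>, which is \<open>1\<close>, and degree
  \<open>k\<close>.\<close>

lemma coeff_power_le:
  fixes p :: "real poly"
  assumes "\<And>s. coeff p s \<ge> 0" "coeff p 0 = 1" "x \<ge> 0" "k \<ge> 1"
  shows "coeff (p ^ n) k * x ^ k \<le> poly p x ^ n - 1"
proof -
  let ?q = "p ^ n"
  have nonneg: "coeff ?q i \<ge> 0" for i by (intro coeff_power_nonneg assms)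
  have "1 + coeff ?q k * x ^ k = (\<Sum>i\<in>{0, k}. coeff ?q i * x ^ i)"
    using assms by (simp add: coeff_0_power)
  \<comment> \<open>The range is extended to \<open>max k\<close> because \<open>k\<close> may
    exceed the degree of the polynomial.\<close>
  also have "\<dots> \<le> (\<Sum>i\<le>max k (degree ?q). coeff ?q i * x ^ i)"
    using assms nonneg by (intro sum_mono2) auto
  also have "\<dots> = poly ?q x"
    by (subst poly_altdef) (auto intro!: sum.mono_neutral_right simp: le_degree)
  finally show ?thesis by (simp add: poly_power)
qed

text \<open>The \<open>s\<close>-th moment of the two-point variable with value
  \<open>\<alpha>\<close> of probability \<open>1 - \<epsilon>\<close> and value
  \<open>- \<alpha> (1 - \<epsilon>) / \<epsilon>\<close> of probability
  \<open>\<epsilon>\<close>.\<close>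

definition mix_moment :: "real \<Rightarrow> real \<Rightarrow> nat \<Rightarrow> real" where
  "mix_moment \<epsilon> \<alpha> s = (1 - \<epsilon>) * \<alpha> ^ s + \<epsilon> * (- \<alpha> * (1 - \<epsilon>) / \<epsilon>) ^ s"

lemma mix_moment_0: "mix_moment \<epsilon> \<alpha> 0 = 1"
  by (simp add: mix_moment_def)

text \<open>The mixture is centered, which eliminates level \<open>1\<close> of the
  expansion.\<close>

lemma mix_moment_1: "\<epsilon> \<noteq> 0 \<Longrightarrow> mix_moment \<epsilon> \<alpha> 1 = 0"
  by (simp add: mix_moment_def)

text \<open>Factoring out \<open>\<epsilon> (\<alpha> / \<epsilon>)^s\<close> leaves
  \<open>(1 - \<epsilon>) (\<epsilon>^(s-1) + (1 - \<epsilon>)^(s-1))\<close>, and for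
  \<open>s \<ge> 2\<close> the second factor is at most
  \<open>\<epsilon> + (1 - \<epsilon>) = 1\<close>.\<close>

lemma mix_moment_sq_le:
  assumes "0 < \<epsilon>" "\<epsilon> \<le> 1" "0 < \<alpha>" "s \<ge> 2"
  shows "(mix_moment \<epsilon> \<alpha> s)\<^sup>2 \<le> \<epsilon>\<^sup>2 * (\<alpha>\<^sup>2 / \<epsilon>\<^sup>2) ^ s"
proof -
  obtain r where r: "s = Suc (Suc r)" using assms(4) by (metis add_2_eq_Suc le_Suc_ex)
  have "\<bar>mix_moment \<epsilon> \<alpha> s\<bar> \<le> \<bar>(1 - \<epsilon>) * \<alpha> ^ s\<bar> + \<bar>\<epsilon> * (- \<alpha> * (1 - \<epsilon>) / \<epsilon>) ^ s\<bar>"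
    unfolding mix_moment_def by (rule abs_triangle_ineq)
  also have "\<bar>\<epsilon> * (- \<alpha> * (1 - \<epsilon>) / \<epsilon>) ^ s\<bar> = \<epsilon> * (\<alpha> * (1 - \<epsilon>) / \<epsilon>) ^ s"
    using assms by (simp add: abs_mult power_abs)
  also have "\<bar>(1 - \<epsilon>) * \<alpha> ^ s\<bar> = (1 - \<epsilon>) * \<alpha> ^ s"
    using assms by simp
  also have "(1 - \<epsilon>) * \<alpha> ^ s + \<epsilon> * (\<alpha> * (1 - \<epsilon>) / \<epsilon>) ^ s
      = \<epsilon> * (\<alpha> / \<epsilon>) ^ s * ((1 - \<epsilon>) * (\<epsilon> ^ Suc r + (1 - \<epsilon>) ^ Suc r))"
  proof -
    have "(\<alpha> * (1 - \<epsilon>) / \<epsilon>) ^ s = (\<alpha> / \<epsilon>) ^ s * (1 - \<epsilon>) ^ s"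
      by (simp add: power_mult_distrib power_divide)
    moreover have "\<alpha> ^ s = (\<alpha> / \<epsilon>) ^ s * (\<epsilon> * \<epsilon> ^ Suc r)"
      using assms by (simp add: r power_divide)
    moreover have "(1 - \<epsilon>) ^ s = (1 - \<epsilon>) * (1 - \<epsilon>) ^ Suc r"
      by (simp add: r)
    ultimately show ?thesis by (simp only:) (simp only: algebra_simps)
  qed
  also have "\<dots> \<le> \<epsilon> * (\<alpha> / \<epsilon>) ^ s * (1 * (\<epsilon> + (1 - \<epsilon>)))"
  proof -
    have "\<epsilon> ^ Suc r \<le> \<epsilon>" "(1 - \<epsilon>) ^ Suc r \<le> 1 - \<epsilon>"
      using assms power_decreasing[of 1 "Suc r" \<epsilon>] power_decreasing[of 1 "Suc r" "1 - \<epsilon>"] by auto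
    then show ?thesis
      using assms by (intro mult_left_mono mult_mono) (auto intro!: add_nonneg_nonneg zero_le_power simp del: power_Suc)
  qed
  finally have "\<bar>mix_moment \<epsilon> \<alpha> s\<bar> \<le> \<epsilon> * (\<alpha> / \<epsilon>) ^ s" by simp
  then have "\<bar>mix_moment \<epsilon> \<alpha> s\<bar>\<^sup>2 \<le> (\<epsilon> * (\<alpha> / \<epsilon>) ^ s)\<^sup>2"
    by (intro power_mono) auto
  also have "\<dots> = \<epsilon>\<^sup>2 * (\<alpha>\<^sup>2 / \<epsilon>\<^sup>2) ^ s"
    by (simp add: power_mult_distrib power_divide mult.commute flip: power_mult)
  finally show ?thesis by simp
qed

lemma power_le_fact_exp:
  fixes y :: real
  assumes "y \<ge> 0"
  shows "y ^ k \<le> fact k * exp y"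
proof -
  have "y ^ k / fact k \<le> exp y"
  proof -
    have "(\<Sum>i\<in>{k}. y ^ i /\<^sub>R fact i) \<le> exp y"
      unfolding exp_def using assms summable_exp_generic[of y]
      by (intro sum_le_suminf) auto
    then show ?thesis by (simp add: field_simps)
  qed
  then show ?thesis by (simp add: field_simps)
qed

text \<open>At the chosen \<open>x\<close>, the ratio \<open>\<alpha>^2 / \<epsilon>^2 * x\<close>
  equals \<open>B / (A + B) \<le> 1\<close>, so every term with \<open>s \<ge> 2\<close> is
  dominated by the quadratic one. Multiplied by \<open>n\<close>, that term becomes
  \<open>(A / (A + B))^2\<close>, since \<open>n \<epsilon>^2 B^2 = A^2\<close>.\<close>

lemma weight_coeff_bound:
  fixes n d D k :: nat and \<epsilon> \<alpha> :: real
  assumes e: "0 < \<epsilon>" "\<epsilon> \<le> 1" and a: "0 < \<alpha>" and k: "2 \<le> k" "k \<le> D" and d: "1 \<le> d"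
  defines "A \<equiv> sqrt (real n) * \<alpha>\<^sup>2 / (sqrt (real d) * \<epsilon>)"
    and "B \<equiv> \<alpha>\<^sup>2 / (sqrt (real d) * \<epsilon>\<^sup>2)"
  shows "coeff (weight_poly (mix_moment \<epsilon> \<alpha>) D ^ n) k / sqrt (real d) ^ k
       \<le> real D * exp (real D) * A\<^sup>2 * (fact (k - 2) * exp (A + B))"
proof -
  let ?p = "weight_poly (mix_moment \<epsilon> \<alpha>) D"
  define y where "y = A + B"
  have A0: "A \<ge> 0" and B0: "B > 0" using e a d by (auto simp: A_def B_def)
  then have y0: "y > 0" and By: "B \<le> y" and Ay: "A \<le> y" by (auto simp: y_def)
  define x where "x = 1 / (sqrt (real d) * y)"
  have x0: "x > 0" using y0 d by (simp add: x_def)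
  have Bx: "\<alpha>\<^sup>2 / \<epsilon>\<^sup>2 * x = B / y"
    by (simp add: x_def B_def)
  define u where "u = real D * (\<epsilon>\<^sup>2 * (B / y)\<^sup>2)"
  have "poly ?p x = (\<Sum>s\<le>D. (mix_moment \<epsilon> \<alpha> s)\<^sup>2 / fact s * x ^ s)"
    by (simp add: weight_poly_def poly_sum poly_monom)
  also have "\<dots> = 1 + (\<Sum>s=2..D. (mix_moment \<epsilon> \<alpha> s)\<^sup>2 / fact s * x ^ s)"
  proof -
    \<comment> \<open>The term at \<open>0\<close> is \<open>1\<close> and the term at
      \<open>1\<close> vanishes.\<close>
    have "{..D} = {0, 1} \<union> {2..D}" using k by auto
    then show ?thesis
      using e by (simp add: sum.union_disjoint mix_moment_0 mix_moment_1[simplified])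
  qed
  also have "(\<Sum>s=2..D. (mix_moment \<epsilon> \<alpha> s)\<^sup>2 / fact s * x ^ s) \<le> (\<Sum>s=2..D. \<epsilon>\<^sup>2 * (B / y)\<^sup>2)"
  proof (intro sum_mono)
    fix s assume s: "s \<in> {2..D}"
    have "(mix_moment \<epsilon> \<alpha> s)\<^sup>2 / fact s \<le> (mix_moment \<epsilon> \<alpha> s)\<^sup>2 / 1"
      by (intro divide_left_mono) auto
    also have "\<dots> \<le> \<epsilon>\<^sup>2 * (\<alpha>\<^sup>2 / \<epsilon>\<^sup>2) ^ s"
      using mix_moment_sq_le[of \<epsilon> \<alpha> s] e a s by simp
    finally have "(mix_moment \<epsilon> \<alpha> s)\<^sup>2 / fact s * x ^ s \<le> \<epsilon>\<^sup>2 * (\<alpha>\<^sup>2 / \<epsilon>\<^sup>2) ^ s * x ^ s"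
      using x0 by (intro mult_right_mono) auto
    also have "\<dots> = \<epsilon>\<^sup>2 * (B / y) ^ s"
      unfolding Bx[symmetric] by (simp only: power_mult_distrib mult.assoc)
    also have "\<dots> \<le> \<epsilon>\<^sup>2 * (B / y)\<^sup>2"
      using s By y0 B0 by (intro mult_left_mono power_decreasing) auto
    finally show "(mix_moment \<epsilon> \<alpha> s)\<^sup>2 / fact s * x ^ s \<le> \<epsilon>\<^sup>2 * (B / y)\<^sup>2" .
  qed
  also have "(\<Sum>s=2..D. \<epsilon>\<^sup>2 * (B / y)\<^sup>2) \<le> u"
    unfolding u_def by (simp add: mult_right_mono)
  finally have "poly ?p x \<le> 1 + u" by simp
  moreover have "0 \<le> poly ?p x"
    using x0 by (auto simp: weight_poly_def poly_sum poly_monom intro!: sum_nonneg)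
  ultimately have "poly ?p x ^ n \<le> exp u ^ n"
    using order_trans[OF _ exp_ge_add_one_self, of "poly ?p x" u] by (intro power_mono)
  also have "\<dots> = exp (real n * u)" by (simp add: exp_of_nat_mult)
  also have nu: "real n * u = real D * (A / y)\<^sup>2"
    using e d by (simp add: u_def A_def B_def field_simps power2_eq_square)
  finally have le: "poly ?p x ^ n - 1 \<le> exp (real D * (A / y)\<^sup>2) - 1" by simp
  have "(A / y)\<^sup>2 \<le> 1"
    using A0 Ay y0 by (intro power_le_one) auto
  then have wD: "real D * (A / y)\<^sup>2 \<le> real D" by (simp add: mult_left_le)
  \<comment> \<open>Unlike a bound by \<open>exp w\<close> alone, this keeps the factor
    \<open>w\<close>, which carries the \<open>A\<^sup>2\<close> of the conclusion.\<close>
  have exp_minus: "exp w - 1 \<le> w * exp w" for w :: real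
    using exp_ge_add_one_self[of "- w"] by (simp add: exp_minus field_simps)
  have "coeff (?p ^ n) k * x ^ k \<le> poly ?p x ^ n - 1"
    using k x0 by (intro coeff_power_le) (auto simp: coeff_weight_poly_nonneg coeff_weight_poly mix_moment_0)
  also have "\<dots> \<le> real D * (A / y)\<^sup>2 * exp (real D * (A / y)\<^sup>2)"
    using le exp_minus[of "real D * (A / y)\<^sup>2"] by simp
  also have "\<dots> \<le> real D * (A / y)\<^sup>2 * exp (real D)"
    using wD by (intro mult_left_mono) auto
  \<comment> \<open>Since \<open>x * y = 1 / sqrt d\<close>, multiplying by \<open>y ^ k\<close>
    produces the desired power of \<open>d\<close>.\<close>
  finally have "coeff (?p ^ n) k * x ^ k * y ^ k \<le> real D * (A / y)\<^sup>2 * exp (real D) * y ^ k"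
    using y0 by (intro mult_right_mono) auto
  moreover have "coeff (?p ^ n) k * x ^ k * y ^ k = coeff (?p ^ n) k / sqrt (real d) ^ k"
    using y0 by (simp add: x_def power_divide power_mult_distrib)
  moreover
  \<comment> \<open>Two of the \<open>k \<ge> 2\<close> factors cancel the denominator of
    \<open>(A / y)\<^sup>2\<close>; the remaining ones are absorbed into the factorial and the
    exponential.\<close>
  have "y ^ k = y\<^sup>2 * y ^ (k - 2)"
    using k by (metis le_add_diff_inverse power_add)
  then have "real D * (A / y)\<^sup>2 * exp (real D) * y ^ k = real D * exp (real D) * A\<^sup>2 * y ^ (k - 2)"
    using y0 by (simp add: power_divide)
  ultimately have "coeff (?p ^ n) k / sqrt (real d) ^ k \<le> real D * exp (real D) * A\<^sup>2 * y ^ (k - 2)"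
    by simp
  also have "\<dots> \<le> real D * exp (real D) * A\<^sup>2 * (fact (k - 2) * exp y)"
    using y0 by (intro mult_left_mono power_le_fact_exp) auto
  finally show ?thesis by (simp add: y_def)
qed

section \<open>Moments of the uniform distribution on the sphere\<close>

text \<open>A product measure is determined by its values on boxes, where the integrand is a product
  of one-variable functions and the integral factors.\<close>

lemma PiM_density:
  assumes I: "finite I" and M: "product_sigma_finite M"
    and N: "product_sigma_finite (\<lambda>i. density (M i) (f i))"
    and f: "\<And>i. i \<in> I \<Longrightarrow> f i \<in> borel_measurable (M i)"
  shows "PiM I (\<lambda>i. density (M i) (f i)) = density (PiM I M) (\<lambda>x. \<Prod>i\<in>I. f i (x i))"
proof -
  interpret M: product_sigma_finite M by (rule M)
  interpret N: product_sigma_finite "\<lambda>i. density (M i) (f i)" by (rule N)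
  have meas [measurable]: "(\<lambda>x. \<Prod>i\<in>I. f i (x i)) \<in> borel_measurable (PiM I M)"
    using f by (intro borel_measurable_prod_ennreal measurable_compose[OF measurable_component_singleton]) auto
  show ?thesis
  proof (rule N.PiM_eqI[OF I, symmetric])
    show "sets (density (PiM I M) (\<lambda>x. \<Prod>i\<in>I. f i (x i))) = sets (PiM I (\<lambda>i. density (M i) (f i)))"
      by (auto intro!: sets_PiM_cong)
    fix A assume "\<And>i. i \<in> I \<Longrightarrow> A i \<in> sets (density (M i) (f i))"
    then have A: "\<And>i. i \<in> I \<Longrightarrow> A i \<in> sets (M i)" by simp
    then have PA: "PiE I A \<in> sets (PiM I M)" using I by (intro sets_PiM_I_finite)
    have "emeasure (density (PiM I M) (\<lambda>x. \<Prod>i\<in>I. f i (x i))) (PiE I A)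
        = (\<integral>\<^sup>+x. (\<Prod>i\<in>I. f i (x i)) * indicator (PiE I A) x \<partial>PiM I M)"
      using PA by (rule emeasure_density[OF meas])
    also have "\<dots> = (\<integral>\<^sup>+x. (\<Prod>i\<in>I. f i (x i) * indicator (A i) (x i)) \<partial>PiM I M)"
    proof (intro nn_integral_cong)
      fix x assume x: "x \<in> space (PiM I M)"
      have "indicator (PiE I A) x = (\<Prod>i\<in>I. indicator (A i) (x i) :: ennreal)"
        using x I by (auto simp: indicator_def space_PiM PiE_iff prod_zero_iff)
      then show "(\<Prod>i\<in>I. f i (x i)) * indicator (PiE I A) x
          = (\<Prod>i\<in>I. f i (x i) * indicator (A i) (x i))"
        by (simp add: prod.distrib)
    qed
    also have "\<dots> = (\<Prod>i\<in>I. \<integral>\<^sup>+x. f i x * indicator (A i) x \<partial>M i)"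
      using A f I by (intro M.product_nn_integral_prod) auto
    also have "\<dots> = (\<Prod>i\<in>I. emeasure (density (M i) (f i)) (A i))"
      using A f by (intro prod.cong) (auto simp: emeasure_density)
    finally show "emeasure (density (PiM I M) (\<lambda>x. \<Prod>i\<in>I. f i (x i))) (PiE I A)
        = (\<Prod>i\<in>I. emeasure (density (M i) (f i)) (A i))" .
  qed
qed

section \<open>Lebesgue measure under scaling and polar coordinates\<close>

abbreviation lebesgue_upto :: "nat \<Rightarrow> (nat \<Rightarrow> real) measure" where
  "lebesgue_upto d \<equiv> \<Pi>\<^sub>M j\<in>{..<d}. lborel"

interpretation lborel_product: product_sigma_finite "\<lambda>_::nat. lborel :: real measure"
  by standard

lemma sigma_finite_lebesgue_upto: "sigma_finite_measure (lebesgue_upto d)"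
  by (rule lborel_product.sigma_finite) simp

lemma measurable_L2_set [measurable]:
  "(\<lambda>x. L2_set x {..<d}) \<in> borel_measurable (lebesgue_upto d)"
  unfolding L2_set_def by measurable

lemma measurable_scale [measurable]:
  "(\<lambda>x. \<lambda>j\<in>{..<d}. c * x j) \<in> measurable (lebesgue_upto d) (lebesgue_upto d)"
  by measurable

text \<open>Change of variables \<open>x -> c x\<close> with Jacobian \<open>c ^ d\<close>: each
  coordinate contributes one factor \<open>c\<close>, and boxes determine the product
  measure.\<close>

lemma lebesgue_upto_scale:
  assumes c: "c > 0"
  shows "lebesgue_upto d = density (distr (lebesgue_upto d) (lebesgue_upto d) (\<lambda>x. \<lambda>j\<in>{..<d}. c * x j))
           (\<lambda>_. ennreal (c ^ d))"
proof (rule lborel_product.PiM_eqI[symmetric])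
  fix A assume A: "\<And>i. i \<in> {..<d} \<Longrightarrow> A i \<in> sets (lborel :: real measure)"
  let ?S = "\<lambda>x. \<lambda>j\<in>{..<d}. c * x j"
  let ?A' = "\<lambda>j. (\<lambda>x. c * x) -` A j"
  have A' [measurable]: "?A' j \<in> sets borel" if "j < d" for j
    using A[of j] that measurable_sets[of "\<lambda>x::real. c * x" borel borel "A j"] by simp
  have PA: "PiE {..<d} A \<in> sets (lebesgue_upto d)" using A by (intro sets_PiM_I_finite) auto
  have vim: "?S -` PiE {..<d} A \<inter> space (lebesgue_upto d) = PiE {..<d} ?A'"
    by (auto simp: space_PiM PiE_iff)
  have one: "ennreal c * emeasure lborel (?A' j) = emeasure lborel (A j)" if "j < d" for j
  proof -
    have "emeasure lborel (?A' j) = emeasure (distr lborel borel ((*) c)) (A j)"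
      using A[of j] that by (subst emeasure_distr) auto
    also have "\<dots> = ennreal (inverse c) * emeasure lborel (A j)"
      using c A[of j] that by (subst lborel_distr_mult) (auto simp: emeasure_density_const)
    finally have "ennreal c * emeasure lborel (?A' j) = (ennreal c * ennreal (inverse c)) * emeasure lborel (A j)"
      by (simp add: mult_ac)
    also have "ennreal c * ennreal (inverse c) = 1"
      using c by (simp flip: ennreal_mult')
    finally show ?thesis by simp
  qed
  have "emeasure (density (distr (lebesgue_upto d) (lebesgue_upto d) ?S) (\<lambda>_. ennreal (c ^ d))) (PiE {..<d} A)
      = ennreal (c ^ d) * emeasure (lebesgue_upto d) (?S -` PiE {..<d} A \<inter> space (lebesgue_upto d))"
    using PA by (subst emeasure_density_const) (auto simp: emeasure_distr)
  also have "\<dots> = (\<Prod>j<d. ennreal c) * (\<Prod>j<d. emeasure lborel (?A' j))"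
    unfolding vim using c by (subst lborel_product.emeasure_PiM) (auto simp: ennreal_power)
  also have "\<dots> = (\<Prod>j<d. emeasure lborel (A j))"
    using one by (simp del: prod_constant flip: prod.distrib)
  finally show "emeasure (density (distr (lebesgue_upto d) (lebesgue_upto d) ?S) (\<lambda>_. ennreal (c ^ d))) (PiE {..<d} A)
      = (\<Prod>j<d. emeasure lborel (A j))" .
qed simp_all

lemma nn_integral_scale:
  assumes c: "c > 0" and f [measurable]: "f \<in> borel_measurable (lebesgue_upto d)"
  shows "(\<integral>\<^sup>+x. f x \<partial>lebesgue_upto d)
       = ennreal (c ^ d) * (\<integral>\<^sup>+x. f (\<lambda>j\<in>{..<d}. c * x j) \<partial>lebesgue_upto d)"
  by (subst lebesgue_upto_scale[OF c])
     (simp add: nn_integral_density nn_integral_cmult nn_integral_distr)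

lemma L2_set_scale: "c \<ge> 0 \<Longrightarrow> L2_set (\<lambda>j\<in>{..<d}. c * x j) {..<d} = c * L2_set x {..<d}"
  by (simp add: L2_set_def power_mult_distrib real_sqrt_mult flip: sum_distrib_left)

text \<open>For \<open>d \<ge> 1\<close> the origin lies in the hyperplane of vanishing coordinate
  \<open>0\<close>, a box with a null factor.\<close>

lemma AE_L2_set_pos:
  assumes "d \<ge> 1"
  shows "AE x in lebesgue_upto d. L2_set x {..<d} > 0"
proof -
  have "AE x in lebesgue_upto d. x 0 \<noteq> 0"
  proof (rule AE_I')
    let ?Z = "PiE {..<d} (\<lambda>j. if j = 0 then {0::real} else UNIV)"
    have "emeasure (lebesgue_upto d) ?Z = (\<Prod>j<d. emeasure lborel (if j = 0 then {0::real} else UNIV))"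
      by (subst lborel_product.emeasure_PiM) auto
    also have "\<dots> = 0" using assms by (intro prod_zero) (auto intro!: bexI[of _ 0])
    finally show "?Z \<in> null_sets (lebesgue_upto d)"
      by (auto intro!: null_setsI sets_PiM_I_finite)
    show "{x \<in> space (lebesgue_upto d). \<not> x 0 \<noteq> 0} \<subseteq> ?Z"
      by (auto simp: space_PiM PiE_iff extensional_def)
  qed
  then show ?thesis
  proof eventually_elim
    case (elim x)
    then have "0 < \<bar>x 0\<bar>" by simp
    also have "\<bar>x 0\<bar> \<le> L2_set x {..<d}"
      using assms member_le_L2_set[of "{..<d}" 0 "\<lambda>j. \<bar>x j\<bar>"] by (simp add: L2_set_def)
    finally show ?case .
  qed
qed

text \<open>
  Polar coordinates without a surface measure: integrate \<open>Q(x) |x|\<^sup>d [|x| \<le> 1] g(t |x|) t\<^bsup>d-1\<^esup>\<close>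
  over \<open>x\<close> and \<open>t > 0\<close> in both orders; after the substitution \<open>x = y / t\<close> the homogeneous
  factor \<open>Q\<close> is unchanged.
\<close>

lemma polar_nn_integral:
  assumes d: "d \<ge> 1"
    and Q [measurable]: "Q \<in> borel_measurable (lebesgue_upto d)"
    and hom: "\<And>c x. c > 0 \<Longrightarrow> x \<in> space (lebesgue_upto d) \<Longrightarrow> Q (\<lambda>j\<in>{..<d}. c * x j) = Q x"
    and g [measurable]: "g \<in> borel_measurable borel"
  shows "(\<integral>\<^sup>+x. Q x * g (L2_set x {..<d}) \<partial>lebesgue_upto d)
       = ennreal (real d) * (\<integral>\<^sup>+t. g t * ennreal (t ^ (d - 1)) * indicator {0<..} t \<partial>lborel)
           * (\<integral>\<^sup>+x. Q x * indicator {..1} (L2_set x {..<d}) \<partial>lebesgue_upto d)"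
proof -
  let ?M = "lebesgue_upto d"
  let ?N = "\<lambda>x. L2_set x {..<d}"
  interpret M: sigma_finite_measure ?M by (rule sigma_finite_lebesgue_upto)
  interpret P: pair_sigma_finite "lborel :: real measure" ?M
    by (rule pair_sigma_finite.intro) (auto simp: sigma_finite_lborel M.sigma_finite_measure_axioms)
  define K where "K = (\<integral>\<^sup>+t. g t * ennreal (t ^ (d - 1)) * indicator {0<..} t \<partial>lborel)"
  define F where "F t x = Q x * indicator {..1} (?N x) * ennreal (?N x ^ d)
      * (g (t * ?N x) * ennreal (t ^ (d - 1)) * indicator {0<..} t)" for t x
  have F_meas [measurable]: "case_prod F \<in> borel_measurable (lborel \<Otimes>\<^sub>M ?M)"
    unfolding F_def by measurable
  have dd: "Suc (d - 1) = d" using d by simp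
  \<comment> \<open>The substitution \<open>t -> r t\<close> yields one factor \<open>r\<close> from
    \<open>dt\<close> and \<open>r ^ (d - 1)\<close> from the power of \<open>t\<close>; the weight
    \<open>|x|^d\<close> in \<open>F\<close> supplies exactly their product.\<close>
  have radial: "ennreal (r ^ d) * (\<integral>\<^sup>+t. g (t * r) * ennreal (t ^ (d - 1)) * indicator {0<..} t \<partial>lborel) = K"
    if r: "r > 0" for r :: real
  proof -
    have "K = ennreal \<bar>r\<bar> * (\<integral>\<^sup>+t. g (0 + r * t) * ennreal ((0 + r * t) ^ (d - 1)) * indicator {0<..} (0 + r * t) \<partial>lborel)"
      unfolding K_def using r by (intro nn_integral_real_affine) auto
    also have "(\<integral>\<^sup>+t. g (0 + r * t) * ennreal ((0 + r * t) ^ (d - 1)) * indicator {0<..} (0 + r * t) \<partial>lborel)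
      = (\<integral>\<^sup>+t. ennreal (r ^ (d - 1)) * (g (t * r) * ennreal (t ^ (d - 1)) * indicator {0<..} t) \<partial>lborel)"
      using r by (intro nn_integral_cong)
        (auto simp: indicator_def power_mult_distrib ennreal_mult mult_ac zero_less_mult_iff)
    also have "\<dots> = ennreal (r ^ (d - 1)) * (\<integral>\<^sup>+t. g (t * r) * ennreal (t ^ (d - 1)) * indicator {0<..} t \<partial>lborel)"
      by (intro nn_integral_cmult) measurable
    finally have "K = (ennreal \<bar>r\<bar> * ennreal (r ^ (d - 1)))
        * (\<integral>\<^sup>+t. g (t * r) * ennreal (t ^ (d - 1)) * indicator {0<..} t \<partial>lborel)"
      by (simp add: mult_ac)
    also have "ennreal \<bar>r\<bar> * ennreal (r ^ (d - 1)) = ennreal (r ^ d)"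
      using r power_Suc[of r "d - 1"] unfolding dd by (simp flip: ennreal_mult)
    finally show ?thesis by simp
  qed
  have "(\<integral>\<^sup>+x. \<integral>\<^sup>+t. F t x \<partial>lborel \<partial>?M) = (\<integral>\<^sup>+x. K * (Q x * indicator {..1} (?N x)) \<partial>?M)"
  proof (rule nn_integral_cong_AE)
    show "AE x in ?M. (\<integral>\<^sup>+t. F t x \<partial>lborel) = K * (Q x * indicator {..1} (?N x))"
      using AE_L2_set_pos[OF d]
    proof eventually_elim
      case (elim x)
      have "(\<integral>\<^sup>+t. F t x \<partial>lborel) = Q x * indicator {..1} (?N x) * ennreal (?N x ^ d)
        * (\<integral>\<^sup>+t. g (t * ?N x) * ennreal (t ^ (d - 1)) * indicator {0<..} t \<partial>lborel)"
        unfolding F_def by (intro nn_integral_cmult) measurable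
      also have "\<dots> = Q x * indicator {..1} (?N x) * K"
        using radial[OF elim] by (simp add: mult.assoc)
      finally show ?case by (simp add: mult_ac)
    qed
  qed
  also have "\<dots> = K * (\<integral>\<^sup>+x. Q x * indicator {..1} (?N x) \<partial>?M)"
    by (intro nn_integral_cmult) measurable
  finally have lhs: "(\<integral>\<^sup>+x. \<integral>\<^sup>+t. F t x \<partial>lborel \<partial>?M) = K * (\<integral>\<^sup>+x. Q x * indicator {..1} (?N x) \<partial>?M)" .

  \<comment> \<open>\<open>F\<close> after the substitution: \<open>t^-d\<close> from the Jacobian,
    \<open>t^-d\<close> from \<open>|x|^d\<close> and the old \<open>t^(d-1)\<close> combine to
    \<open>t^-(d+1)\<close>. The constraint \<open>|x| \<le> 1\<close> becomes
    \<open>t \<ge> |y|\<close>, written through a difference so that joint measurability is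
    immediate.\<close>
  define G where "G t x = Q x * g (?N x) * (ennreal (?N x ^ d) * (ennreal (inverse (t ^ Suc d)) * indicator {0..} (t - ?N x) * indicator {0<..} t))" for t x
  have G_meas [measurable]: "case_prod G \<in> borel_measurable (lborel \<Otimes>\<^sub>M ?M)"
    unfolding G_def by measurable
  have "(\<integral>\<^sup>+t. \<integral>\<^sup>+x. F t x \<partial>?M \<partial>lborel) = (\<integral>\<^sup>+t. \<integral>\<^sup>+x. G t x \<partial>?M \<partial>lborel)"
  proof (rule nn_integral_cong)
    fix t :: real
    show "(\<integral>\<^sup>+x. F t x \<partial>?M) = (\<integral>\<^sup>+x. G t x \<partial>?M)"
    proof (cases "t > 0")
      case False
      then show ?thesis by (simp add: F_def G_def)
    next
      case t: True
      have "(\<integral>\<^sup>+x. F t x \<partial>?M) = ennreal (inverse t ^ d) * (\<integral>\<^sup>+x. F t (\<lambda>j\<in>{..<d}. inverse t * x j) \<partial>?M)"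
        using t by (intro nn_integral_scale) auto
      also have "\<dots> = (\<integral>\<^sup>+x. ennreal (inverse t ^ d) * F t (\<lambda>j\<in>{..<d}. inverse t * x j) \<partial>?M)"
        by (intro nn_integral_cmult[symmetric]) measurable
      also have "\<dots> = (\<integral>\<^sup>+x. G t x \<partial>?M)"
      proof (intro nn_integral_cong)
        fix x assume x: "x \<in> space ?M"
        have q: "Q (\<lambda>j\<in>{..<d}. inverse t * x j) = Q x" using t x by (intro hom) auto
        have n: "?N (\<lambda>j\<in>{..<d}. inverse t * x j) = inverse t * ?N x" using t by (intro L2_set_scale) simp
        have i: "indicator {..1} (inverse t * ?N x) = (indicator {0..} (t - ?N x) :: ennreal)"
          using t by (auto simp: indicator_def field_simps)
        have p: "ennreal (inverse t ^ d) * ennreal ((inverse t * ?N x) ^ d) * ennreal (t ^ (d - 1))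
            = ennreal (?N x ^ d) * ennreal (inverse (t ^ Suc d))"
        proof -
          have "t ^ d = t * t ^ (d - 1)" using dd by (metis power_Suc)
          then have "inverse t ^ d * (inverse t * ?N x) ^ d * t ^ (d - 1) = ?N x ^ d * inverse (t ^ Suc d)"
            using t by (simp add: power_mult_distrib field_simps power_inverse)
          then show ?thesis
            using t L2_set_nonneg[of x "{..<d}"] by (simp flip: ennreal_mult)
        qed
        have "ennreal (inverse t ^ d) * F t (\<lambda>j\<in>{..<d}. inverse t * x j)
          = Q x * g (?N x) * indicator {0..} (t - ?N x) * (ennreal (inverse t ^ d) * ennreal ((inverse t * ?N x) ^ d) * ennreal (t ^ (d - 1)))"
        proof -
          have e: "t * (inverse t * ?N x) = ?N x" using t by simp
          show ?thesis using t unfolding F_def q n i e by (simp add: mult_ac)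
        qed
        also have "\<dots> = G t x"
          unfolding p G_def using t by (simp add: mult_ac)
        finally show "ennreal (inverse t ^ d) * F t (\<lambda>j\<in>{..<d}. inverse t * x j) = G t x" .
      qed
      finally show ?thesis .
    qed
  qed
  also have "\<dots> = (\<integral>\<^sup>+x. \<integral>\<^sup>+t. G t x \<partial>lborel \<partial>?M)"
    by (rule P.Fubini'[OF G_meas, symmetric])
  also have "\<dots> = (\<integral>\<^sup>+x. ennreal (1 / real d) * (Q x * g (?N x)) \<partial>?M)"
  proof (rule nn_integral_cong_AE)
    show "AE x in ?M. (\<integral>\<^sup>+t. G t x \<partial>lborel) = ennreal (1 / real d) * (Q x * g (?N x))"
      using AE_L2_set_pos[OF d]
    proof eventually_elim
      case (elim x)
      \<comment> \<open>The antiderivative of \<open>t^-(d+1)\<close> vanishes at infinity, so the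
        integral over \<open>t \<ge> |x|\<close> is \<open>|x|^-d / d\<close>, and the weight
        \<open>|x|^d\<close> reduces it to \<open>1 / d\<close>.\<close>
      have "((\<lambda>t. - inverse (t ^ d) / real d) \<longlongrightarrow> - 0 / real d) at_top"
        using d by (intro tendsto_intros tendsto_inverse_0_at_top filterlim_pow_at_top filterlim_ident) auto
      then have FTC: "(\<integral>\<^sup>+t. ennreal (inverse (t ^ Suc d)) * indicator {?N x..} t \<partial>lborel)
          = ennreal (- 0 / real d - (- inverse (?N x ^ d) / real d))"
      proof (rule nn_integral_FTC_atLeast[rotated 3])
        fix t assume t: "?N x \<le> t"
        then have t0: "t > 0" using elim by simp
        have "((\<lambda>t. - inverse (t ^ d) / real d) has_real_derivative
            - (- (real d * t ^ (d - 1)) * inverse (t ^ d) ^ 2) / real d) (at t)"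
          using t0 d by (auto intro!: derivative_eq_intros simp: power2_eq_square)
        also have "- (- (real d * t ^ (d - 1)) * inverse (t ^ d) ^ 2) / real d = inverse (t ^ Suc d)"
        proof -
          have "t ^ d = t * t ^ (d - 1)" using dd by (metis power_Suc)
          then show ?thesis using t0 d by (simp add: field_simps power2_eq_square)
        qed
        finally show "((\<lambda>t. - inverse (t ^ d) / real d) has_real_derivative inverse (t ^ Suc d)) (at t)" .
        show "0 \<le> inverse (t ^ Suc d)" using t0 by simp
      qed simp
      have "(\<integral>\<^sup>+t. G t x \<partial>lborel) = Q x * g (?N x) * (ennreal (?N x ^ d) *
          (\<integral>\<^sup>+t. ennreal (inverse (t ^ Suc d)) * indicator {0..} (t - ?N x) * indicator {0<..} t \<partial>lborel))"
        unfolding G_def by (subst nn_integral_cmult, measurable, subst nn_integral_cmult) auto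
      also have "(\<integral>\<^sup>+t. ennreal (inverse (t ^ Suc d)) * indicator {0..} (t - ?N x) * indicator {0<..} t \<partial>lborel)
          = (\<integral>\<^sup>+t. ennreal (inverse (t ^ Suc d)) * indicator {?N x..} t \<partial>lborel)"
        using elim by (intro nn_integral_cong) (auto simp: indicator_def)
      also have "ennreal (?N x ^ d) * (\<integral>\<^sup>+t. ennreal (inverse (t ^ Suc d)) * indicator {?N x..} t \<partial>lborel)
          = ennreal (1 / real d)"
        unfolding FTC using elim d by (simp flip: ennreal_mult)
      finally show ?case by (simp add: mult_ac)
    qed
  qed
  also have "\<dots> = ennreal (1 / real d) * (\<integral>\<^sup>+x. Q x * g (?N x) \<partial>?M)"
    by (intro nn_integral_cmult) measurable
  finally have rhs: "(\<integral>\<^sup>+t. \<integral>\<^sup>+x. F t x \<partial>?M \<partial>lborel) = ennreal (1 / real d) * (\<integral>\<^sup>+x. Q x * g (?N x) \<partial>?M)" .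
  have "ennreal (real d) * ennreal (1 / real d) = 1"
    using d by (simp flip: ennreal_mult)
  then have "(\<integral>\<^sup>+x. Q x * g (?N x) \<partial>?M)
      = ennreal (real d) * (ennreal (1 / real d) * (\<integral>\<^sup>+x. Q x * g (?N x) \<partial>?M))"
    by (simp flip: mult.assoc)
  also have "\<dots> = ennreal (real d) * (K * (\<integral>\<^sup>+x. Q x * indicator {..1} (?N x) \<partial>?M))"
    using lhs rhs P.Fubini'[OF F_meas] by simp
  finally show ?thesis by (simp add: K_def mult_ac)
qed


section \<open>The uniform distribution on the sphere\<close>

lemma measurable_radial [measurable]:
  "(\<lambda>x. \<lambda>j\<in>{..<d}. x j / L2_set x {..<d}) \<in> measurable (lebesgue_upto d) (\<Pi>\<^sub>M j\<in>{..<d}. borel)"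
  by measurable

lemma measurable_L2_set_borel [measurable]:
  "(\<lambda>x. L2_set x {..<d}) \<in> borel_measurable (\<Pi>\<^sub>M j\<in>{..<d}. borel :: real measure)"
  unfolding L2_set_def by measurable

abbreviation unit_ball_upto :: "nat \<Rightarrow> (nat \<Rightarrow> real) set" where
  "unit_ball_upto d \<equiv> {x \<in> space (lebesgue_upto d). L2_set x {..<d} \<le> 1}"

text \<open>Makes the uniform measure on the ball a probability measure and permits cancelling its
  volume in \<open>ennreal\<close>.\<close>

lemma emeasure_unit_ball_upto:
  "emeasure (lebesgue_upto d) (unit_ball_upto d) \<noteq> 0"
  "emeasure (lebesgue_upto d) (unit_ball_upto d) \<noteq> \<infinity>"
proof -
  have "unit_ball_upto d = {f. sqrt (\<Sum>i<d. (f i)\<^sup>2) \<le> 1} \<inter> space (lebesgue_upto d)"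
    by (auto simp: L2_set_def)
  then have "emeasure (lebesgue_upto d) (unit_ball_upto d) = ennreal (unit_ball_vol (real d))"
    using emeasure_cball_aux[of "{..<d}" 1] by simp
  then show "emeasure (lebesgue_upto d) (unit_ball_upto d) \<noteq> 0"
    and "emeasure (lebesgue_upto d) (unit_ball_upto d) \<noteq> \<infinity>"
    using unit_ball_vol_pos[of "real d"] by (simp_all add: ennreal_eq_0_iff not_le del: unit_ball_vol_pos)
qed

lemma sets_uniform_sphere [simp, measurable_cong]:
  "sets (uniform_sphere d) = sets (\<Pi>\<^sub>M j\<in>{..<d}. borel)"
  by (simp add: uniform_sphere_def)

lemma measurable_radial_uniform:
  "(\<lambda>x. \<lambda>j\<in>{..<d}. x j / L2_set x {..<d})
     \<in> measurable (uniform_measure (lebesgue_upto d) (unit_ball_upto d)) (\<Pi>\<^sub>M j\<in>{..<d}. borel)"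
  using measurable_radial by (simp cong: measurable_cong_sets)

lemma prob_space_uniform_sphere: "prob_space (uniform_sphere d)"
  unfolding uniform_sphere_def
  using emeasure_unit_ball_upto[of d]
  by (intro prob_space.prob_space_distr prob_space_uniform_measure measurable_radial_uniform) auto

text \<open>The projected norm is a quotient \<open>N / N\<close>, equal to \<open>1\<close>, or to
  \<open>0\<close> at the origin by the convention for division by zero; the inequality covers both
  cases.\<close>

lemma AE_uniform_sphere: "AE v in uniform_sphere d. L2_set v {..<d} \<le> 1"
  unfolding uniform_sphere_def
proof (subst AE_distr_iff[OF measurable_radial_uniform])
  have "L2_set (\<lambda>j\<in>{..<d}. x j / L2_set x {..<d}) {..<d} \<le> 1" for x
  proof -
    have "L2_set (\<lambda>j\<in>{..<d}. x j / L2_set x {..<d}) {..<d} = L2_set x {..<d} / L2_set x {..<d}"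
      using L2_set_scale[where c = "inverse (L2_set x {..<d})" and d = d and x = x] by (simp add: field_simps)
    then show ?thesis by simp
  qed
  then show "AE x in uniform_measure (lebesgue_upto d) (unit_ball_upto d).
     L2_set (\<lambda>j\<in>{..<d}. x j / L2_set x {..<d}) {..<d} \<le> 1" by simp
qed measurable

lemma nn_integral_uniform_sphere:
  assumes [measurable]: "f \<in> borel_measurable (\<Pi>\<^sub>M j\<in>{..<d}. borel)"
  shows "(\<integral>\<^sup>+v. f v \<partial>uniform_sphere d)
       = (\<integral>\<^sup>+x. f (\<lambda>j\<in>{..<d}. x j / L2_set x {..<d}) * indicator {..1} (L2_set x {..<d}) \<partial>lebesgue_upto d)
         / emeasure (lebesgue_upto d) (unit_ball_upto d)"
  unfolding uniform_sphere_def
  by (subst nn_integral_distr[OF measurable_radial_uniform], measurable,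
      subst nn_integral_uniform_measure, measurable)
     (auto intro!: nn_integral_cong arg_cong2[where f = "(/)"] simp: indicator_def)

section \<open>Comparison of spherical and Gaussian moments\<close>

interpretation std_normal_product: product_sigma_finite "\<lambda>_::nat. std_normal"
  by (intro product_sigma_finite.intro prob_space_imp_sigma_finite prob_space_std_normal)

abbreviation std_gaussian :: "nat \<Rightarrow> (nat \<Rightarrow> real) measure" where
  "std_gaussian d \<equiv> \<Pi>\<^sub>M j\<in>{..<d}. std_normal"

lemma prob_space_std_gaussian: "prob_space (std_gaussian d)"
  by (rule prob_space_PiM) (rule prob_space_std_normal)

text \<open>The density is a function of the norm alone, as \<open>polar_nn_integral\<close>
  requires.\<close>

lemma std_gaussian_eq_density:
  "std_gaussian d = density (lebesgue_upto d)
     (\<lambda>x. ennreal ((1 / sqrt (2 * pi)) ^ d * exp (- (L2_set x {..<d})\<^sup>2 / 2)))"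
proof -
  have "std_gaussian d = density (lebesgue_upto d) (\<lambda>x. \<Prod>j<d. ennreal (std_normal_density (x j)))"
    unfolding std_normal_def
    using std_normal_product.product_sigma_finite_axioms[unfolded std_normal_def]
    by (intro PiM_density lborel_product.product_sigma_finite_axioms) auto
  also have "(\<lambda>x. \<Prod>j<d. ennreal (std_normal_density (x j)))
      = (\<lambda>x. ennreal ((1 / sqrt (2 * pi)) ^ d * exp (- (L2_set x {..<d})\<^sup>2 / 2)))"
  proof
    fix x :: "nat \<Rightarrow> real"
    have "(\<Prod>j<d. ennreal (std_normal_density (x j))) = ennreal (\<Prod>j<d. std_normal_density (x j))"
      by (intro prod_ennreal) simp
    also have "(\<Prod>j<d. std_normal_density (x j)) = (1 / sqrt (2 * pi)) ^ d * (\<Prod>j<d. exp (- (x j)\<^sup>2 / 2))"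
      unfolding std_normal_density_def prod.distrib by simp
    also have "(\<Prod>j<d. exp (- (x j)\<^sup>2 / 2)) = exp (- (L2_set x {..<d})\<^sup>2 / 2)"
      by (simp add: L2_set_def sum_nonneg sum_negf flip: exp_sum sum_divide_distrib)
    finally show "(\<Prod>j<d. ennreal (std_normal_density (x j)))
        = ennreal ((1 / sqrt (2 * pi)) ^ d * exp (- (L2_set x {..<d})\<^sup>2 / 2))" .
  qed
  finally show ?thesis .
qed

text \<open>Norm and direction of a Gaussian vector are independent. Polar coordinates are used
  twice, with \<open>Q\<close> the directional factor and with \<open>Q = 1\<close>; both produce
  the same radial constant \<open>C\<close>, which links the two sides.\<close>

lemma gaussian_moment_eq_sphere_moment:
  assumes d: "d \<ge> 1" and k: "k \<ge> 1"
  shows "(\<integral>\<^sup>+x. ennreal (\<bar>\<Sum>j<d. x j * w j\<bar> ^ k) \<partial>std_gaussian d)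
       = (\<integral>\<^sup>+x. ennreal (L2_set x {..<d} ^ k) \<partial>std_gaussian d)
         * (\<integral>\<^sup>+v. ennreal (\<bar>\<Sum>j<d. v j * w j\<bar> ^ k) \<partial>uniform_sphere d)"
proof -
  let ?M = "lebesgue_upto d"
  let ?N = "\<lambda>x. L2_set x {..<d}"
  let ?V = "emeasure ?M (unit_ball_upto d)"
  define \<gamma> where "\<gamma> s = (1 / sqrt (2 * pi)) ^ d * exp (- s\<^sup>2 / 2)" for s :: real
  have [measurable]: "\<gamma> \<in> borel_measurable borel" unfolding \<gamma>_def by measurable
  have \<gamma>0: "\<gamma> s \<ge> 0" for s by (simp add: \<gamma>_def)
  have dens: "std_gaussian d = density ?M (\<lambda>x. ennreal (\<gamma> (?N x)))"
    unfolding \<gamma>_def by (rule std_gaussian_eq_density)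
  define Q where "Q x = ennreal (\<bar>\<Sum>j<d. x j / ?N x * w j\<bar> ^ k)" for x
  have [measurable]: "Q \<in> borel_measurable ?M" unfolding Q_def by measurable
  define g where "g s = ennreal (s ^ k * \<gamma> s)" for s
  have [measurable]: "g \<in> borel_measurable borel" unfolding g_def by measurable
  define C where "C = ennreal (real d) * (\<integral>\<^sup>+t. g t * ennreal (t ^ (d - 1)) * indicator {0<..} t \<partial>lborel)"
  have "(\<integral>\<^sup>+x. ennreal (\<bar>\<Sum>j<d. x j * w j\<bar> ^ k) \<partial>std_gaussian d)
      = (\<integral>\<^sup>+x. Q x * g (?N x) \<partial>?M)"
  proof (subst dens, subst nn_integral_density, measurable, intro nn_integral_cong)
    fix x
    have "(\<Sum>j<d. x j / ?N x * w j) = (\<Sum>j<d. x j * w j) / ?N x"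
      by (simp add: sum_divide_distrib)
    moreover have "(\<Sum>j<d. x j * w j) = 0" if "?N x = 0"
      using that by (simp add: L2_set_eq_0_iff)
    \<comment> \<open>At the origin both sides vanish because \<open>k \<ge> 1\<close>.\<close>
    ultimately have "\<bar>\<Sum>j<d. x j / ?N x * w j\<bar> ^ k * ?N x ^ k = \<bar>\<Sum>j<d. x j * w j\<bar> ^ k"
      using k by (cases "?N x = 0") (auto simp: power_divide)
    then show "ennreal (\<gamma> (?N x)) * ennreal (\<bar>\<Sum>j<d. x j * w j\<bar> ^ k) = Q x * g (?N x)"
      unfolding Q_def g_def by (simp add: \<gamma>0 mult_ac flip: ennreal_mult')
  qed
  also have "\<dots> = C * (\<integral>\<^sup>+x. Q x * indicator {..1} (?N x) \<partial>?M)"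
    unfolding C_def
  proof (rule polar_nn_integral[OF d])
    fix c :: real and x assume "c > 0"
    then show "Q (\<lambda>j\<in>{..<d}. c * x j) = Q x"
      unfolding Q_def by (simp add: L2_set_scale)
  qed measurable
  also have "(\<integral>\<^sup>+x. Q x * indicator {..1} (?N x) \<partial>?M)
      = ?V * (\<integral>\<^sup>+v. ennreal (\<bar>\<Sum>j<d. v j * w j\<bar> ^ k) \<partial>uniform_sphere d)"
  proof -
    have cancel: "I = ?V * (I / ?V)" for I
      using emeasure_unit_ball_upto[of d] mult_divide_eq_ennreal[of ?V I]
      by (simp add: ennreal_times_divide mult.commute)
    show ?thesis
      unfolding Q_def by (subst nn_integral_uniform_sphere, measurable, subst cancel) simp
  qed
  also have "C * (?V * (\<integral>\<^sup>+v. ennreal (\<bar>\<Sum>j<d. v j * w j\<bar> ^ k) \<partial>uniform_sphere d))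
      = C * (\<integral>\<^sup>+x. 1 * indicator {..1} (?N x) \<partial>?M)
        * (\<integral>\<^sup>+v. ennreal (\<bar>\<Sum>j<d. v j * w j\<bar> ^ k) \<partial>uniform_sphere d)"
  proof -
    have "(\<integral>\<^sup>+x. 1 * indicator {..1} (?N x) \<partial>?M) = (\<integral>\<^sup>+x. indicator (unit_ball_upto d) x \<partial>?M)"
      by (intro nn_integral_cong) (auto simp: indicator_def)
    then show ?thesis by (simp add: mult.assoc)
  qed
  also have "C * (\<integral>\<^sup>+x. 1 * indicator {..1} (?N x) \<partial>?M) = (\<integral>\<^sup>+x. 1 * g (?N x) \<partial>?M)"
    unfolding C_def by (rule polar_nn_integral[OF d, symmetric]) auto
  also have "\<dots> = (\<integral>\<^sup>+x. ennreal (?N x ^ k) \<partial>std_gaussian d)"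
    by (subst dens, subst nn_integral_density, measurable)
       (auto intro!: nn_integral_cong simp: g_def \<gamma>0 mult_ac simp flip: ennreal_mult')
  finally show ?thesis .
qed

text \<open>The tangent of \<open>t^(k/2)\<close> at \<open>t = 1\<close>, with
  \<open>t = r^2\<close>. Induction on \<open>k\<close> treats odd \<open>k\<close> as well: the
  excess at each step is \<open>(r - 1)^2 / 2\<close> times a nonnegative factor.\<close>

lemma power_ge_quadratic:
  fixes r :: real
  assumes "r \<ge> 0" "k \<ge> 2"
  shows "r ^ k \<ge> 1 + real k / 2 * (r\<^sup>2 - 1)"
  using assms(2)
proof (induction k rule: dec_induct)
  case (step k)
  have "0 \<le> (r - 1)\<^sup>2 / 2 * (real k * (r + 1) - 1)"
  proof (intro mult_nonneg_nonneg)
    have "1 * 1 \<le> real k * (r + 1)"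
      using step assms by (intro mult_mono) auto
    then show "0 \<le> real k * (r + 1) - 1" by simp
  qed simp
  also have "\<dots> = r * (1 + real k / 2 * (r\<^sup>2 - 1)) - (1 + real (Suc k) / 2 * (r\<^sup>2 - 1))"
    by (simp add: power2_eq_square field_simps)
  finally have "1 + real (Suc k) / 2 * (r\<^sup>2 - 1) \<le> r * (1 + real k / 2 * (r\<^sup>2 - 1))" by simp
  also have "\<dots> \<le> r * r ^ k"
    using step assms by (intro mult_left_mono)
  finally show ?case by simp
qed simp

lemma std_normal_second_moment: "(\<integral>\<^sup>+x. ennreal (x\<^sup>2) \<partial>std_normal) = 1"
proof -
  have "integrable std_normal (poly [:0, 0, 1:])" by (rule integrable_std_normal_poly)
  moreover have "poly [:0, 0, 1:] = (\<lambda>x::real. x\<^sup>2)"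
    by (auto simp: power2_eq_square)
  ultimately have i: "integrable std_normal (\<lambda>x. x\<^sup>2)" by simp
  have "(\<integral>x. x\<^sup>2 \<partial>std_normal) = 1"
    using hermite_orthogonal[of 1 1] by (simp add: power2_eq_square)
  then show ?thesis using i by (subst nn_integral_eq_integral) auto
qed

text \<open>Jensen's inequality by way of the tangent bound: \<open>r = |x| / sqrt d\<close>
  satisfies \<open>E r^2 = 1\<close>, so integrating \<open>power_ge_quadratic\<close> gives
  \<open>E r^k \<ge> 1\<close>.\<close>

lemma gaussian_norm_moment_ge:
  assumes d: "d \<ge> 1" and k: "k \<ge> 2"
  shows "(\<integral>\<^sup>+x. ennreal (L2_set x {..<d} ^ k) \<partial>std_gaussian d) \<ge> ennreal (sqrt (real d) ^ k)"
proof -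
  interpret prob_space "std_gaussian d" by (rule prob_space_std_gaussian)
  let ?N = "\<lambda>x. L2_set x {..<d}"
  have [measurable]: "?N \<in> borel_measurable (std_gaussian d)" unfolding L2_set_def by measurable
  let ?I = "\<integral>\<^sup>+x. ennreal ((?N x / sqrt (real d)) ^ k) \<partial>std_gaussian d"
  have coord: "(\<integral>\<^sup>+x. ennreal ((x j)\<^sup>2) \<partial>std_gaussian d) = 1" if "j < d" for j
  proof -
    have "(\<integral>\<^sup>+x. ennreal ((x j)\<^sup>2) \<partial>std_gaussian d) = (\<integral>\<^sup>+y. ennreal (y\<^sup>2) \<partial>distr (std_gaussian d) std_normal (\<lambda>x. x j))"
      using that by (subst nn_integral_distr) auto
    also have "distr (std_gaussian d) std_normal (\<lambda>x. x j) = std_normal"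
      using that prob_space_std_normal by (intro distr_PiM_component) auto
    finally show ?thesis by (simp add: std_normal_second_moment)
  qed
  have "ennreal (real k / 2) = (\<integral>\<^sup>+x. ennreal (real k / (2 * real d)) * (\<Sum>j<d. ennreal ((x j)\<^sup>2)) \<partial>std_gaussian d)"
    using d by (subst nn_integral_cmult, measurable, subst nn_integral_sum, measurable)
       (simp add: coord ennreal_of_nat_eq_real_of_nat flip: ennreal_mult)
  \<comment> \<open>The tangent bound is rearranged as
    \<open>k/2 * r^2 \<le> r^k + (k/2 - 1)\<close>, in which all terms are nonnegative for
    \<open>k \<ge> 2\<close>, so the argument stays in \<open>ennreal\<close>.\<close>
  also have "\<dots> \<le> (\<integral>\<^sup>+x. ennreal ((?N x / sqrt (real d)) ^ k) + ennreal (real k / 2 - 1) \<partial>std_gaussian d)"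
  proof (intro nn_integral_mono)
    fix x
    have "real k / (2 * real d) * (\<Sum>j<d. (x j)\<^sup>2) = real k / 2 * (?N x / sqrt (real d))\<^sup>2"
      by (simp add: L2_set_def power_divide sum_nonneg)
    also have "\<dots> \<le> (?N x / sqrt (real d)) ^ k + (real k / 2 - 1)"
      using power_ge_quadratic[OF _ k, of "?N x / sqrt (real d)"] by (simp add: algebra_simps)
    finally show "ennreal (real k / (2 * real d)) * (\<Sum>j<d. ennreal ((x j)\<^sup>2))
        \<le> ennreal ((?N x / sqrt (real d)) ^ k) + ennreal (real k / 2 - 1)"
      using k by (simp add: sum_ennreal sum_nonneg flip: ennreal_mult ennreal_plus)
  qed
  also have "\<dots> = ennreal (real k / 2 - 1) + ?I"
    using emeasure_space_1 by (subst nn_integral_add) (auto simp: add.commute)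
  also have "ennreal (real k / 2) = ennreal (real k / 2 - 1) + 1"
    using k by (simp flip: ennreal_plus ennreal_1)
  finally have "1 \<le> ?I"
    unfolding ennreal_add_left_cancel_le by simp
  then have "ennreal (sqrt (real d) ^ k) * 1 \<le> ennreal (sqrt (real d) ^ k) * ?I"
    by (intro mult_left_mono) auto
  also have "\<dots> = (\<integral>\<^sup>+x. ennreal (?N x ^ k) \<partial>std_gaussian d)"
    using d by (subst nn_integral_cmult[symmetric], measurable)
      (auto intro!: nn_integral_cong simp: power_divide simp flip: ennreal_mult)
  finally show ?thesis by simp
qed


text \<open>In one variable \<open>exp (y * u)\<close> is \<open>exp (u\<^sup>2 / 2)\<close> times a
  tilt, which has mean \<open>1\<close>; independent coordinates multiply.\<close>

lemma gaussian_linear_mgf: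
  "(\<integral>\<^sup>+x. ennreal (exp (\<Sum>j<d. x j * w j)) \<partial>std_gaussian d) = ennreal (exp ((\<Sum>j<d. (w j)\<^sup>2) / 2))"
proof -
  have one: "(\<integral>\<^sup>+y. ennreal (exp (y * u)) \<partial>std_normal) = ennreal (exp (u\<^sup>2 / 2))" for u
  proof -
    have "(\<integral>\<^sup>+y. ennreal (exp (y * u)) \<partial>std_normal) = (\<integral>\<^sup>+y. ennreal (exp (u\<^sup>2 / 2)) * ennreal (tilt u y) \<partial>std_normal)"
      by (intro nn_integral_cong) (simp add: tilt_def mult.commute flip: ennreal_mult exp_add)
    also have "\<dots> = ennreal (exp (u\<^sup>2 / 2)) * (\<integral>\<^sup>+y. ennreal (tilt u y) \<partial>std_normal)"
      by (intro nn_integral_cmult) measurable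
    also have "(\<integral>\<^sup>+y. ennreal (tilt u y) \<partial>std_normal) = 1"
      using tilt_integral[of u] tilt_pos[of u]
      by (subst nn_integral_eq_integral) (auto simp: has_bochner_integral_iff less_imp_le)
    finally show ?thesis by simp
  qed
  have "(\<integral>\<^sup>+x. ennreal (exp (\<Sum>j<d. x j * w j)) \<partial>std_gaussian d)
      = (\<integral>\<^sup>+x. (\<Prod>j<d. ennreal (exp (x j * w j))) \<partial>std_gaussian d)"
    by (intro nn_integral_cong) (simp add: exp_sum prod_ennreal)
  also have "\<dots> = (\<Prod>j<d. \<integral>\<^sup>+y. ennreal (exp (y * w j)) \<partial>std_normal)"
    by (intro std_normal_product.product_nn_integral_prod) auto
  also have "\<dots> = ennreal (exp ((\<Sum>j<d. (w j)\<^sup>2) / 2))"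
    by (simp add: one prod_ennreal exp_sum sum_divide_distrib)
  finally show ?thesis .
qed

text \<open>From \<open>|l|^k \<le> k! (e^l + e^-l)\<close>: both exponential moments are at most
  \<open>exp (1/2) \<le> 2\<close>, which accounts for the constant \<open>4\<close>.\<close>

lemma gaussian_linear_moment_le:
  assumes w: "L2_set w {..<d} \<le> 1"
  shows "(\<integral>\<^sup>+x. ennreal (\<bar>\<Sum>j<d. x j * w j\<bar> ^ k) \<partial>std_gaussian d) \<le> ennreal (4 * fact k)"
proof -
  let ?l = "\<lambda>x. \<Sum>j<d. x j * w j"
  have [measurable]: "?l \<in> borel_measurable (std_gaussian d)" by measurable
  have sq: "(\<Sum>j<d. (w j)\<^sup>2) \<le> 1"
    using w by (simp add: L2_set_def)
  have "(\<integral>\<^sup>+x. ennreal (\<bar>?l x\<bar> ^ k) \<partial>std_gaussian d)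
      \<le> (\<integral>\<^sup>+x. ennreal (fact k) * (ennreal (exp (?l x)) + ennreal (exp (\<Sum>j<d. x j * - w j))) \<partial>std_gaussian d)"
  proof (intro nn_integral_mono)
    fix x
    have "\<bar>?l x\<bar> ^ k \<le> fact k * exp \<bar>?l x\<bar>" by (rule power_le_fact_exp) simp
    also have "\<dots> \<le> fact k * (exp (?l x) + exp (\<Sum>j<d. x j * - w j))"
      by (intro mult_left_mono) (auto simp: abs_if sum_negf)
    finally show "ennreal (\<bar>?l x\<bar> ^ k)
        \<le> ennreal (fact k) * (ennreal (exp (?l x)) + ennreal (exp (\<Sum>j<d. x j * - w j)))"
      by (simp flip: ennreal_plus ennreal_mult)
  qed
  also have "\<dots> = ennreal (fact k) * ((\<integral>\<^sup>+x. ennreal (exp (?l x)) \<partial>std_gaussian d)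
      + (\<integral>\<^sup>+x. ennreal (exp (\<Sum>j<d. x j * - w j)) \<partial>std_gaussian d))"
    by (subst nn_integral_cmult, measurable, subst nn_integral_add) auto
  also have "\<dots> = ennreal (fact k * (2 * exp ((\<Sum>j<d. (w j)\<^sup>2) / 2)))"
    unfolding gaussian_linear_mgf by (simp flip: ennreal_plus ennreal_mult)
  also have "\<dots> \<le> ennreal (4 * fact k)"
  proof -
    have "exp ((\<Sum>j<d. (w j)\<^sup>2) / 2) \<le> exp (1 / 2)" using sq by simp
    also have "\<dots> \<le> (2::real)" using exp_half_le2 .
    finally show ?thesis by (intro ennreal_leI) (simp add: mult_left_mono)
  qed
  finally show ?thesis .
qed

text \<open>The Gaussian linear moment is the norm moment times the spherical one, so an upper bound
  for the first is divided by a lower bound for the second.\<close>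

lemma sphere_linear_moment_le:
  assumes d: "d \<ge> 1" and k: "k \<ge> 2" and w: "L2_set w {..<d} \<le> 1"
  shows "(\<integral>v. \<bar>\<Sum>j<d. v j * w j\<bar> ^ k \<partial>uniform_sphere d) \<le> 4 * fact k / sqrt (real d) ^ k"
proof -
  let ?E = "\<integral>\<^sup>+v. ennreal (\<bar>\<Sum>j<d. v j * w j\<bar> ^ k) \<partial>uniform_sphere d"
  have [measurable]: "(\<lambda>v. \<bar>\<Sum>j<d. v j * w j\<bar> ^ k) \<in> borel_measurable (uniform_sphere d)"
    by measurable
  have s0: "sqrt (real d) ^ k > 0" using d by simp
  have "ennreal (sqrt (real d) ^ k) * ?E \<le> (\<integral>\<^sup>+x. ennreal (L2_set x {..<d} ^ k) \<partial>std_gaussian d) * ?E"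
    using gaussian_norm_moment_ge[OF d k] by (intro mult_right_mono) auto
  also have "\<dots> = (\<integral>\<^sup>+x. ennreal (\<bar>\<Sum>j<d. x j * w j\<bar> ^ k) \<partial>std_gaussian d)"
    using gaussian_moment_eq_sphere_moment[OF d, of k w] k by simp
  also have "\<dots> \<le> ennreal (4 * fact k)" by (rule gaussian_linear_moment_le[OF w])
  finally have "ennreal (1 / sqrt (real d) ^ k) * (ennreal (sqrt (real d) ^ k) * ?E)
      \<le> ennreal (1 / sqrt (real d) ^ k) * ennreal (4 * fact k)"
    by (intro mult_left_mono) auto
  moreover have "ennreal (1 / sqrt (real d) ^ k) * ennreal (sqrt (real d) ^ k) = 1"
    using d by (simp flip: ennreal_mult)
  ultimately have le: "?E \<le> ennreal (4 * fact k / sqrt (real d) ^ k)"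
    using s0 by (simp add: mult.commute flip: mult.assoc ennreal_mult)
  then have "integrable (uniform_sphere d) (\<lambda>v. \<bar>\<Sum>j<d. v j * w j\<bar> ^ k)"
    by (intro integrableI_bounded) (auto simp: le_less_trans[OF _ ennreal_less_top])
  then have "ennreal (\<integral>v. \<bar>\<Sum>j<d. v j * w j\<bar> ^ k \<partial>uniform_sphere d) = ?E"
    by (intro nn_integral_eq_integral[symmetric]) auto
  with le have "ennreal (\<integral>v. \<bar>\<Sum>j<d. v j * w j\<bar> ^ k \<partial>uniform_sphere d)
      \<le> ennreal (4 * fact k / sqrt (real d) ^ k)" by simp
  moreover have "0 \<le> 4 * fact k / sqrt (real d) ^ k" by simp
  ultimately show "(\<integral>v. \<bar>\<Sum>j<d. v j * w j\<bar> ^ k \<partial>uniform_sphere d) \<le> 4 * fact k / sqrt (real d) ^ k"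
    by (simp only: ennreal_le_iff)
qed

section \<open>The likelihood ratio\<close>

interpretation std_gaussian_product: product_sigma_finite "\<lambda>_::nat. std_gaussian d"
  by (intro product_sigma_finite.intro prob_space_imp_sigma_finite prob_space_std_gaussian)

lemma null_dist_eq: "null_dist n d = (\<Pi>\<^sub>M i\<in>{..<n}. std_gaussian d)"
  by (simp add: null_dist_def gaussian_def std_normal_def)

lemma prob_space_null_dist: "prob_space (null_dist n d)"
  unfolding null_dist_eq by (rule prob_space_PiM) (rule prob_space_std_gaussian)

lemma measurable_null_dist_component:
  assumes "i < n" "j < d"
  shows "(\<lambda>X. X i j) \<in> borel_measurable (null_dist n d)"
proof -
  have "(\<lambda>X. X i) \<in> measurable (null_dist n d) (std_gaussian d)"
    unfolding null_dist_eq using assms by (intro measurable_component_singleton) auto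
  moreover have "(\<lambda>x. x j) \<in> measurable (std_gaussian d) std_normal"
    using assms by (intro measurable_component_singleton) auto
  ultimately have "(\<lambda>X. X i j) \<in> measurable (null_dist n d) std_normal"
    by (rule measurable_compose)
  then show ?thesis by (simp cong: measurable_cong_sets)
qed

lemma std_gaussian_prod_integral:
  fixes f :: "nat \<Rightarrow> real \<Rightarrow> real"
  assumes "\<And>j. j < d \<Longrightarrow> integrable std_normal (f j)"
  shows "integrable (std_gaussian d) (\<lambda>x. \<Prod>j<d. f j (x j))"
    and "(\<integral>x. (\<Prod>j<d. f j (x j)) \<partial>std_gaussian d) = (\<Prod>j<d. integral\<^sup>L std_normal (f j))"
  using assms by (auto intro!: std_normal_product.product_integrable_prod std_normal_product.product_integral_prod)

lemma null_dist_row_integral: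
  fixes f :: "nat \<Rightarrow> (nat \<Rightarrow> real) \<Rightarrow> real"
  assumes "\<And>i. i < n \<Longrightarrow> integrable (std_gaussian d) (f i)"
  shows "integrable (null_dist n d) (\<lambda>X. \<Prod>i<n. f i (X i))"
    and "(\<integral>X. (\<Prod>i<n. f i (X i)) \<partial>null_dist n d) = (\<Prod>i<n. integral\<^sup>L (std_gaussian d) (f i))"
  unfolding null_dist_eq
  using assms by (auto intro!: std_gaussian_product.product_integrable_prod std_gaussian_product.product_integral_prod)

lemma null_dist_prod_integral:
  fixes f :: "nat \<Rightarrow> nat \<Rightarrow> real \<Rightarrow> real"
  assumes "\<And>i j. i < n \<Longrightarrow> j < d \<Longrightarrow> integrable std_normal (f i j)"
  shows "integrable (null_dist n d) (\<lambda>X. \<Prod>i<n. \<Prod>j<d. f i j (X i j))"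
    and "(\<integral>X. (\<Prod>i<n. \<Prod>j<d. f i j (X i j)) \<partial>null_dist n d)
       = (\<Prod>i<n. \<Prod>j<d. integral\<^sup>L std_normal (f i j))"
proof -
  have row: "integrable (std_gaussian d) (\<lambda>x. \<Prod>j<d. f i j (x j))" if "i < n" for i
    using assms that by (intro std_gaussian_prod_integral) auto
  show "integrable (null_dist n d) (\<lambda>X. \<Prod>i<n. \<Prod>j<d. f i j (X i j))"
    using row by (intro null_dist_row_integral) auto
  show "(\<integral>X. (\<Prod>i<n. \<Prod>j<d. f i j (X i j)) \<partial>null_dist n d)
       = (\<Prod>i<n. \<Prod>j<d. integral\<^sup>L std_normal (f i j))"
    using row assms by (subst null_dist_row_integral) (auto intro!: prod.cong std_gaussian_prod_integral)
qed

lemma gaussian_eq_density: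
  "gaussian d \<mu> = density (std_gaussian d) (\<lambda>x. ennreal (\<Prod>j<d. tilt (\<mu> j) (x j)))"
proof -
  have one: "density lborel (\<lambda>x. ennreal (normal_density m 1 x)) = density std_normal (\<lambda>x. ennreal (tilt m x))" for m
    unfolding std_normal_def
    by (subst density_density_eq) (auto simp: normal_density_eq_tilt[of m] ennreal_mult')
  have "prob_space (density std_normal (\<lambda>x. ennreal (tilt m x)))" for m
    unfolding one[symmetric] by (rule prob_space_normal_density) simp
  then have "gaussian d \<mu> = density (std_gaussian d) (\<lambda>x. \<Prod>j<d. ennreal (tilt (\<mu> j) (x j)))"
    unfolding gaussian_def one
    by (intro PiM_density std_normal_product.product_sigma_finite_axioms product_sigma_finite.intro
        prob_space_imp_sigma_finite) auto
  then show ?thesis by (simp add: prod_ennreal tilt_pos less_imp_le)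
qed

lemma sets_gaussian [simp]: "sets (gaussian d \<mu>) = sets (std_gaussian d)"
  by (simp add: gaussian_eq_density)

lemma prob_space_gaussian: "prob_space (gaussian d \<mu>)"
  unfolding gaussian_def by (intro prob_space_PiM prob_space_normal_density) simp

text \<open>The density of the mixture with respect to \<open>std_gaussian d\<close>.
  Correspondingly, \<open>sample_lr\<close> is the density of \<open>n\<close> samples for a fixed
  direction and \<open>average_lr\<close> that of the alternative, both with respect to
  \<open>null_dist\<close>.\<close>

definition mixture_lr :: "nat \<Rightarrow> real \<Rightarrow> real \<Rightarrow> (nat \<Rightarrow> real) \<Rightarrow> (nat \<Rightarrow> real) \<Rightarrow> real" where
  "mixture_lr d \<epsilon> \<alpha> v x =
     (1 - \<epsilon>) * (\<Prod>j<d. tilt (\<alpha> * v j) (x j)) + \<epsilon> * (\<Prod>j<d. tilt (- \<alpha> * (1 - \<epsilon>) / \<epsilon> * v j) (x j))"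

definition sample_lr :: "nat \<Rightarrow> nat \<Rightarrow> real \<Rightarrow> real \<Rightarrow> (nat \<Rightarrow> real) \<Rightarrow> (nat \<Rightarrow> nat \<Rightarrow> real) \<Rightarrow> real" where
  "sample_lr n d \<epsilon> \<alpha> v X = (\<Prod>i<n. mixture_lr d \<epsilon> \<alpha> v (X i))"

definition average_lr :: "nat \<Rightarrow> nat \<Rightarrow> real \<Rightarrow> real \<Rightarrow> (nat \<Rightarrow> nat \<Rightarrow> real) \<Rightarrow> real" where
  "average_lr n d \<epsilon> \<alpha> X = (\<integral>v. sample_lr n d \<epsilon> \<alpha> v X \<partial>uniform_sphere d)"

text \<open>Dominates all tilts with \<open>|\<mu>| \<le> c\<close> at once. With
  \<open>c = \<alpha> / \<epsilon>\<close> it bounds the densities uniformly in the direction, for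
  square integrability and for Fubini.\<close>

definition envelope :: "real \<Rightarrow> real \<Rightarrow> real" where
  "envelope c x = exp (c * x) + exp (- c * x)"

lemma measurable_sample_lr [measurable]:
  "(\<lambda>(v, X). sample_lr n d \<epsilon> \<alpha> v X)
     \<in> borel_measurable ((\<Pi>\<^sub>M j\<in>{..<d}. borel) \<Otimes>\<^sub>M null_dist n d)"
proof -
  let ?P = "(\<Pi>\<^sub>M j\<in>{..<d}. borel :: real measure) \<Otimes>\<^sub>M null_dist n d"
  have [measurable]: "(\<lambda>p. fst p j) \<in> borel_measurable ?P" if "j \<in> {..<d}" for j
    using that by measurable
  have [measurable]: "(\<lambda>p. snd p i j) \<in> borel_measurable ?P" if "i \<in> {..<n}" "j \<in> {..<d}" for i j
    using measurable_compose[OF measurable_snd measurable_null_dist_component] that by auto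
  show ?thesis
    unfolding sample_lr_def mixture_lr_def tilt_def case_prod_beta by measurable
qed

lemma integrable_exp_std_normal: "integrable std_normal (\<lambda>x. exp (c * x))"
proof -
  have "integrable std_normal (\<lambda>x. exp (c\<^sup>2 / 2) * tilt c x)"
    using tilt_integral[of c] by (auto simp: has_bochner_integral_iff)
  moreover have "exp (c\<^sup>2 / 2) * tilt c x = exp (c * x)" for x
    by (simp add: tilt_def flip: exp_add)
  ultimately show ?thesis by simp
qed

lemma integrable_envelope_sq: "integrable std_normal (\<lambda>x. (envelope c x)\<^sup>2)"
proof -
  have "(envelope c x)\<^sup>2 = exp ((2 * c) * x) + exp ((- 2 * c) * x) + 2" for x
  proof -
    have "exp ((2 * c) * x) = (exp (c * x))\<^sup>2" "exp ((- 2 * c) * x) = (exp (- c * x))\<^sup>2"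
      "exp (c * x) * exp (- c * x) = 1"
      by (simp_all add: power2_eq_square flip: exp_add)
    then show ?thesis by (simp add: envelope_def power2_sum)
  qed
  moreover interpret prob_space std_normal by (rule prob_space_std_normal)
  show ?thesis
    unfolding calculation by (intro Bochner_Integration.integrable_add integrable_exp_std_normal) auto
qed

lemma tilt_le_envelope:
  assumes "\<bar>\<mu>\<bar> \<le> c"
  shows "tilt \<mu> x \<le> envelope c x"
proof -
  have "tilt \<mu> x \<le> exp (\<mu> * x)" by (simp add: tilt_def)
  also have "\<mu> * x \<le> \<bar>\<mu>\<bar> * \<bar>x\<bar>" by (metis abs_ge_self abs_mult)
  also have "\<dots> \<le> c * \<bar>x\<bar>" using assms by (intro mult_right_mono) auto
  also have "exp (c * \<bar>x\<bar>) \<le> envelope c x"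
    by (auto simp: envelope_def abs_if)
  finally show ?thesis by simp
qed

section \<open>Densities of the mixture and of the alternative\<close>

context
  fixes n d :: nat and \<epsilon> \<alpha> :: real
  assumes e: "0 < \<epsilon>" "\<epsilon> \<le> 1" and a: "0 < \<alpha>"
begin

lemma mixture_lr_nonneg: "mixture_lr d \<epsilon> \<alpha> v x \<ge> 0"
  unfolding mixture_lr_def using e tilt_pos
  by (intro add_nonneg_nonneg mult_nonneg_nonneg prod_nonneg) (auto simp: less_imp_le)

lemma mixture_eq_density:
  "mixture d \<epsilon> \<alpha> v = density (std_gaussian d) (\<lambda>x. ennreal (mixture_lr d \<epsilon> \<alpha> v x))"
  and prob_space_mixture: "prob_space (mixture d \<epsilon> \<alpha> v)"
proof -
  let ?K = "\<lambda>b. if b then gaussian d (\<lambda>j. - \<alpha> * (1 - \<epsilon>) / \<epsilon> * v j) else gaussian d (\<lambda>j. \<alpha> * v j)"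
  have K: "?K \<in> measurable (measure_pmf (bernoulli_pmf \<epsilon>)) (subprob_algebra (std_gaussian d))"
    by (auto simp: measurable_pmf_measure1 space_subprob_algebra prob_space_imp_subprob_space prob_space_gaussian)
  show "prob_space (mixture d \<epsilon> \<alpha> v)"
    unfolding mixture_def
    by (rule prob_space.prob_space_bind[OF prob_space_measure_pmf _ K]) (auto simp: prob_space_gaussian)
  have [measurable]: "mixture_lr d \<epsilon> \<alpha> v \<in> borel_measurable (std_gaussian d)"
    unfolding mixture_lr_def tilt_def by measurable
  show "mixture d \<epsilon> \<alpha> v = density (std_gaussian d) (\<lambda>x. ennreal (mixture_lr d \<epsilon> \<alpha> v x))"
  proof (rule measure_eqI)
    show s: "sets (mixture d \<epsilon> \<alpha> v) = sets (density (std_gaussian d) (\<lambda>x. ennreal (mixture_lr d \<epsilon> \<alpha> v x)))"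
      unfolding mixture_def by (subst sets_bind[where N = "std_gaussian d"]) auto
    fix A assume "A \<in> sets (mixture d \<epsilon> \<alpha> v)"
    then have A [measurable]: "A \<in> sets (std_gaussian d)" unfolding s by simp
    have "emeasure (mixture d \<epsilon> \<alpha> v) A = (\<integral>\<^sup>+b. emeasure (?K b) A \<partial>measure_pmf (bernoulli_pmf \<epsilon>))"
      unfolding mixture_def by (rule emeasure_bind[OF _ K A]) simp
    also have "\<dots> = emeasure (?K True) A * ennreal \<epsilon> + emeasure (?K False) A * ennreal (1 - \<epsilon>)"
      using e by (subst nn_integral_bernoulli_pmf) auto
    also have "\<dots> = (\<integral>\<^sup>+x. ennreal (\<epsilon> * (\<Prod>j<d. tilt (- \<alpha> * (1 - \<epsilon>) / \<epsilon> * v j) (x j))) * indicator A x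
          + ennreal ((1 - \<epsilon>) * (\<Prod>j<d. tilt (\<alpha> * v j) (x j))) * indicator A x \<partial>std_gaussian d)"
    proof -
      have part: "emeasure (gaussian d \<mu>) A * ennreal c
          = (\<integral>\<^sup>+x. ennreal (c * (\<Prod>j<d. tilt (\<mu> j) (x j))) * indicator A x \<partial>std_gaussian d)" if "c \<ge> 0" for c \<mu>
      proof -
        have "emeasure (gaussian d \<mu>) A * ennreal c
          = ennreal c * (\<integral>\<^sup>+x. ennreal (\<Prod>j<d. tilt (\<mu> j) (x j)) * indicator A x \<partial>std_gaussian d)"
          unfolding gaussian_eq_density by (subst emeasure_density) (auto simp: mult.commute)
        also have "\<dots> = (\<integral>\<^sup>+x. ennreal c * (ennreal (\<Prod>j<d. tilt (\<mu> j) (x j)) * indicator A x) \<partial>std_gaussian d)"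
          by (intro nn_integral_cmult[symmetric]) measurable
        finally show ?thesis
          using that by (simp add: ennreal_mult' mult.assoc)
      qed
      show ?thesis
        using e by (subst nn_integral_add) (auto simp: part)
    qed
    also have "\<dots> = (\<integral>\<^sup>+x. ennreal (mixture_lr d \<epsilon> \<alpha> v x) * indicator A x \<partial>std_gaussian d)"
    proof (intro nn_integral_cong)
      fix x
      have "ennreal (mixture_lr d \<epsilon> \<alpha> v x) = ennreal (\<epsilon> * (\<Prod>j<d. tilt (- \<alpha> * (1 - \<epsilon>) / \<epsilon> * v j) (x j)))
          + ennreal ((1 - \<epsilon>) * (\<Prod>j<d. tilt (\<alpha> * v j) (x j)))"
        unfolding mixture_lr_def using e
        by (subst add.commute, intro ennreal_plus mult_nonneg_nonneg prod_nonneg) (auto simp: tilt_pos less_imp_le)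
      then show "ennreal (\<epsilon> * (\<Prod>j<d. tilt (- \<alpha> * (1 - \<epsilon>) / \<epsilon> * v j) (x j))) * indicator A x
          + ennreal ((1 - \<epsilon>) * (\<Prod>j<d. tilt (\<alpha> * v j) (x j))) * indicator A x
          = ennreal (mixture_lr d \<epsilon> \<alpha> v x) * indicator A x"
        by (simp add: distrib_right)
    qed
    also have "\<dots> = emeasure (density (std_gaussian d) (\<lambda>x. ennreal (mixture_lr d \<epsilon> \<alpha> v x))) A"
      by (subst emeasure_density) auto
    finally show "emeasure (mixture d \<epsilon> \<alpha> v) A = emeasure (density (std_gaussian d) (\<lambda>x. ennreal (mixture_lr d \<epsilon> \<alpha> v x))) A" .
  qed
qed

lemma sample_eq_density:
  "(\<Pi>\<^sub>M i\<in>{..<n}. mixture d \<epsilon> \<alpha> v) = density (null_dist n d) (\<lambda>X. ennreal (sample_lr n d \<epsilon> \<alpha> v X))"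
proof -
  have [measurable]: "mixture_lr d \<epsilon> \<alpha> v \<in> borel_measurable (std_gaussian d)"
    unfolding mixture_lr_def tilt_def by measurable
  have "(\<Pi>\<^sub>M i\<in>{..<n}. mixture d \<epsilon> \<alpha> v) = density (null_dist n d) (\<lambda>X. \<Prod>i<n. ennreal (mixture_lr d \<epsilon> \<alpha> v (X i)))"
    unfolding mixture_eq_density null_dist_eq
    using prob_space_mixture[of v]
    by (intro PiM_density std_gaussian_product.product_sigma_finite_axioms product_sigma_finite.intro
        prob_space_imp_sigma_finite) (auto simp: mixture_eq_density)
  then show ?thesis by (simp add: sample_lr_def prod_ennreal mixture_lr_nonneg)
qed

lemma prob_space_sample: "prob_space (\<Pi>\<^sub>M i\<in>{..<n}. mixture d \<epsilon> \<alpha> v)"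
  by (intro prob_space_PiM prob_space_mixture)

lemma sample_lr_nonneg: "sample_lr n d \<epsilon> \<alpha> v X \<ge> 0"
  unfolding sample_lr_def by (intro prod_nonneg) (simp add: mixture_lr_nonneg)

text \<open>Both means have modulus at most \<open>\<alpha> / \<epsilon>\<close> and
  \<open>|v j| \<le> 1\<close>, so each component is bounded by the same product; a convex
  combination of the two is as well.\<close>

lemma sample_lr_le_envelope:
  assumes v: "L2_set v {..<d} \<le> 1"
  shows "sample_lr n d \<epsilon> \<alpha> v X \<le> (\<Prod>i<n. \<Prod>j<d. envelope (\<alpha> / \<epsilon>) (X i j))"
  unfolding sample_lr_def
proof (intro prod_mono conjI mixture_lr_nonneg)
  fix i
  let ?c = "\<alpha> / \<epsilon>"
  let ?E = "\<Prod>j<d. envelope ?c (X i j)"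
  have le: "(\<Prod>j<d. tilt (c * v j) (X i j)) \<le> ?E" if c: "\<bar>c\<bar> \<le> ?c" for c
  proof (intro prod_mono conjI)
    fix j assume j: "j \<in> {..<d}"
    have "\<bar>v j\<bar> \<le> L2_set v {..<d}"
      using j member_le_L2_set[of "{..<d}" j "\<lambda>j. \<bar>v j\<bar>"] by (simp add: L2_set_def)
    then have "\<bar>v j\<bar> \<le> 1" using v by simp
    then have "\<bar>c * v j\<bar> \<le> ?c * 1"
      unfolding abs_mult using c by (intro mult_mono) auto
    then show "tilt (c * v j) (X i j) \<le> envelope ?c (X i j)"
      by (intro tilt_le_envelope) simp
  qed (simp add: tilt_pos less_imp_le)
  have "\<bar>\<alpha>\<bar> \<le> ?c" using e a by (simp add: field_simps)
  moreover have "\<bar>- \<alpha> * (1 - \<epsilon>) / \<epsilon>\<bar> \<le> ?c" using e a by (simp add: abs_mult field_simps)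
  ultimately have "mixture_lr d \<epsilon> \<alpha> v (X i) \<le> (1 - \<epsilon>) * ?E + \<epsilon> * ?E"
    unfolding mixture_lr_def using e by (intro add_mono mult_left_mono le) auto
  also have "\<dots> = ?E" by (simp add: algebra_simps)
  finally show "mixture_lr d \<epsilon> \<alpha> v (X i) \<le> ?E" .
qed

lemma integrable_sample_lr_sphere:
  assumes X: "X \<in> space (null_dist n d)"
  shows "integrable (uniform_sphere d) (\<lambda>v. sample_lr n d \<epsilon> \<alpha> v X)"
proof -
  interpret prob_space "uniform_sphere d" by (rule prob_space_uniform_sphere)
  have "(\<lambda>v. sample_lr n d \<epsilon> \<alpha> v X) \<in> borel_measurable (uniform_sphere d)"
    using measurable_compose[OF measurable_Pair2'[OF X] measurable_sample_lr] by (simp cong: measurable_cong_sets)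
  then show ?thesis
    using AE_uniform_sphere[of d]
    by (intro integrable_const_bound[where B = "\<Prod>i<n. \<Prod>j<d. envelope (\<alpha> / \<epsilon>) (X i j)"])
       (auto simp: sample_lr_nonneg intro: sample_lr_le_envelope)
qed

lemma measurable_average_lr [measurable]: "average_lr n d \<epsilon> \<alpha> \<in> borel_measurable (null_dist n d)"
proof -
  interpret prob_space "uniform_sphere d" by (rule prob_space_uniform_sphere)
  have "(\<lambda>(X, v). sample_lr n d \<epsilon> \<alpha> v X) \<in> borel_measurable (null_dist n d \<Otimes>\<^sub>M uniform_sphere d)"
    using measurable_compose[OF measurable_pair_swap' measurable_sample_lr[of n d \<epsilon> \<alpha>]]
    by (simp add: case_prod_beta cong: measurable_cong_sets)
  then show ?thesis
    unfolding average_lr_def[abs_def] by (rule borel_measurable_lebesgue_integral)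
qed

lemma average_lr_bounds:
  assumes X: "X \<in> space (null_dist n d)"
  shows "0 \<le> average_lr n d \<epsilon> \<alpha> X"
    and "average_lr n d \<epsilon> \<alpha> X \<le> (\<Prod>i<n. \<Prod>j<d. envelope (\<alpha> / \<epsilon>) (X i j))"
proof -
  interpret prob_space "uniform_sphere d" by (rule prob_space_uniform_sphere)
  show "0 \<le> average_lr n d \<epsilon> \<alpha> X"
    unfolding average_lr_def by (simp add: sample_lr_nonneg)
  have "average_lr n d \<epsilon> \<alpha> X \<le> (\<integral>v. (\<Prod>i<n. \<Prod>j<d. envelope (\<alpha> / \<epsilon>) (X i j)) \<partial>uniform_sphere d)"
    unfolding average_lr_def using AE_uniform_sphere[of d] integrable_sample_lr_sphere[OF X]
    by (intro integral_mono_AE) (auto intro: sample_lr_le_envelope)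
  then show "average_lr n d \<epsilon> \<alpha> X \<le> (\<Prod>i<n. \<Prod>j<d. envelope (\<alpha> / \<epsilon>) (X i j))"
    by (simp add: prob_space)
qed

text \<open>Tonelli exchanges the integrals over direction and sample. Joint measurability of
  \<open>sample_lr\<close> also makes the map from \<open>v\<close> to the product measure a kernel,
  as the evaluation of the bind requires.\<close>

lemma alt_dist_eq_density:
  "alt_dist n d \<epsilon> \<alpha> = density (null_dist n d) (\<lambda>X. ennreal (average_lr n d \<epsilon> \<alpha> X))"
proof -
  interpret U: prob_space "uniform_sphere d" by (rule prob_space_uniform_sphere)
  interpret N: prob_space "null_dist n d" by (rule prob_space_null_dist)
  interpret P: pair_sigma_finite "uniform_sphere d" "null_dist n d" ..
  let ?K = "\<lambda>v. \<Pi>\<^sub>M i\<in>{..<n}. mixture d \<epsilon> \<alpha> v"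
  have meas [measurable]: "(\<lambda>(v, X). sample_lr n d \<epsilon> \<alpha> v X) \<in> borel_measurable (uniform_sphere d \<Otimes>\<^sub>M null_dist n d)"
    using measurable_sample_lr by (simp cong: measurable_cong_sets)
  have K: "?K \<in> measurable (uniform_sphere d) (subprob_algebra (null_dist n d))"
  proof (rule measurable_subprob_algebra)
    show "subprob_space (?K v)" for v
      by (intro prob_space_imp_subprob_space prob_space_sample)
    show "sets (?K v) = sets (null_dist n d)" for v
      by (simp add: sample_eq_density)
    fix A assume [measurable]: "A \<in> sets (null_dist n d)"
    have "(\<lambda>v. \<integral>\<^sup>+X. ennreal (sample_lr n d \<epsilon> \<alpha> v X) * indicator A X \<partial>null_dist n d) \<in> borel_measurable (uniform_sphere d)"
      by measurable
    moreover have "emeasure (?K v) A = (\<integral>\<^sup>+X. ennreal (sample_lr n d \<epsilon> \<alpha> v X) * indicator A X \<partial>null_dist n d)"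
      if "v \<in> space (uniform_sphere d)" for v
      unfolding sample_eq_density using that by (intro emeasure_density) auto
    ultimately show "(\<lambda>v. emeasure (?K v) A) \<in> borel_measurable (uniform_sphere d)"
      by (simp cong: measurable_cong)
  qed
  show ?thesis
  proof (rule measure_eqI)
    show s: "sets (alt_dist n d \<epsilon> \<alpha>) = sets (density (null_dist n d) (\<lambda>X. ennreal (average_lr n d \<epsilon> \<alpha> X)))"
      unfolding alt_dist_def using U.not_empty
      by (subst sets_bind[where N = "null_dist n d"]) (auto simp: sample_eq_density)
    fix A assume "A \<in> sets (alt_dist n d \<epsilon> \<alpha>)"
    then have A [measurable]: "A \<in> sets (null_dist n d)" unfolding s by simp
    have "emeasure (alt_dist n d \<epsilon> \<alpha>) A = (\<integral>\<^sup>+v. emeasure (?K v) A \<partial>uniform_sphere d)"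
      unfolding alt_dist_def by (rule emeasure_bind[OF U.not_empty K A])
    also have "\<dots> = (\<integral>\<^sup>+v. \<integral>\<^sup>+X. ennreal (sample_lr n d \<epsilon> \<alpha> v X) * indicator A X \<partial>null_dist n d \<partial>uniform_sphere d)"
      unfolding sample_eq_density by (intro nn_integral_cong emeasure_density) auto
    also have "\<dots> = (\<integral>\<^sup>+X. \<integral>\<^sup>+v. ennreal (sample_lr n d \<epsilon> \<alpha> v X) * indicator A X \<partial>uniform_sphere d \<partial>null_dist n d)"
      by (rule P.Fubini'[symmetric]) measurable
    also have "\<dots> = (\<integral>\<^sup>+X. ennreal (average_lr n d \<epsilon> \<alpha> X) * indicator A X \<partial>null_dist n d)"
    proof (rule nn_integral_cong)
      fix X assume X: "X \<in> space (null_dist n d)"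
      have "(\<integral>\<^sup>+v. ennreal (sample_lr n d \<epsilon> \<alpha> v X) * indicator A X \<partial>uniform_sphere d)
          = (\<integral>\<^sup>+v. ennreal (sample_lr n d \<epsilon> \<alpha> v X) \<partial>uniform_sphere d) * indicator A X"
        using integrable_sample_lr_sphere[OF X] by (intro nn_integral_multc) auto
      also have "(\<integral>\<^sup>+v. ennreal (sample_lr n d \<epsilon> \<alpha> v X) \<partial>uniform_sphere d) = ennreal (average_lr n d \<epsilon> \<alpha> X)"
        unfolding average_lr_def using integrable_sample_lr_sphere[OF X]
        by (intro nn_integral_eq_integral) (auto simp: sample_lr_nonneg)
      finally show "(\<integral>\<^sup>+v. ennreal (sample_lr n d \<epsilon> \<alpha> v X) * indicator A X \<partial>uniform_sphere d)
          = ennreal (average_lr n d \<epsilon> \<alpha> X) * indicator A X" .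
    qed
    also have "\<dots> = emeasure (density (null_dist n d) (\<lambda>X. ennreal (average_lr n d \<epsilon> \<alpha> X))) A"
      by (intro emeasure_density[symmetric]) auto
    finally show "emeasure (alt_dist n d \<epsilon> \<alpha>) A = emeasure (density (null_dist n d) (\<lambda>X. ennreal (average_lr n d \<epsilon> \<alpha> X))) A" .
  qed
qed

text \<open>Uniqueness of the Radon-Nikodym derivative; nonnegativity of \<open>average_lr\<close>
  lets \<open>enn2real\<close> undo \<open>ennreal\<close>.\<close>

lemma likelihood_ratio_eq_average_lr:
  "AE X in null_dist n d. likelihood_ratio (null_dist n d) (alt_dist n d \<epsilon> \<alpha>) X = average_lr n d \<epsilon> \<alpha> X"
proof -
  interpret N: prob_space "null_dist n d" by (rule prob_space_null_dist)
  have "AE X in null_dist n d. ennreal (average_lr n d \<epsilon> \<alpha> X) = RN_deriv (null_dist n d) (alt_dist n d \<epsilon> \<alpha>) X"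
    by (rule N.RN_deriv_unique) (auto simp: alt_dist_eq_density)
  then show ?thesis
    using AE_space
  proof eventually_elim
    case (elim X)
    then show ?case by (simp add: likelihood_ratio_def average_lr_bounds flip: elim(1))
  qed
qed

lemma square_integrable_average_lr: "square_integrable (null_dist n d) (average_lr n d \<epsilon> \<alpha>)"
proof -
  have "integrable (null_dist n d) (\<lambda>X. \<Prod>i<n. \<Prod>j<d. (envelope (\<alpha> / \<epsilon>) (X i j))\<^sup>2)"
    by (intro null_dist_prod_integral integrable_envelope_sq)
  then have "integrable (null_dist n d) (\<lambda>X. (average_lr n d \<epsilon> \<alpha> X)\<^sup>2)"
  proof (rule Bochner_Integration.integrable_bound)
    show "AE X in null_dist n d. norm ((average_lr n d \<epsilon> \<alpha> X)\<^sup>2)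
        \<le> norm (\<Prod>i<n. \<Prod>j<d. (envelope (\<alpha> / \<epsilon>) (X i j))\<^sup>2)"
    proof (rule AE_I2)
      fix X assume "X \<in> space (null_dist n d)"
      then have "(average_lr n d \<epsilon> \<alpha> X)\<^sup>2 \<le> (\<Prod>i<n. \<Prod>j<d. envelope (\<alpha> / \<epsilon>) (X i j))\<^sup>2"
        using average_lr_bounds by (intro power_mono) auto
      then show "norm ((average_lr n d \<epsilon> \<alpha> X)\<^sup>2) \<le> norm (\<Prod>i<n. \<Prod>j<d. (envelope (\<alpha> / \<epsilon>) (X i j))\<^sup>2)"
        by (simp add: prod_power_distrib prod_nonneg)
    qed
  qed measurable
  then show ?thesis by (simp add: square_integrable_def)
qed

lemma square_integrable_likelihood_ratio:
  "square_integrable (null_dist n d) (likelihood_ratio (null_dist n d) (alt_dist n d \<epsilon> \<alpha>))"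
proof -
  have meas [measurable]: "likelihood_ratio (null_dist n d) (alt_dist n d \<epsilon> \<alpha>) \<in> borel_measurable (null_dist n d)"
    unfolding likelihood_ratio_def[abs_def] by measurable
  have "integrable (null_dist n d) (\<lambda>X. (likelihood_ratio (null_dist n d) (alt_dist n d \<epsilon> \<alpha>) X)\<^sup>2)
      \<longleftrightarrow> integrable (null_dist n d) (\<lambda>X. (average_lr n d \<epsilon> \<alpha> X)\<^sup>2)"
    using likelihood_ratio_eq_average_lr by (intro integrable_cong_AE) auto
  then show ?thesis
    using square_integrable_average_lr meas by (simp add: square_integrable_def)
qed

end

section \<open>Hermite basis of the polynomials of bounded degree\<close>

lemma square_integrable_mult:
  assumes "square_integrable M f" "square_integrable M g"
  shows "integrable M (\<lambda>x. f x * g x)"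
proof -
  have [measurable]: "f \<in> borel_measurable M" "g \<in> borel_measurable M"
    using assms by (auto simp: square_integrable_def)
  have "integrable M (\<lambda>x. (f x)\<^sup>2 + (g x)\<^sup>2)"
    using assms by (auto simp: square_integrable_def)
  then show ?thesis
  proof (rule Bochner_Integration.integrable_bound)
    have "\<bar>a * b\<bar> \<le> a\<^sup>2 + b\<^sup>2" for a b :: real
    proof -
      have "2 * (\<bar>a\<bar> * \<bar>b\<bar>) \<le> a\<^sup>2 + b\<^sup>2"
        using zero_le_power2[of "\<bar>a\<bar> - \<bar>b\<bar>"] by (simp add: power2_diff)
      moreover have "0 \<le> \<bar>a\<bar> * \<bar>b\<bar>" by simp
      ultimately show ?thesis unfolding abs_mult by linarith
    qed
    then show "AE x in M. norm (f x * g x) \<le> norm ((f x)\<^sup>2 + (g x)\<^sup>2)" by simp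
  qed measurable
qed

lemma square_integrable_sum:
  assumes "finite B" "\<And>b. b \<in> B \<Longrightarrow> square_integrable M (h b)"
  shows "square_integrable M (\<lambda>x. \<Sum>b\<in>B. c b * h b x)"
proof -
  have "integrable M (\<lambda>x. \<Sum>a\<in>B. \<Sum>b\<in>B. c a * c b * (h a x * h b x))"
    using assms by (intro Bochner_Integration.integrable_sum integrable_mult_right square_integrable_mult) auto
  moreover have "(\<Sum>a\<in>B. \<Sum>b\<in>B. c a * c b * (h a x * h b x)) = (\<Sum>b\<in>B. c b * h b x)\<^sup>2" for x
    unfolding power2_eq_square sum_product by (simp add: mult_ac)
  moreover have "(\<lambda>x. \<Sum>b\<in>B. c b * h b x) \<in> borel_measurable M"
    using assms by (intro borel_measurable_sum borel_measurable_times) (auto simp: square_integrable_def)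
  ultimately show ?thesis by (simp add: square_integrable_def)
qed

context
  fixes M :: "'a measure" and B :: "'b set" and h :: "'b \<Rightarrow> 'a \<Rightarrow> real" and V :: "('a \<Rightarrow> real) set"
  assumes fin: "finite B"
    and sq: "\<And>b. b \<in> B \<Longrightarrow> square_integrable M (h b)"
    and orth: "\<And>a b. a \<in> B \<Longrightarrow> b \<in> B \<Longrightarrow> (\<integral>x. h a x * h b x \<partial>M) = of_bool (a = b)"
    and V_eq: "V = range (\<lambda>c x. \<Sum>b\<in>B. c b * h b x)"
begin

lemma inner_combination:
  assumes f: "square_integrable M f"
  shows "(\<integral>x. f x * (\<Sum>b\<in>B. c b * h b x) \<partial>M) = (\<Sum>b\<in>B. c b * (\<integral>x. f x * h b x \<partial>M))"
proof -
  have "(\<integral>x. f x * (\<Sum>b\<in>B. c b * h b x) \<partial>M) = (\<integral>x. (\<Sum>b\<in>B. c b * (f x * h b x)) \<partial>M)"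
    by (simp add: sum_distrib_left mult_ac)
  also have "\<dots> = (\<Sum>b\<in>B. c b * (\<integral>x. f x * h b x \<partial>M))"
    using square_integrable_mult[OF f sq] by (subst Bochner_Integration.integral_sum) auto
  finally show ?thesis .
qed

lemma combination_coefficient:
  assumes a: "a \<in> B"
  shows "(\<integral>x. (\<Sum>b\<in>B. c b * h b x) * h a x \<partial>M) = c a"
proof -
  have "(\<integral>x. (\<Sum>b\<in>B. c b * h b x) * h a x \<partial>M) = (\<Sum>b\<in>B. c b * (\<integral>x. h a x * h b x \<partial>M))"
    using inner_combination[OF sq[OF a], of c] by (simp add: mult.commute)
  also have "\<dots> = (\<Sum>b\<in>B. if b = a then c b else 0)"
    using a by (intro sum.cong) (auto simp: orth)
  finally show ?thesis using fin a by simp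
qed

lemma combination_norm:
  "(\<integral>x. (\<Sum>b\<in>B. c b * h b x)\<^sup>2 \<partial>M) = (\<Sum>b\<in>B. (c b)\<^sup>2)"
  unfolding power2_eq_square
  by (subst inner_combination) (auto intro!: square_integrable_sum fin sq sum.cong simp: combination_coefficient)

lemma square_integrable_span: "q \<in> V \<Longrightarrow> square_integrable M q"
  unfolding V_eq using fin sq by (auto intro!: square_integrable_sum)

text \<open>Existence makes the \<open>SOME\<close> in \<open>L2_projection\<close> an actual
  projection; the witness carries the Fourier coefficients of \<open>f\<close>.\<close>

lemma L2_projection_exists:
  assumes f: "square_integrable M f"
  shows "\<exists>p. is_L2_projection M V f p"
proof -
  define c where "c b = (\<integral>x. f x * h b x \<partial>M)" for b
  let ?p = "\<lambda>x. \<Sum>b\<in>B. c b * h b x"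
  have p: "?p \<in> V" unfolding V_eq by blast
  have "(\<integral>x. (f x - ?p x) * q x \<partial>M) = 0" if q: "q \<in> V" for q
  proof -
    obtain c' where c': "q = (\<lambda>x. \<Sum>b\<in>B. c' b * h b x)" using q unfolding V_eq by blast
    have "(\<integral>x. (f x - ?p x) * q x \<partial>M) = (\<integral>x. f x * q x \<partial>M) - (\<integral>x. ?p x * q x \<partial>M)"
      unfolding left_diff_distrib
      using f square_integrable_span p q
      by (intro Bochner_Integration.integral_diff square_integrable_mult) auto
    also have "\<dots> = (\<Sum>b\<in>B. c' b * c b) - (\<Sum>b\<in>B. c' b * (\<integral>x. ?p x * h b x \<partial>M))"
      unfolding c' c_def[symmetric]
      using inner_combination[OF f] inner_combination[OF square_integrable_span[OF p]] by (simp add: c_def)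
    also have "\<dots> = 0"
      by (simp add: combination_coefficient)
    finally show ?thesis .
  qed
  then show ?thesis
    using p f square_integrable_span unfolding is_L2_projection_def by blast
qed

text \<open>Parseval's identity, with the coefficients of \<open>p\<close> replaced by those of
  \<open>f\<close>: they agree because \<open>f - p\<close> is orthogonal to every basis
  function.\<close>

lemma L2_projection_diff_norm:
  assumes p: "is_L2_projection M V f p" and g: "g \<in> V"
  shows "(\<integral>x. (p x - g x)\<^sup>2 \<partial>M) = (\<Sum>b\<in>B. ((\<integral>x. f x * h b x \<partial>M) - (\<integral>x. g x * h b x \<partial>M))\<^sup>2)"
proof -
  have f: "square_integrable M f" and pV: "p \<in> V"
    and ortho: "\<And>q. q \<in> V \<Longrightarrow> (\<integral>x. (f x - p x) * q x \<partial>M) = 0"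
    using p unfolding is_L2_projection_def by auto
  obtain cp where cp: "p = (\<lambda>x. \<Sum>b\<in>B. cp b * h b x)" using pV unfolding V_eq by blast
  obtain cg where cg: "g = (\<lambda>x. \<Sum>b\<in>B. cg b * h b x)" using g unfolding V_eq by blast
  have hV: "h b \<in> V" if "b \<in> B" for b
  proof -
    have "h b = (\<lambda>x. \<Sum>a\<in>B. of_bool (a = b) * h a x)"
      using that fin by (simp add: of_bool_def if_distrib[where f = "\<lambda>t. t * _"] cong: if_cong)
    then show ?thesis unfolding V_eq by (intro range_eqI[where x = "\<lambda>a. of_bool (a = b)"])
  qed
  have "(\<integral>x. f x * h b x \<partial>M) = cp b" if b: "b \<in> B" for b
  proof -
    have "0 = (\<integral>x. f x * h b x \<partial>M) - (\<integral>x. p x * h b x \<partial>M)"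
      using ortho[OF hV[OF b]] f square_integrable_span[OF pV] sq[OF b]
      by (simp add: left_diff_distrib square_integrable_mult)
    then show ?thesis using combination_coefficient[OF b, of cp] unfolding cp by simp
  qed
  moreover have "(\<integral>x. g x * h b x \<partial>M) = cg b" if b: "b \<in> B" for b
    using combination_coefficient[OF b, of cg] unfolding cg by simp
  moreover have "(\<integral>x. (p x - g x)\<^sup>2 \<partial>M) = (\<Sum>b\<in>B. (cp b - cg b)\<^sup>2)"
    using combination_norm[of "\<lambda>b. cp b - cg b"] unfolding cp cg
    by (simp add: left_diff_distrib sum_subtractf)
  ultimately show ?thesis by simp
qed

end

definition hermite_prod :: "nat \<Rightarrow> nat \<Rightarrow> (nat \<Rightarrow> nat \<Rightarrow> nat) \<Rightarrow> (nat \<Rightarrow> nat \<Rightarrow> real) \<Rightarrow> real" where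
  "hermite_prod n d m X = (\<Prod>i<n. \<Prod>j<d. hermite_fun (m i j) (X i j))"

abbreviation index_box :: "nat \<Rightarrow> nat \<Rightarrow> nat \<Rightarrow> (nat \<Rightarrow> nat \<Rightarrow> nat) set" where
  "index_box n d D \<equiv> PiE {..<n} (\<lambda>_. PiE {..<d} (\<lambda>_. {..D}))"

text \<open>Extensional functions make index arrays with equal entries equal. The entry bound in the
  box gives finiteness and excludes no extensional array of total degree at most
  \<open>D\<close>.\<close>

definition multi_indices :: "nat \<Rightarrow> nat \<Rightarrow> nat \<Rightarrow> (nat \<Rightarrow> nat \<Rightarrow> nat) set" where
  "multi_indices n d D = {m \<in> index_box n d D. (\<Sum>i<n. \<Sum>j<d. m i j) \<le> D}"

lemma finite_index_box: "finite (index_box n d D)"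
  by (intro finite_PiE) auto

lemma finite_multi_indices: "finite (multi_indices n d D)"
  unfolding multi_indices_def using finite_index_box[of n d D] by simp

lemma multi_indices_eqI:
  assumes "m \<in> multi_indices n d D" "m' \<in> multi_indices n d D"
    and "\<And>i j. i < n \<Longrightarrow> j < d \<Longrightarrow> m i j = m' i j"
  shows "m = m'"
proof (rule PiE_ext[where k = "{..<n}"])
  show "m \<in> index_box n d D" using assms by (simp add: multi_indices_def)
  show "m' \<in> index_box n d D" using assms by (simp add: multi_indices_def)
  fix i assume i: "i \<in> {..<n}"
  show "m i = m' i"
  proof (rule PiE_ext[where k = "{..<d}"])
    show "m i \<in> PiE {..<d} (\<lambda>_. {..D})" "m' i \<in> PiE {..<d} (\<lambda>_. {..D})"
      using assms(1,2) i unfolding multi_indices_def by (blast dest: PiE_mem)+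
    show "m i j = m' i j" if "j \<in> {..<d}" for j
      using assms(3) i that by simp
  qed
qed

text \<open>The integral factors over the coordinates, and distinct indices differ in some
  coordinate, whose factor is zero.\<close>

lemma hermite_prod_orthonormal:
  assumes "m \<in> multi_indices n d D" "m' \<in> multi_indices n d D"
  shows "integrable (null_dist n d) (\<lambda>X. hermite_prod n d m X * hermite_prod n d m' X)"
    and "(\<integral>X. hermite_prod n d m X * hermite_prod n d m' X \<partial>null_dist n d) = of_bool (m = m')"
proof -
  have eq: "hermite_prod n d m X * hermite_prod n d m' X
      = (\<Prod>i<n. \<Prod>j<d. hermite_fun (m i j) (X i j) * hermite_fun (m' i j) (X i j))" for X
    by (simp add: hermite_prod_def prod.distrib)
  show "integrable (null_dist n d) (\<lambda>X. hermite_prod n d m X * hermite_prod n d m' X)"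
    unfolding eq by (intro null_dist_prod_integral integrable_hermite_fun_mult)
  have "(\<integral>X. hermite_prod n d m X * hermite_prod n d m' X \<partial>null_dist n d)
      = (\<Prod>i<n. \<Prod>j<d. of_bool (m i j = m' i j))"
    unfolding eq by (subst null_dist_prod_integral) (auto simp: integrable_hermite_fun_mult hermite_fun_orthonormal)
  also have "\<dots> = of_bool (m = m')"
  proof (cases "m = m'")
    case False
    then obtain i j where "i < n" "j < d" "m i j \<noteq> m' i j"
      using multi_indices_eqI[OF assms] by blast
    then have "(\<Prod>j<d. of_bool (m i j = m' i j)) = (0 :: real)"
      by (intro prod_zero) (use \<open>j < d\<close> in auto)
    then have "(\<Prod>i<n. \<Prod>j<d. of_bool (m i j = m' i j)) = (0 :: real)"
      by (intro prod_zero) (use \<open>i < n\<close> in auto)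
    then show ?thesis using False by simp
  qed simp
  finally show "(\<integral>X. hermite_prod n d m X * hermite_prod n d m' X \<partial>null_dist n d) = of_bool (m = m')" .
qed

lemma measurable_hermite_prod [measurable]: "hermite_prod n d m \<in> borel_measurable (null_dist n d)"
  unfolding hermite_prod_def[abs_def]
  by (intro borel_measurable_prod measurable_compose[OF measurable_null_dist_component]) auto

lemma square_integrable_hermite_prod:
  "m \<in> multi_indices n d D \<Longrightarrow> square_integrable (null_dist n d) (hermite_prod n d m)"
  using hermite_prod_orthonormal(1)[of m n d D m] by (simp add: square_integrable_def power2_eq_square)

text \<open>Multiplies out one-variable expansions over all coordinates. With \<open>f\<close> and
  \<open>g\<close> arbitrary it serves both directions of the change of basis between monomials and
  Hermite functions.\<close>

lemma nested_prod_expansion: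
  fixes f g :: "nat \<Rightarrow> real \<Rightarrow> real" and m :: "nat \<Rightarrow> nat \<Rightarrow> nat"
  assumes "\<And>a x. f a x = (\<Sum>b\<le>a. c a b * g b x)"
  shows "(\<Prod>i<n. \<Prod>j<d. f (m i j) (X i j))
       = (\<Sum>m'\<in>PiE {..<n} (\<lambda>i. PiE {..<d} (\<lambda>j. {..m i j})).
            (\<Prod>i<n. \<Prod>j<d. c (m i j) (m' i j)) * (\<Prod>i<n. \<Prod>j<d. g (m' i j) (X i j)))"
proof -
  have "(\<Prod>i<n. \<Prod>j<d. f (m i j) (X i j))
      = (\<Prod>i<n. \<Sum>r\<in>PiE {..<d} (\<lambda>j. {..m i j}). \<Prod>j<d. c (m i j) (r j) * g (r j) (X i j))"
    unfolding assms by (intro prod.cong refl prod_sum_PiE) auto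
  also have "\<dots> = (\<Sum>m'\<in>PiE {..<n} (\<lambda>i. PiE {..<d} (\<lambda>j. {..m i j})).
            \<Prod>i<n. \<Prod>j<d. c (m i j) (m' i j) * g (m' i j) (X i j))"
    by (rule prod_sum_PiE) (auto intro!: finite_PiE)
  finally show ?thesis by (simp add: prod.distrib)
qed

text \<open>Triangular expansions only lower exponents, so the total degree does not grow.\<close>

lemma sub_index_in_multi_indices:
  assumes "m' \<in> PiE {..<n} (\<lambda>i. PiE {..<d} (\<lambda>j. {..m i j}))" "(\<Sum>i<n. \<Sum>j<d. m i j) \<le> D"
  shows "m' \<in> multi_indices n d D"
proof -
  have le: "m' i j \<le> m i j" if "i < n" "j < d" for i j
    using assms(1) that by (auto simp: PiE_iff)
  have tot: "(\<Sum>i<n. \<Sum>j<d. m' i j) \<le> D"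
    using assms(2) le by (auto intro!: sum_mono elim!: order_trans[rotated])
  have "m' i j \<le> D" if "i < n" "j < d" for i j
  proof -
    have "m' i j \<le> (\<Sum>j<d. m' i j)" using that by (intro member_le_sum) auto
    also have "\<dots> \<le> (\<Sum>i<n. \<Sum>j<d. m' i j)" using that by (intro member_le_sum[where f = "\<lambda>i. \<Sum>j<d. m' i j"]) auto
    finally show ?thesis using tot by simp
  qed
  then show ?thesis using tot assms(1) by (auto simp: multi_indices_def PiE_iff)
qed

text \<open>The representations of the summands are merged on the union of their index sets, with
  coefficients extended by zero by means of \<open>of_bool\<close>.\<close>

lemma polynomials_upto_sum:
  assumes "finite A" "\<And>a. a \<in> A \<Longrightarrow> p a \<in> polynomials_upto n d D"
  shows "(\<lambda>X. \<Sum>a\<in>A. w a * p a X) \<in> polynomials_upto n d D"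
proof -
  let ?mon = "\<lambda>m X. \<Prod>i<n. \<Prod>j<d. X i j ^ (m i j :: nat) :: real"
  have "\<forall>a\<in>A. \<exists>Sc. finite (fst Sc) \<and> (\<forall>m\<in>fst Sc. (\<Sum>i<n. \<Sum>j<d. m i j) \<le> D) \<and>
      p a = (\<lambda>X. \<Sum>m\<in>fst Sc. snd Sc m * ?mon m X)"
    using assms(2) unfolding polynomials_upto_def by force
  from bchoice[OF this] obtain Sc where Sc: "\<forall>a\<in>A. finite (fst (Sc a)) \<and>
      (\<forall>m\<in>fst (Sc a). (\<Sum>i<n. \<Sum>j<d. m i j) \<le> D) \<and>
      p a = (\<lambda>X. \<Sum>m\<in>fst (Sc a). snd (Sc a) m * ?mon m X)" ..
  define S where "S a = fst (Sc a)" for a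
  define c where "c a = snd (Sc a)" for a
  have S: "\<And>a. a \<in> A \<Longrightarrow> finite (S a)"
    "\<And>a m. a \<in> A \<Longrightarrow> m \<in> S a \<Longrightarrow> (\<Sum>i<n. \<Sum>j<d. m i j) \<le> D"
    "\<And>a. a \<in> A \<Longrightarrow> p a = (\<lambda>X. \<Sum>m\<in>S a. c a m * ?mon m X)"
    using Sc by (auto simp: S_def c_def)
  let ?U = "\<Union>a\<in>A. S a"
  have finU: "finite ?U" using assms(1) S(1) by blast
  have "(\<Sum>a\<in>A. w a * p a X) = (\<Sum>m\<in>?U. (\<Sum>a\<in>A. w a * (of_bool (m \<in> S a) * c a m)) * ?mon m X)" for X
  proof -
    have "(\<Sum>a\<in>A. w a * p a X) = (\<Sum>a\<in>A. w a * (\<Sum>m\<in>?U. of_bool (m \<in> S a) * c a m * ?mon m X))"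
      using S finU by (intro sum.cong refl arg_cong2[where f = "(*)"])
        (auto intro!: sum.mono_neutral_cong_left)
    also have "\<dots> = (\<Sum>m\<in>?U. \<Sum>a\<in>A. w a * (of_bool (m \<in> S a) * c a m * ?mon m X))"
      by (subst sum.swap) (simp add: sum_distrib_left)
    finally show ?thesis by (simp add: sum_distrib_right mult.assoc)
  qed
  then show ?thesis
    unfolding polynomials_upto_def mem_Collect_eq using finU S(2)
    by (intro exI[of _ ?U] exI[of _ "\<lambda>m. \<Sum>a\<in>A. w a * (of_bool (m \<in> S a) * c a m)"]) auto
qed

lemma monomial_in_polynomials_upto:
  assumes "(\<Sum>i<n. \<Sum>j<d. m i j) \<le> D"
  shows "(\<lambda>X. \<Prod>i<n. \<Prod>j<d. X i j ^ m i j) \<in> polynomials_upto n d D"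
  unfolding polynomials_upto_def mem_Collect_eq
  using assms by (intro exI[of _ "{m}"] exI[of _ "\<lambda>_. 1"]) auto

lemma hermite_prod_in_polynomials_upto:
  assumes "m \<in> multi_indices n d D"
  shows "hermite_prod n d m \<in> polynomials_upto n d D"
proof -
  have expand: "hermite_fun a x = (\<Sum>b\<le>a. (coeff (hermite a) b / sqrt (fact a)) * x ^ b)" for a x
    unfolding hermite_fun_def by (simp add: poly_altdef hermite_degree sum_divide_distrib)
  have tot: "(\<Sum>i<n. \<Sum>j<d. m i j) \<le> D" using assms by (simp add: multi_indices_def)
  show ?thesis
    unfolding hermite_prod_def[abs_def] nested_prod_expansion[where f = hermite_fun and g = "\<lambda>b x. x ^ b", OF expand]
    using sub_index_in_multi_indices[OF _ tot]
    by (intro polynomials_upto_sum monomial_in_polynomials_upto) (auto intro!: finite_PiE simp: multi_indices_def)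
qed

text \<open>The change of basis is triangular in both directions and hence preserves the degree
  bound.\<close>

lemma polynomials_upto_eq_hermite_span:
  "polynomials_upto n d D = range (\<lambda>c X. \<Sum>m\<in>multi_indices n d D. c m * hermite_prod n d m X)"
proof (intro equalityI subsetI)
  fix q assume "q \<in> range (\<lambda>c X. \<Sum>m\<in>multi_indices n d D. c m * hermite_prod n d m X)"
  then show "q \<in> polynomials_upto n d D"
    using polynomials_upto_sum[OF finite_multi_indices hermite_prod_in_polynomials_upto] by auto
next
  fix q assume "q \<in> polynomials_upto n d D"
  then obtain S c where S: "finite S" "\<And>m. m \<in> S \<Longrightarrow> (\<Sum>i<n. \<Sum>j<d. m i j) \<le> D"
    and q: "q = (\<lambda>X. \<Sum>m\<in>S. c m * (\<Prod>i<n. \<Prod>j<d. X i j ^ m i j))"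
    unfolding polynomials_upto_def by auto
  have "\<exists>c. \<forall>x::real. x ^ a = (\<Sum>b\<le>a. c b * hermite_fun b x)" for a
    using poly_hermite_expansion[of "monom 1 a" a] by (simp add: poly_monom degree_monom_eq)
  then obtain co where co: "\<And>a x. (x::real) ^ a = (\<Sum>b\<le>a. co a b * hermite_fun b x)"
    by metis
  let ?I = "\<lambda>m. PiE {..<n} (\<lambda>i. PiE {..<d} (\<lambda>j. {..m i j}))"
  let ?C = "\<lambda>m m'. \<Prod>i<n. \<Prod>j<d. co (m i j) (m' i j)"
  \<comment> \<open>The indices from expanding a monomial depend on \<open>m\<close>;
    \<open>of_bool\<close> extends all expansions to the common set
    \<open>multi_indices n d D\<close>, so that the sums can be swapped.\<close>
  have "q X = (\<Sum>m'\<in>multi_indices n d D. (\<Sum>m\<in>S. c m * (of_bool (m' \<in> ?I m) * ?C m m')) * hermite_prod n d m' X)" for X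
  proof -
    have mono: "(\<Prod>i<n. \<Prod>j<d. X i j ^ m i j)
        = (\<Sum>m'\<in>multi_indices n d D. of_bool (m' \<in> ?I m) * ?C m m' * hermite_prod n d m' X)" if "m \<in> S" for m
      unfolding nested_prod_expansion[where f = "\<lambda>b x. x ^ b" and g = hermite_fun, OF co] hermite_prod_def
      using sub_index_in_multi_indices[OF _ S(2)[OF that]] finite_multi_indices
      by (intro sum.mono_neutral_cong_left) auto
    have "q X = (\<Sum>m\<in>S. c m * (\<Sum>m'\<in>multi_indices n d D. of_bool (m' \<in> ?I m) * ?C m m' * hermite_prod n d m' X))"
      unfolding q by (intro sum.cong refl) (simp only: mono)
    also have "\<dots> = (\<Sum>m'\<in>multi_indices n d D. \<Sum>m\<in>S. c m * (of_bool (m' \<in> ?I m) * ?C m m' * hermite_prod n d m' X))"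
      by (subst sum.swap) (simp only: sum_distrib_left)
    finally show ?thesis by (simp only: sum_distrib_right mult.assoc)
  qed
  then show "q \<in> range (\<lambda>c X. \<Sum>m\<in>multi_indices n d D. c m * hermite_prod n d m X)"
    by (intro range_eqI[where x = "\<lambda>m'. \<Sum>m\<in>S. c m * (of_bool (m' \<in> ?I m) * ?C m m')"]) auto
qed

section \<open>Hermite coefficients of the likelihood ratio\<close>

text \<open>For \<open>\<kappa> = mix_moment \<epsilon> \<alpha>\<close>, the Hermite coefficient at
  \<open>m\<close> of the likelihood ratio with fixed direction \<open>v\<close>. The summation over
  \<open>m\<close> works for any \<open>\<kappa>\<close>.\<close>

definition direction_coeff :: "nat \<Rightarrow> nat \<Rightarrow> (nat \<Rightarrow> real) \<Rightarrow> (nat \<Rightarrow> nat \<Rightarrow> nat) \<Rightarrow> (nat \<Rightarrow> real) \<Rightarrow> real" where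
  "direction_coeff n d \<kappa> m v =
     (\<Prod>i<n. \<kappa> (\<Sum>j<d. m i j) * (\<Prod>j<d. v j ^ m i j / sqrt (fact (m i j))))"

text \<open>A component with mean \<open>c v\<close> contributes \<open>c^|r|\<close> times a factor
  independent of \<open>c\<close>; weighting the two values of \<open>c^|r|\<close> gives the
  mixture moment.\<close>

lemma mixture_hermite_integral:
  "has_bochner_integral (std_gaussian d) (\<lambda>x. mixture_lr d \<epsilon> \<alpha> v x * (\<Prod>j<d. hermite_fun (r j) (x j)))
     (mix_moment \<epsilon> \<alpha> (\<Sum>j<d. r j) * (\<Prod>j<d. v j ^ r j / sqrt (fact (r j))))"
proof -
  have part: "has_bochner_integral (std_gaussian d)
      (\<lambda>x. \<Prod>j<d. tilt (c * v j) (x j) * hermite_fun (r j) (x j))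
      (c ^ (\<Sum>j<d. r j) * (\<Prod>j<d. v j ^ r j / sqrt (fact (r j))))" for c
  proof -
    have t: "integrable std_normal (\<lambda>x. tilt (c * v j) x * hermite_fun (r j) x)"
      "(\<integral>x. tilt (c * v j) x * hermite_fun (r j) x \<partial>std_normal) = (c * v j) ^ r j / sqrt (fact (r j))" for j
      using tilt_hermite_integral[of "c * v j" "r j"] by (auto simp: has_bochner_integral_iff)
    have "(\<Prod>j<d. (c * v j) ^ r j / sqrt (fact (r j)))
        = c ^ (\<Sum>j<d. r j) * (\<Prod>j<d. v j ^ r j / sqrt (fact (r j)))"
      by (simp add: power_mult_distrib power_sum flip: prod.distrib)
    then show ?thesis
      using std_gaussian_prod_integral[OF t(1)] by (simp add: has_bochner_integral_iff t(2))
  qed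
  have "has_bochner_integral (std_gaussian d)
     (\<lambda>x. (1 - \<epsilon>) * (\<Prod>j<d. tilt (\<alpha> * v j) (x j) * hermite_fun (r j) (x j))
        + \<epsilon> * (\<Prod>j<d. tilt (- \<alpha> * (1 - \<epsilon>) / \<epsilon> * v j) (x j) * hermite_fun (r j) (x j)))
     ((1 - \<epsilon>) * (\<alpha> ^ (\<Sum>j<d. r j) * (\<Prod>j<d. v j ^ r j / sqrt (fact (r j))))
        + \<epsilon> * ((- \<alpha> * (1 - \<epsilon>) / \<epsilon>) ^ (\<Sum>j<d. r j) * (\<Prod>j<d. v j ^ r j / sqrt (fact (r j)))))"
    by (intro has_bochner_integral_add has_bochner_integral_mult_right part)
  then show ?thesis
    unfolding mixture_lr_def mix_moment_def prod.distrib distrib_right mult.assoc .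
qed

lemma sample_hermite_integral:
  "has_bochner_integral (null_dist n d) (\<lambda>X. sample_lr n d \<epsilon> \<alpha> v X * hermite_prod n d m X)
     (direction_coeff n d (mix_moment \<epsilon> \<alpha>) m v)"
proof -
  let ?f = "\<lambda>i x. mixture_lr d \<epsilon> \<alpha> v x * (\<Prod>j<d. hermite_fun (m i j) (x j))"
  have f: "integrable (std_gaussian d) (?f i)" "integral\<^sup>L (std_gaussian d) (?f i)
      = mix_moment \<epsilon> \<alpha> (\<Sum>j<d. m i j) * (\<Prod>j<d. v j ^ m i j / sqrt (fact (m i j)))" for i
    using mixture_hermite_integral[of d \<epsilon> \<alpha> v "m i"] by (auto simp: has_bochner_integral_iff)
  have eq: "sample_lr n d \<epsilon> \<alpha> v X * hermite_prod n d m X = (\<Prod>i<n. ?f i (X i))" for X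
    by (simp add: sample_lr_def hermite_prod_def prod.distrib)
  show ?thesis
    unfolding eq direction_coeff_def
    using null_dist_row_integral[of n d ?f, OF f(1)] by (simp add: has_bochner_integral_iff f(2))
qed

lemma direction_coeff_bound:
  assumes "L2_set v {..<d} \<le> 1"
  shows "\<bar>direction_coeff n d \<kappa> m v\<bar> \<le> (\<Prod>i<n. \<bar>\<kappa> (\<Sum>j<d. m i j)\<bar>)"
proof -
  have "(\<Prod>j<d. \<bar>v j ^ m i j / sqrt (fact (m i j))\<bar>) \<le> 1" for i
  proof (intro prod_le_1 conjI)
    fix j assume j: "j \<in> {..<d}"
    have "\<bar>v j\<bar> \<le> L2_set v {..<d}"
      using j member_le_L2_set[of "{..<d}" j "\<lambda>j. \<bar>v j\<bar>"] by (simp add: L2_set_def)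
    then have "\<bar>v j\<bar> ^ m i j \<le> 1" using assms by (intro power_le_one) auto
    moreover have "1 \<le> sqrt (fact (m i j))" by simp
    ultimately have "\<bar>v j\<bar> ^ m i j / sqrt (fact (m i j)) \<le> 1 / 1"
      by (intro frac_le) auto
    then show "\<bar>v j ^ m i j / sqrt (fact (m i j))\<bar> \<le> 1"
      by (simp add: power_abs)
  qed simp
  then have "(\<Prod>i<n. \<bar>\<kappa> (\<Sum>j<d. m i j)\<bar> * (\<Prod>j<d. \<bar>v j ^ m i j / sqrt (fact (m i j))\<bar>))
      \<le> (\<Prod>i<n. \<bar>\<kappa> (\<Sum>j<d. m i j)\<bar>)"
    by (intro prod_mono) (auto intro!: mult_left_le mult_nonneg_nonneg prod_nonneg)
  then show ?thesis
    by (simp add: direction_coeff_def abs_prod abs_mult)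
qed

lemma measurable_direction_coeff [measurable]:
  "direction_coeff n d \<kappa> m \<in> borel_measurable (uniform_sphere d)"
  unfolding direction_coeff_def[abs_def] by measurable

lemma integrable_direction_coeff: "integrable (uniform_sphere d) (direction_coeff n d \<kappa> m)"
proof -
  interpret prob_space "uniform_sphere d" by (rule prob_space_uniform_sphere)
  show ?thesis
    using AE_uniform_sphere[of d]
    by (intro integrable_const_bound[where B = "\<Prod>i<n. \<bar>\<kappa> (\<Sum>j<d. m i j)\<bar>"])
       (auto intro: direction_coeff_bound)
qed

text \<open>Fubini moves the average over directions outside the integral over samples, where
  \<open>sample_hermite_integral\<close> applies.\<close>

lemma likelihood_ratio_coefficient:
  assumes e: "0 < \<epsilon>" "\<epsilon> \<le> 1" and a: "0 < \<alpha>" and m: "m \<in> multi_indices n d D"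
  shows "(\<integral>X. likelihood_ratio (null_dist n d) (alt_dist n d \<epsilon> \<alpha>) X * hermite_prod n d m X \<partial>null_dist n d)
       = (\<integral>v. direction_coeff n d (mix_moment \<epsilon> \<alpha>) m v \<partial>uniform_sphere d)"
proof -
  interpret U: prob_space "uniform_sphere d" by (rule prob_space_uniform_sphere)
  interpret N: prob_space "null_dist n d" by (rule prob_space_null_dist)
  interpret P: pair_sigma_finite "uniform_sphere d" "null_dist n d" ..
  let ?E = "\<lambda>X. \<Prod>i<n. \<Prod>j<d. envelope (\<alpha> / \<epsilon>) (X i j)"
  let ?h = "hermite_prod n d m"
  let ?f = "\<lambda>v X. sample_lr n d \<epsilon> \<alpha> v X * ?h X"
  have meas_lr [measurable]: "(\<lambda>(v, X). sample_lr n d \<epsilon> \<alpha> v X) \<in> borel_measurable (uniform_sphere d \<Otimes>\<^sub>M null_dist n d)"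
    using measurable_sample_lr by (simp cong: measurable_cong_sets)
  have meas [measurable]: "case_prod ?f \<in> borel_measurable (uniform_sphere d \<Otimes>\<^sub>M null_dist n d)"
    by measurable
  \<comment> \<open>The envelope product is square integrable, so its product with a Hermite product
    is an integrable bound, independent of the direction.\<close>
  have "square_integrable (null_dist n d) ?E"
  proof -
    have "integrable (null_dist n d) (\<lambda>X. \<Prod>i<n. \<Prod>j<d. (envelope (\<alpha> / \<epsilon>) (X i j))\<^sup>2)"
      by (intro null_dist_prod_integral integrable_envelope_sq)
    moreover have "envelope (\<alpha> / \<epsilon>) \<in> borel_measurable borel"
      unfolding envelope_def[abs_def] by measurable
    then have "?E \<in> borel_measurable (null_dist n d)"
      by (intro borel_measurable_prod measurable_compose[OF measurable_null_dist_component]) auto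
    ultimately show ?thesis by (simp add: square_integrable_def prod_power_distrib)
  qed
  then have Eh: "integrable (null_dist n d) (\<lambda>X. ?E X * ?h X)"
    using square_integrable_hermite_prod[OF m] by (rule square_integrable_mult)
  then have Eh': "integrable (null_dist n d) (\<lambda>X. norm (?E X * ?h X))" by (rule integrable_norm)
  have dom: "norm (?f v X) \<le> norm (?E X * ?h X)" if "L2_set v {..<d} \<le> 1" for v X
    using sample_lr_le_envelope[OF e a that, of n X] sample_lr_nonneg[OF e a, of n d v X]
    unfolding norm_mult by (intro mult_right_mono) auto
  have int: "integrable (null_dist n d) (?f v)" for v
    using sample_hermite_integral[of n d \<epsilon> \<alpha> v m] by (simp add: has_bochner_integral_iff)
  have "integrable (uniform_sphere d \<Otimes>\<^sub>M null_dist n d) (case_prod ?f)"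
  proof (rule P.Fubini_integrable[OF meas])
    show "AE v in uniform_sphere d. integrable (null_dist n d) (\<lambda>X. case_prod ?f (v, X))"
      using int by simp
    have "AE v in uniform_sphere d. (\<integral>X. norm (?f v X) \<partial>null_dist n d) \<le> (\<integral>X. norm (?E X * ?h X) \<partial>null_dist n d)"
      using AE_uniform_sphere[of d]
    proof eventually_elim
      case (elim v)
      show ?case by (rule integral_mono[OF integrable_norm[OF int] Eh' dom[OF elim]])
    qed
    then show "integrable (uniform_sphere d) (\<lambda>v. \<integral>X. norm (case_prod ?f (v, X)) \<partial>null_dist n d)"
      by (intro U.integrable_const_bound[where B = "\<integral>X. norm (?E X * ?h X) \<partial>null_dist n d"]) (auto simp: integral_nonneg_AE)
  qed
  then have "(\<integral>X. (\<integral>v. ?f v X \<partial>uniform_sphere d) \<partial>null_dist n d) = (\<integral>v. (\<integral>X. ?f v X \<partial>null_dist n d) \<partial>uniform_sphere d)"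
    by (rule P.Fubini_integral)
  also have "\<dots> = (\<integral>v. direction_coeff n d (mix_moment \<epsilon> \<alpha>) m v \<partial>uniform_sphere d)"
    using sample_hermite_integral[THEN has_bochner_integral_integral_eq] by simp
  also have "(\<integral>X. (\<integral>v. ?f v X \<partial>uniform_sphere d) \<partial>null_dist n d) = (\<integral>X. average_lr n d \<epsilon> \<alpha> X * ?h X \<partial>null_dist n d)"
    by (simp add: average_lr_def)
  also have "\<dots> = (\<integral>X. likelihood_ratio (null_dist n d) (alt_dist n d \<epsilon> \<alpha>) X * ?h X \<partial>null_dist n d)"
    using likelihood_ratio_eq_average_lr[OF e a, of n d]
      square_integrable_likelihood_ratio[OF e a, of n d] square_integrable_average_lr[OF e a, of n d]
    by (intro integral_cong_AE) (auto simp: square_integrable_def)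
  finally show ?thesis by simp
qed

text \<open>A squared mean is the mean of a product over independent copies \<open>v\<close> and
  \<open>w\<close>; summed over one level, the product collapses to a multiple of
  \<open>\<langle>v, w\<rangle>^k\<close>. The moment over \<open>v\<close> is then bounded for each
  fixed \<open>w\<close> in the unit ball.\<close>

lemma sum_coefficient_sq_le:
  assumes d: "d \<ge> 1" and k: "2 \<le> k" "k \<le> D"
  shows "(\<Sum>m\<in>{m \<in> index_box n d D. (\<Sum>i<n. \<Sum>j<d. m i j) = k}.
            (\<integral>v. direction_coeff n d \<kappa> m v \<partial>uniform_sphere d)\<^sup>2)
       \<le> coeff (weight_poly \<kappa> D ^ n) k * (4 * fact k / sqrt (real d) ^ k)"
proof -
  interpret prob_space "uniform_sphere d" by (rule prob_space_uniform_sphere)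
  let ?I = "{m \<in> index_box n d D. (\<Sum>i<n. \<Sum>j<d. m i j) = k}"
  let ?W = "coeff (weight_poly \<kappa> D ^ n) k"
  let ?\<phi> = "direction_coeff n d \<kappa>"
  have W: "?W \<ge> 0" by (intro coeff_power_nonneg coeff_weight_poly_nonneg)
  have inner: "(\<Sum>m\<in>?I. ?\<phi> m w * expectation (?\<phi> m)) = ?W * (\<integral>v. (\<Sum>j<d. v j * w j) ^ k \<partial>uniform_sphere d)" for w
  proof -
    have "(\<Sum>m\<in>?I. ?\<phi> m w * expectation (?\<phi> m)) = (\<integral>v. (\<Sum>m\<in>?I. ?\<phi> m w * ?\<phi> m v) \<partial>uniform_sphere d)"
      using integrable_direction_coeff by (simp add: Bochner_Integration.integral_sum)
    also have "(\<lambda>v. \<Sum>m\<in>?I. ?\<phi> m w * ?\<phi> m v) = (\<lambda>v. ?W * (\<Sum>j<d. v j * w j) ^ k)"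
    proof
      fix v
      have "(\<Sum>m\<in>?I. ?\<phi> m w * ?\<phi> m v)
          = (\<Sum>m\<in>?I. \<Prod>i<n. (\<kappa> (\<Sum>j<d. m i j))\<^sup>2 * (\<Prod>j<d. (v j * w j) ^ m i j / fact (m i j)))"
        unfolding direction_coeff_def
        by (intro sum.cong refl) (simp add: power2_eq_square power_mult_distrib mult_ac flip: prod.distrib)
      then show "(\<Sum>m\<in>?I. ?\<phi> m w * ?\<phi> m v) = ?W * (\<Sum>j<d. v j * w j) ^ k"
        using sum_multiindex_eq_coeff[OF k(2), where n = n and d = d and \<kappa> = \<kappa> and y = "\<lambda>j. v j * w j"] by simp
    qed
    finally show ?thesis by simp
  qed
  \<comment> \<open>Only one of the two expectations is opened as an integral over \<open>w\<close>;
    the other remains the inner integral over \<open>v\<close>, so the two copies appear as iterated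
    integrals.\<close>
  have "(\<Sum>m\<in>?I. (expectation (?\<phi> m))\<^sup>2) = (\<integral>w. (\<Sum>m\<in>?I. ?\<phi> m w * expectation (?\<phi> m)) \<partial>uniform_sphere d)"
    using integrable_direction_coeff by (simp add: Bochner_Integration.integral_sum power2_eq_square)
  also have "\<dots> \<le> ?W * (4 * fact k / sqrt (real d) ^ k)"
  proof (rule integral_le_const)
    show "integrable (uniform_sphere d) (\<lambda>w. \<Sum>m\<in>?I. ?\<phi> m w * expectation (?\<phi> m))"
      using integrable_direction_coeff by (intro Bochner_Integration.integrable_sum integrable_mult_left) auto
    show "AE w in uniform_sphere d. (\<Sum>m\<in>?I. ?\<phi> m w * expectation (?\<phi> m)) \<le> ?W * (4 * fact k / sqrt (real d) ^ k)"
      using AE_uniform_sphere[of d]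
    proof eventually_elim
      case (elim w)
      have "(\<integral>v. (\<Sum>j<d. v j * w j) ^ k \<partial>uniform_sphere d) \<le> \<bar>\<integral>v. (\<Sum>j<d. v j * w j) ^ k \<partial>uniform_sphere d\<bar>"
        by simp
      also have "\<dots> \<le> (\<integral>v. \<bar>\<Sum>j<d. v j * w j\<bar> ^ k \<partial>uniform_sphere d)"
        using integral_abs_bound[of "uniform_sphere d" "\<lambda>v. (\<Sum>j<d. v j * w j) ^ k"] by (simp add: power_abs)
      also have "\<dots> \<le> 4 * fact k / sqrt (real d) ^ k"
        by (rule sphere_linear_moment_le[OF d k(1) elim])
      finally show ?case unfolding inner using W by (rule mult_left_mono)
    qed
  qed
  finally show ?thesis .
qed

text \<open>Total degree \<open>1\<close> forces some row to have degree exactly \<open>1\<close>,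
  and its factor is \<open>\<kappa> 1 = 0\<close>.\<close>

lemma direction_coeff_eq_0:
  assumes "\<kappa> 1 = 0" "(\<Sum>i<n. \<Sum>j<d. m i j) = 1"
  shows "direction_coeff n d \<kappa> m v = 0"
proof -
  have "\<exists>i<n. (\<Sum>j<d. m i j) = 1"
  proof (rule ccontr)
    assume no: "\<not> ?thesis"
    obtain i where i: "i < n" "(\<Sum>j<d. m i j) \<noteq> 0"
      using assms(2) by (metis (no_types, lifting) lessThan_iff sum.neutral zero_neq_one)
    have "(\<Sum>j<d. m i j) \<le> (\<Sum>i<n. \<Sum>j<d. m i j)"
      using i by (intro member_le_sum[where f = "\<lambda>i. \<Sum>j<d. m i j"]) auto
    then have "(\<Sum>j<d. m i j) = 1" using i(2) unfolding assms(2) by linarith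
    then show False using i(1) no by blast
  qed
  then obtain i where "i < n" "\<kappa> (\<Sum>j<d. m i j) = 0" using assms(1) by metis
  then show ?thesis
    unfolding direction_coeff_def by (intro prod_zero) auto
qed

text \<open>Parseval's identity for the projection minus the constant \<open>1\<close>, which is the
  Hermite product of the zero index \<open>z\<close>. The likelihood ratio also has coefficient
  \<open>1\<close> there, so exactly this term cancels.\<close>

lemma truncated_LR_norm_sq:
  assumes e: "0 < \<epsilon>" "\<epsilon> \<le> 1" and a: "0 < \<alpha>"
  shows "(\<integral>X. (truncated_LR n d \<epsilon> \<alpha> D X - 1)\<^sup>2 \<partial>null_dist n d)
       = (\<Sum>m\<in>{m \<in> multi_indices n d D. (\<Sum>i<n. \<Sum>j<d. m i j) \<noteq> 0}.
            (\<integral>v. direction_coeff n d (mix_moment \<epsilon> \<alpha>) m v \<partial>uniform_sphere d)\<^sup>2)"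
proof -
  interpret U: prob_space "uniform_sphere d" by (rule prob_space_uniform_sphere)
  let ?M = "null_dist n d" and ?V = "polynomials_upto n d D" and ?B = "multi_indices n d D"
  let ?L = "likelihood_ratio ?M (alt_dist n d \<epsilon> \<alpha>)"
  let ?\<phi> = "\<lambda>m. \<integral>v. direction_coeff n d (mix_moment \<epsilon> \<alpha>) m v \<partial>uniform_sphere d"
  note basis = finite_multi_indices square_integrable_hermite_prod hermite_prod_orthonormal(2)
    polynomials_upto_eq_hermite_span
  have "\<exists>p. is_L2_projection ?M ?V ?L p"
    by (rule L2_projection_exists[OF basis square_integrable_likelihood_ratio[OF e a]])
  then have proj: "is_L2_projection ?M ?V ?L (truncated_LR n d \<epsilon> \<alpha> D)"
    unfolding truncated_LR_def L2_projection_def by (rule someI_ex)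
  define z where "z = (\<lambda>i\<in>{..<n}. \<lambda>j\<in>{..<d}. 0 :: nat)"
  have z: "z \<in> ?B" by (auto simp: z_def multi_indices_def)
  have hz: "hermite_prod n d z = (\<lambda>_. 1)" by (auto simp: hermite_prod_def z_def)
  have tot0: "(\<Sum>i<n. \<Sum>j<d. m i j) = 0 \<longleftrightarrow> m = z" if "m \<in> ?B" for m
  proof
    assume "(\<Sum>i<n. \<Sum>j<d. m i j) = 0"
    then show "m = z" by (intro multi_indices_eqI[OF that z]) (auto simp: z_def)
  qed (simp add: z_def)
  have one: "(\<lambda>_. 1) \<in> ?V" using hermite_prod_in_polynomials_upto[OF z] by (simp add: hz)
  have dz: "?\<phi> z = 1"
    by (simp add: direction_coeff_def z_def mix_moment_0 U.prob_space)
  have "(\<integral>X. (truncated_LR n d \<epsilon> \<alpha> D X - 1)\<^sup>2 \<partial>?M)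
      = (\<Sum>m\<in>?B. ((\<integral>X. ?L X * hermite_prod n d m X \<partial>?M) - (\<integral>X. 1 * hermite_prod n d m X \<partial>?M))\<^sup>2)"
    by (rule L2_projection_diff_norm[OF basis proj one])
  also have "\<dots> = (\<Sum>m\<in>?B. (?\<phi> m - of_bool (m = z))\<^sup>2)"
  proof (intro sum.cong refl)
    fix m assume m: "m \<in> ?B"
    have "(\<integral>X. 1 * hermite_prod n d m X \<partial>?M) = of_bool (m = z)"
      using hermite_prod_orthonormal(2)[OF z m] by (simp add: hz eq_commute)
    then show "((\<integral>X. ?L X * hermite_prod n d m X \<partial>?M) - (\<integral>X. 1 * hermite_prod n d m X \<partial>?M))\<^sup>2
        = (?\<phi> m - of_bool (m = z))\<^sup>2"
      using likelihood_ratio_coefficient[OF e a m] by simp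
  qed
  also have "\<dots> = (\<Sum>m\<in>{m \<in> ?B. (\<Sum>i<n. \<Sum>j<d. m i j) \<noteq> 0}. (?\<phi> m)\<^sup>2)"
  proof -
    have "{m \<in> ?B. (\<Sum>i<n. \<Sum>j<d. m i j) \<noteq> 0} = {m \<in> ?B. m \<noteq> z}"
      by (intro Collect_cong conj_cong refl) (simp only: tot0)
    also have "\<dots> = ?B - {z}" by auto
    finally have "{m \<in> ?B. (\<Sum>i<n. \<Sum>j<d. m i j) \<noteq> 0} = ?B - {z}" .
    moreover have "(\<Sum>m\<in>?B - {z}. (?\<phi> m - of_bool (m = z))\<^sup>2) = (\<Sum>m\<in>?B - {z}. (?\<phi> m)\<^sup>2)"
      by (intro sum.cong) auto
    ultimately show ?thesis
      using sum.remove[OF finite_multi_indices z, of "\<lambda>m. (?\<phi> m - of_bool (m = z))\<^sup>2"]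
      by (simp only: dz) simp
  qed
  finally show ?thesis .
qed

section \<open>Summation over levels and the explicit bound\<close>

lemma sum_by_level:
  fixes f :: "'a \<Rightarrow> nat"
  assumes "finite S"
  shows "(\<Sum>m\<in>{m \<in> {m \<in> S. f m \<le> D}. f m \<noteq> 0}. h m) = (\<Sum>k\<in>{1..D}. \<Sum>m\<in>{m \<in> S. f m = k}. h m)"
proof -
  have "{m \<in> {m \<in> S. f m \<le> D}. f m \<noteq> 0} = (\<Union>k\<in>{1..D}. {m \<in> S. f m = k})" by auto
  then show ?thesis using assms by (simp only:) (intro sum.UNION_disjoint, auto)
qed

lemma truncated_LR_bound:
  fixes n d D :: nat and \<epsilon> \<alpha> :: real
  assumes d: "d \<ge> 1" and e: "0 < \<epsilon>" "\<epsilon> \<le> 1" and a: "0 < \<alpha>" and D: "D > 1"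
  defines "A \<equiv> sqrt (real n) * \<alpha>\<^sup>2 / (sqrt (real d) * \<epsilon>)"
    and "B \<equiv> \<alpha>\<^sup>2 / (sqrt (real d) * \<epsilon>\<^sup>2)"
  shows "L2_norm (null_dist n d) (\<lambda>X. truncated_LR n d \<epsilon> \<alpha> D X - 1)
       \<le> real D powr (3 * real D) * A * exp (A + B)"
proof -
  let ?\<kappa> = "mix_moment \<epsilon> \<alpha>"
  let ?\<phi> = "\<lambda>m. \<integral>v. direction_coeff n d ?\<kappa> m v \<partial>uniform_sphere d"
  let ?tot = "\<lambda>m. \<Sum>i<n. \<Sum>j<d. m i j"
  let ?I = "\<lambda>k. {m \<in> index_box n d D. ?tot m = k}"
  define T where "T = real D * exp (real D) * A\<^sup>2 * exp (A + B)"
  have A0: "A \<ge> 0" and B0: "B \<ge> 0" using e by (auto simp: A_def B_def)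
  have "(\<integral>X. (truncated_LR n d \<epsilon> \<alpha> D X - 1)\<^sup>2 \<partial>null_dist n d)
      = (\<Sum>m\<in>{m \<in> multi_indices n d D. ?tot m \<noteq> 0}. (?\<phi> m)\<^sup>2)"
    by (rule truncated_LR_norm_sq[OF e a])
  also have "\<dots> = (\<Sum>k\<in>{1..D}. \<Sum>m\<in>?I k. (?\<phi> m)\<^sup>2)"
    unfolding multi_indices_def by (rule sum_by_level[OF finite_index_box])
  \<comment> \<open>The two factorials bound \<open>fact k\<close>, from the spherical moment, and
    \<open>fact (k - 2)\<close>, from the weight coefficient, uniformly in the level.\<close>
  also have "\<dots> \<le> (\<Sum>k\<in>{1..D}. 4 * fact D * fact D * T)"
  proof (intro sum_mono)
    fix k assume "k \<in> {1..D}"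
    then consider "k = 1" | "2 \<le> k" "k \<le> D" by force
    then show "(\<Sum>m\<in>?I k. (?\<phi> m)\<^sup>2) \<le> 4 * fact D * fact D * T"
    proof cases
      case 1
      have "(\<Sum>m\<in>?I k. (?\<phi> m)\<^sup>2) = 0"
      proof (intro sum.neutral ballI)
        fix m assume "m \<in> ?I k"
        then have "?tot m = 1" unfolding 1 by blast
        then have "direction_coeff n d ?\<kappa> m v = 0" for v
          using e by (intro direction_coeff_eq_0 mix_moment_1) auto
        then show "(?\<phi> m)\<^sup>2 = 0" by simp
      qed
      then show ?thesis by (simp add: T_def)
    next
      case 2
      have "(\<Sum>m\<in>?I k. (?\<phi> m)\<^sup>2) \<le> coeff (weight_poly ?\<kappa> D ^ n) k * (4 * fact k / sqrt (real d) ^ k)"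
        by (rule sum_coefficient_sq_le[OF d 2])
      also have "\<dots> = 4 * fact k * (coeff (weight_poly ?\<kappa> D ^ n) k / sqrt (real d) ^ k)"
        by simp
      also have "\<dots> \<le> 4 * fact k * (real D * exp (real D) * A\<^sup>2 * (fact (k - 2) * exp (A + B)))"
        unfolding A_def B_def by (intro mult_left_mono weight_coeff_bound e a d 2) simp
      also have "\<dots> = 4 * fact k * fact (k - 2) * T" by (simp add: T_def)
      also have "\<dots> \<le> 4 * fact D * fact D * T"
        using 2 by (intro mult_right_mono mult_mono fact_mono) (auto simp: T_def)
      finally show ?thesis .
    qed
  qed
  also have "\<dots> = 4 * (real D)\<^sup>2 * exp (real D) * (fact D)\<^sup>2 * (A\<^sup>2 * exp (A + B))"
    by (simp add: T_def power2_eq_square)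
  \<comment> \<open>For \<open>D \<ge> 2\<close> each of \<open>4 * (real D)\<^sup>2\<close>,
    \<open>exp (real D)\<close> and \<open>(fact D)\<^sup>2\<close> is at most
    \<open>real D ^ (2 * D)\<close>. Squaring the exponential, which is at least \<open>1\<close>,
    makes the right side a perfect square.\<close>
  also have "\<dots> \<le> real D ^ (6 * D) * (A\<^sup>2 * (exp (A + B))\<^sup>2)"
  proof (intro mult_mono)
    have D2: "2 \<le> real D" using D by simp
    have "4 * (real D)\<^sup>2 \<le> real D ^ (2 * D)"
    proof -
      have "4 \<le> (real D)\<^sup>2" using power_mono[OF D2, of 2] by simp
      then have "4 * (real D)\<^sup>2 \<le> (real D)\<^sup>2 * (real D)\<^sup>2" by (intro mult_right_mono) auto
      also have "\<dots> = real D ^ 4" by (simp flip: power_add)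
      also have "\<dots> \<le> real D ^ (2 * D)" using D by (intro power_increasing) auto
      finally show ?thesis .
    qed
    moreover have "exp (real D) \<le> real D ^ (2 * D)"
    proof -
      have "exp (1::real) \<le> (real D)\<^sup>2" using exp_le power_mono[OF D2, of 2] by simp
      then have "exp 1 ^ D \<le> ((real D)\<^sup>2) ^ D" by (intro power_mono) auto
      then show ?thesis by (simp add: power_mult flip: exp_of_nat_mult)
    qed
    moreover have "(fact D)\<^sup>2 \<le> real D ^ (2 * D)"
    proof -
      have "fact D \<le> real D ^ D" using fact_le_power[of D, where 'a = real] by simp
      then have "(fact D)\<^sup>2 \<le> (real D ^ D)\<^sup>2" by (intro power_mono) auto
      then show ?thesis by (simp add: mult.commute flip: power_mult)
    qed
    ultimately have "4 * (real D)\<^sup>2 * exp (real D) * (fact D)\<^sup>2 \<le> real D ^ (2 * D) * real D ^ (2 * D) * real D ^ (2 * D)"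
      by (intro mult_mono) auto
    then show "4 * (real D)\<^sup>2 * exp (real D) * (fact D)\<^sup>2 \<le> real D ^ (6 * D)"
      by (simp flip: power_add)
    have "exp (A + B) * 1 \<le> exp (A + B) * exp (A + B)"
      using A0 B0 by (intro mult_left_mono) auto
    then show "exp (A + B) \<le> (exp (A + B))\<^sup>2" by (simp add: power2_eq_square)
  qed (use A0 in auto)
  also have "real D ^ (6 * D) = (real D powr (3 * real D))\<^sup>2"
  proof -
    have "real D powr (3 * real D) = real D ^ (3 * D)"
      using D by (subst powr_realpow[symmetric]) auto
    then show ?thesis by (simp flip: power_mult)
  qed
  also have "(real D powr (3 * real D))\<^sup>2 * (A\<^sup>2 * (exp (A + B))\<^sup>2) = (real D powr (3 * real D) * A * exp (A + B))\<^sup>2"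
    by (simp add: power_mult_distrib)
  finally show ?thesis
    unfolding L2_norm_def using A0 by (intro real_le_lsqrt) auto
qed

theorem theorem9p1:
  shows
    "(\<exists>C>0. \<forall>(n::nat) (d::nat) (D::nat) (\<epsilon>::real) (\<alpha>::real).
        d \<ge> 1 \<longrightarrow> 0 < \<epsilon> \<longrightarrow> \<epsilon> \<le> 1 \<longrightarrow> 0 < \<alpha> \<longrightarrow> D > 1 \<longrightarrow>
        L2_norm (null_dist n d) (\<lambda>X. truncated_LR n d \<epsilon> \<alpha> D X - 1)
          \<le> real D powr (C * real D) * (sqrt (real n) * \<alpha>\<^sup>2 / (sqrt (real d) * \<epsilon>))
             * exp (sqrt (real n) * \<alpha>\<^sup>2 / (sqrt (real d) * \<epsilon>) + \<alpha>\<^sup>2 / (sqrt (real d) * \<epsilon>\<^sup>2)))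
     \<and>
     (\<exists>C>0. \<forall>(n::nat \<Rightarrow> nat) (d::nat \<Rightarrow> nat) (D::nat \<Rightarrow> nat) (\<epsilon>::nat \<Rightarrow> real) (\<alpha>::nat \<Rightarrow> real).
        (\<forall>k. d k \<ge> 1 \<and> 0 < \<epsilon> k \<and> \<epsilon> k \<le> 1 \<and> 0 < \<alpha> k \<and> D k > 1) \<longrightarrow>
        (\<lambda>k. real (n k)) \<in>
          o(\<lambda>k. real (D k) powr (- (C * real (D k))) * (real (d k) * (\<epsilon> k)\<^sup>2 / (\<alpha> k) ^ 4)) \<longrightarrow>
        (\<forall>k. real (n k) \<ge> sqrt (real (d k)) / (\<alpha> k)\<^sup>2) \<longrightarrow>
        (\<lambda>k. L2_norm (null_dist (n k) (d k))
               (\<lambda>X. truncated_LR (n k) (d k) (\<epsilon> k) (\<alpha> k) (D k) X - 1)) \<in> o(\<lambda>_. 1))"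
proof (intro conjI)
  show "\<exists>C>0. \<forall>(n::nat) (d::nat) (D::nat) (\<epsilon>::real) (\<alpha>::real).
        d \<ge> 1 \<longrightarrow> 0 < \<epsilon> \<longrightarrow> \<epsilon> \<le> 1 \<longrightarrow> 0 < \<alpha> \<longrightarrow> D > 1 \<longrightarrow>
        L2_norm (null_dist n d) (\<lambda>X. truncated_LR n d \<epsilon> \<alpha> D X - 1)
          \<le> real D powr (C * real D) * (sqrt (real n) * \<alpha>\<^sup>2 / (sqrt (real d) * \<epsilon>))
             * exp (sqrt (real n) * \<alpha>\<^sup>2 / (sqrt (real d) * \<epsilon>) + \<alpha>\<^sup>2 / (sqrt (real d) * \<epsilon>\<^sup>2))"
    using truncated_LR_bound by (intro exI[of _ 3]) auto
next
  show "\<exists>C>0. \<forall>(n::nat \<Rightarrow> nat) (d::nat \<Rightarrow> nat) (D::nat \<Rightarrow> nat) (\<epsilon>::nat \<Rightarrow> real) (\<alpha>::nat \<Rightarrow> real).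
        (\<forall>k. d k \<ge> 1 \<and> 0 < \<epsilon> k \<and> \<epsilon> k \<le> 1 \<and> 0 < \<alpha> k \<and> D k > 1) \<longrightarrow>
        (\<lambda>k. real (n k)) \<in>
          o(\<lambda>k. real (D k) powr (- (C * real (D k))) * (real (d k) * (\<epsilon> k)\<^sup>2 / (\<alpha> k) ^ 4)) \<longrightarrow>
        (\<forall>k. real (n k) \<ge> sqrt (real (d k)) / (\<alpha> k)\<^sup>2) \<longrightarrow>
        (\<lambda>k. L2_norm (null_dist (n k) (d k))
               (\<lambda>X. truncated_LR (n k) (d k) (\<epsilon> k) (\<alpha> k) (D k) X - 1)) \<in> o(\<lambda>_. 1)"
  \<comment> \<open>The constant doubles from \<open>3\<close> to \<open>6\<close> because the
    hypothesis on \<open>n\<close> controls \<open>A\<^sup>2\<close>, while the bound contains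
    \<open>A\<close>.\<close>
  proof (intro exI[of _ 6] conjI allI impI)
    fix n d D :: "nat \<Rightarrow> nat" and \<epsilon> \<alpha> :: "nat \<Rightarrow> real"
    assume params: "\<forall>k. d k \<ge> 1 \<and> 0 < \<epsilon> k \<and> \<epsilon> k \<le> 1 \<and> 0 < \<alpha> k \<and> D k > 1"
      and small: "(\<lambda>k. real (n k)) \<in>
          o(\<lambda>k. real (D k) powr (- (6 * real (D k))) * (real (d k) * (\<epsilon> k)\<^sup>2 / (\<alpha> k) ^ 4))"
      and large: "\<forall>k. real (n k) \<ge> sqrt (real (d k)) / (\<alpha> k)\<^sup>2"
    let ?norm = "\<lambda>k. L2_norm (null_dist (n k) (d k))
               (\<lambda>X. truncated_LR (n k) (d k) (\<epsilon> k) (\<alpha> k) (D k) X - 1)"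
    show "?norm \<in> o(\<lambda>_. 1)"
    proof (rule landau_o.smallI)
      fix c :: real assume c: "c > 0"
      \<comment> \<open>The minimum with \<open>1\<close> ensures \<open>A \<le> 1\<close> and
        \<open>B \<le> 1\<close>, so the exponential is at most \<open>exp 2\<close>; the other
        entry then brings the product below \<open>c\<close>.\<close>
      define \<delta> where "\<delta> = min 1 (c / exp 2)"
      have \<delta>: "0 < \<delta>" "\<delta> \<le> 1" "\<delta> * exp 2 \<le> c" using c by (auto simp: \<delta>_def min_def field_simps)
      have "eventually (\<lambda>k. norm (real (n k))
          \<le> \<delta>\<^sup>2 * norm (real (D k) powr (- (6 * real (D k))) * (real (d k) * (\<epsilon> k)\<^sup>2 / (\<alpha> k) ^ 4))) at_top"
        using landau_o.smallD[OF small, of "\<delta>\<^sup>2"] \<delta> by simp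
      then show "eventually (\<lambda>k. norm (?norm k) \<le> c * norm (1::real)) at_top"
      proof eventually_elim
        case (elim k)
        have p: "d k \<ge> 1" "0 < \<epsilon> k" "\<epsilon> k \<le> 1" "0 < \<alpha> k" "D k > 1" using params by auto
        define A where "A = sqrt (real (n k)) * (\<alpha> k)\<^sup>2 / (sqrt (real (d k)) * \<epsilon> k)"
        define B where "B = (\<alpha> k)\<^sup>2 / (sqrt (real (d k)) * (\<epsilon> k)\<^sup>2)"
        define P where "P = real (D k) powr (3 * real (D k))"
        have P1: "P \<ge> 1" using p by (simp add: P_def ge_one_powr_ge_zero)
        have A0: "A \<ge> 0" using p by (simp add: A_def)
        have Asq: "A\<^sup>2 = real (n k) * ((\<alpha> k) ^ 4 / (real (d k) * (\<epsilon> k)\<^sup>2))"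
          by (simp add: A_def power_divide power_mult_distrib flip: power_mult)
        have P6: "real (D k) powr (- (6 * real (D k))) = 1 / P\<^sup>2"
          using p by (simp add: P_def powr_minus_divide powr_power)
        have "real (n k) \<le> \<delta>\<^sup>2 * (1 / P\<^sup>2 * (real (d k) * (\<epsilon> k)\<^sup>2 / (\<alpha> k) ^ 4))"
          using elim p unfolding P6 by simp
        then have "A\<^sup>2 \<le> \<delta>\<^sup>2 * (1 / P\<^sup>2 * (real (d k) * (\<epsilon> k)\<^sup>2 / (\<alpha> k) ^ 4)) * ((\<alpha> k) ^ 4 / (real (d k) * (\<epsilon> k)\<^sup>2))"
          unfolding Asq using p by (intro mult_right_mono) auto
        also have "\<dots> = \<delta>\<^sup>2 / P\<^sup>2" using p by simp
        finally have "A\<^sup>2 \<le> (\<delta> / P)\<^sup>2" by (simp add: power_divide)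
        then have A_le: "A \<le> \<delta> / P" by (rule power2_le_imp_le) (use \<delta> P1 in auto)
        then have PA: "P * A \<le> \<delta>" using P1 by (simp add: field_simps)
        have A1: "A \<le> 1"
        proof -
          have "A \<le> P * A" using A0 P1 by (simp add: mult_le_cancel_right1)
          then show ?thesis using PA \<delta> by simp
        qed
        \<comment> \<open>\<open>A\<^sup>2\<close> is \<open>n\<close> times a factor, and
          \<open>B\<close> is \<open>sqrt d / \<alpha>\<^sup>2\<close> times the same factor; the
          lower bound on \<open>n\<close> compares them.\<close>
        have "B \<le> A\<^sup>2"
        proof -
          have "B = sqrt (real (d k)) / (\<alpha> k)\<^sup>2 * ((\<alpha> k) ^ 4 / (real (d k) * (\<epsilon> k)\<^sup>2))"
          proof -
            have "s / a * (a * a / (s * s * q)) = a / (s * q)" if "s > 0" "a > 0" for s a q :: real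
              using that by (simp add: field_simps)
            from this[of "sqrt (real (d k))" "(\<alpha> k)\<^sup>2" "(\<epsilon> k)\<^sup>2"] show ?thesis
              unfolding B_def using p by (simp flip: power_add)
          qed
          also have "\<dots> \<le> A\<^sup>2"
            unfolding Asq using p large by (intro mult_right_mono) auto
          finally show ?thesis .
        qed
        also have "A\<^sup>2 \<le> 1" using A0 A1 by (intro power_le_one)
        finally have B1: "B \<le> 1" .
        have "?norm k \<le> P * A * exp (A + B)"
          unfolding P_def A_def B_def by (rule truncated_LR_bound[OF p])
        also have "\<dots> \<le> \<delta> * exp 2"
          using PA A0 A1 B1 \<delta> by (intro mult_mono) auto
        also have "\<dots> \<le> c" by (rule \<delta>)
        finally have "?norm k \<le> c" .
        moreover have "?norm k \<ge> 0" by (simp add: L2_norm_def)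
        ultimately show ?case by simp
      qed
    qed
  qed simp
qed

end
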